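(* Let $N\ge1$ and let $\mathrm{U}^{\circ}_z(\widehat{\mathfrak{gl}}_N)$ be the algebra over $\mathbb{C}[z,z^{-1}]$ defined below. Order the nonzero generators as follows: to each generator $t_{ia}^{(r)}$ or $\bar t_{ia}^{(r)}$ associate the triple $(i,a,r)$; a generator associated with $(i,a,r)$ precedes one associated with $(j,b,s)$ if $(i,a,r)<(j,b,s)$ lexicographically, and $t_{ia}^{(r)}$ precedes $\bar t_{ia}^{(r)}$ when both are nonzero. Consider the ordered monomials, i.e. products of generators taken in this order (with repetitions), excluding the zero generators $t_{ij}^{(0)}$ ($i<j$) and $\bar t_{ij}^{(0)}$ ($i>j$), and such that for each $i=1,\dots,N$ the monomial contains either a nonnegative power of $t_{ii}^{(0)}$ or a positive power of $\bar t_{ii}^{(0)}$ (but not both). These ordered monomials form a basis of $\mathrm{U}^{\circ}_z(\widehat{\mathfrak{gl}}_N)$ over $\mathbb{C}[z,z^{-1}]$.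
   Context: Let $z$ be an indeterminate and $E_{ij}$ the matrix units of size $N$. $R(u,v)=(u-v)\sum_{i\ne j}E_{ii}\otimes E_{jj}+(z^{-1}u-zv)\sum_iE_{ii}\otimes E_{ii}+(z^{-1}-z)u\sum_{i>j}E_{ij}\otimes E_{ji}+(z^{-1}-z)v\sum_{i<j}E_{ij}\otimes E_{ji}$. $\mathrm{U}^{\circ}_z(\widehat{\mathfrak{gl}}_N)$ is the associative $\mathbb{C}[z,z^{-1}]$-algebra with generators $t_{ij}^{(r)},\bar t_{ij}^{(r)}$ ($1\le i,j\le N$, $r\ge0$); with $t_{ij}(u)=\sum_rt_{ij}^{(r)}u^{-r}$, $\bar t_{ij}(u)=\sum_r\bar t_{ij}^{(r)}u^r$, $T(u)=\sum t_{ij}(u)\otimes E_{ij}$, $\overline T(u)=\sum\bar t_{ij}(u)\otimes E_{ij}$, the defining relations are $t_{ij}^{(0)}=\bar t_{ji}^{(0)}=0$ for $i<j$, $t_{ii}^{(0)}\bar t_{ii}^{(0)}=\bar t_{ii}^{(0)}t_{ii}^{(0)}=1$, and $R(u,v)T_1(u)T_2(v)=T_2(v)T_1(u)R(u,v)$, $R(u,v)\overline T_1(u)\overline T_2(v)=\overline T_2(v)\overline T_1(u)R(u,v)$, $R(u,v)\overline T_1(u)T_2(v)=T_2(v)\overline T_1(u)R(u,v)$ (with $T_1(u)=T(u)\otimes1$, $T_2(v)=1\otimes T(v)$, etc.). *)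

theory Defs
  imports Complex_Main "HOL-Library.Poly_Mapping" "HOL-Library.Product_Lexorder"
begin

text \<open>Coefficient ring: Laurent polynomials C[z,z^-1], realised as the group algebra
  of the integers over the complex numbers (finitely supported int to complex maps).\<close>
type_synonym laurent = "int \<Rightarrow>\<^sub>0 complex"

definition zL :: laurent where "zL = Poly_Mapping.single 1 1"
definition zLinv :: laurent where "zLinv = Poly_Mapping.single (-1) 1"

datatype gen = T nat nat nat | Tb nat nat nat

definition valid_gen :: "nat \<Rightarrow> gen \<Rightarrow> bool" where
  "valid_gen N g = (case g of T i j r \<Rightarrow> i \<in> {1..N} \<and> j \<in> {1..N}
                             | Tb i j r \<Rightarrow> i \<in> {1..N} \<and> j \<in> {1..N})"

definition valid_word :: "nat \<Rightarrow> gen list \<Rightarrow> bool" where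
  "valid_word N w = (\<forall>g\<in>set w. valid_gen N g)"

text \<open>Elements of the free associative algebra over laurent on the generators:
  coefficient functions on words (only finitely supported ones are considered).\<close>
type_synonym falg = "gen list \<Rightarrow> laurent"

definition mono :: "gen list \<Rightarrow> falg" where
  "mono w = (\<lambda>v. if v = w then 1 else 0)"

definition fadd :: "falg \<Rightarrow> falg \<Rightarrow> falg" where
  "fadd f g = (\<lambda>w. f w + g w)"

definition fsub :: "falg \<Rightarrow> falg \<Rightarrow> falg" where
  "fsub f g = (\<lambda>w. f w - g w)"

definition fzero :: falg where "fzero = (\<lambda>w. 0)"

definition fsc :: "laurent \<Rightarrow> falg \<Rightarrow> falg" where
  "fsc k f = (\<lambda>w. k * f w)"

definition fmul :: "falg \<Rightarrow> falg \<Rightarrow> falg" where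
  "fmul f g = (\<lambda>w. \<Sum>k\<in>{0..length w}. f (take k w) * g (drop k w))"

definition fsum :: "nat set \<Rightarrow> (nat \<Rightarrow> falg) \<Rightarrow> falg" where
  "fsum A F = (\<lambda>w. \<Sum>a\<in>A. F a w)"

definition G :: "bool \<Rightarrow> nat \<Rightarrow> nat \<Rightarrow> int \<Rightarrow> falg" where
  "G barred i j r = (if r < 0 then fzero
     else mono [if barred then Tb i j (nat r) else T i j (nat r)])"

text \<open>R(u,v) = sum over a,b,c,d of (Ru a b c d * u + Rv a b c d * v) E_ac (x) E_bd,
  i.e. the entry in row (a,b), column (c,d).\<close>
definition Ru :: "nat \<Rightarrow> nat \<Rightarrow> nat \<Rightarrow> nat \<Rightarrow> laurent" where
  "Ru a b c d =
    (if a = c \<and> b = d \<and> a \<noteq> b then 1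
     else if a = c \<and> b = d \<and> a = b then zLinv
     else if a = d \<and> b = c \<and> a > b then zLinv - zL
     else 0)"

definition Rv :: "nat \<Rightarrow> nat \<Rightarrow> nat \<Rightarrow> nat \<Rightarrow> laurent" where
  "Rv a b c d =
    (if a = c \<and> b = d \<and> a \<noteq> b then -1
     else if a = c \<and> b = d \<and> a = b then - zL
     else if a = d \<and> b = c \<and> a < b then zLinv - zL
     else 0)"

text \<open>Index shifts for extracting coefficients. For the series in u (first tensor factor):
  unbarred series are taken at coefficient u^(1-r), barred ones at u^r; for the series in v
  unbarred at v^(1-s), barred at v^s.  uterm = True refers to the summand u*(..) of R(u,v).\<close>
definition iu :: "bool \<Rightarrow> bool \<Rightarrow> nat \<Rightarrow> int" where
  "iu barred uterm r = (if barred then (if uterm then int r - 1 else int r)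
                        else (if uterm then int r else int r - 1))"

definition iv :: "bool \<Rightarrow> bool \<Rightarrow> nat \<Rightarrow> int" where
  "iv barred uterm s = (if barred then (if uterm then int s else int s - 1)
                        else (if uterm then int s - 1 else int s))"

text \<open>Coefficient of the (a,b),(j,l) matrix entry of
  R(u,v) X_1(u) Y_2(v) - Y_2(v) X_1(u) R(u,v)  at the (r,s)-th monomial in u,v.\<close>
definition RLL_rel :: "nat \<Rightarrow> bool \<Rightarrow> bool \<Rightarrow> nat \<Rightarrow> nat \<Rightarrow> nat \<Rightarrow> nat \<Rightarrow> nat \<Rightarrow> nat \<Rightarrow> falg" where
  "RLL_rel N X Y a b j l r s = fsub
     (fsum {1..N} (\<lambda>c. fsum {1..N} (\<lambda>d. fadd
        (fsc (Ru a b c d) (fmul (G X c j (iu X True r)) (G Y d l (iv Y True s))))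
        (fsc (Rv a b c d) (fmul (G X c j (iu X False r)) (G Y d l (iv Y False s)))))))
     (fsum {1..N} (\<lambda>c. fsum {1..N} (\<lambda>d. fadd
        (fsc (Ru c d j l) (fmul (G Y b d (iv Y True s)) (G X a c (iu X True r))))
        (fsc (Rv c d j l) (fmul (G Y b d (iv Y False s)) (G X a c (iu X False r)))))))"

inductive_set rels :: "nat \<Rightarrow> falg set" for N where
  zero_t: "\<lbrakk>i \<in> {1..N}; j \<in> {1..N}; i < j\<rbrakk> \<Longrightarrow> mono [T i j 0] \<in> rels N"
| zero_tb: "\<lbrakk>i \<in> {1..N}; j \<in> {1..N}; i < j\<rbrakk> \<Longrightarrow> mono [Tb j i 0] \<in> rels N"
| inv1: "i \<in> {1..N} \<Longrightarrow> fsub (fmul (mono [T i i 0]) (mono [Tb i i 0])) (mono []) \<in> rels N"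
| inv2: "i \<in> {1..N} \<Longrightarrow> fsub (fmul (mono [Tb i i 0]) (mono [T i i 0])) (mono []) \<in> rels N"
| rtt: "\<lbrakk>a \<in> {1..N}; b \<in> {1..N}; j \<in> {1..N}; l \<in> {1..N}\<rbrakk> \<Longrightarrow> RLL_rel N False False a b j l r s \<in> rels N"
| rtbtb: "\<lbrakk>a \<in> {1..N}; b \<in> {1..N}; j \<in> {1..N}; l \<in> {1..N}\<rbrakk> \<Longrightarrow> RLL_rel N True True a b j l r s \<in> rels N"
| rtbt: "\<lbrakk>a \<in> {1..N}; b \<in> {1..N}; j \<in> {1..N}; l \<in> {1..N}\<rbrakk> \<Longrightarrow> RLL_rel N True False a b j l r s \<in> rels N"

inductive_set rel_ideal :: "nat \<Rightarrow> falg set" for N where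
  base: "x \<in> rels N \<Longrightarrow> x \<in> rel_ideal N"
| zero: "fzero \<in> rel_ideal N"
| add: "\<lbrakk>x \<in> rel_ideal N; y \<in> rel_ideal N\<rbrakk> \<Longrightarrow> fadd x y \<in> rel_ideal N"
| mult: "\<lbrakk>x \<in> rel_ideal N; valid_word N w; valid_word N w'\<rbrakk>
          \<Longrightarrow> fsc k (fmul (mono w) (fmul x (mono w'))) \<in> rel_ideal N"

fun gkey :: "gen \<Rightarrow> nat \<times> nat \<times> nat \<times> nat" where
  "gkey (T i a r) = (i, a, r, 0)"
| "gkey (Tb i a r) = (i, a, r, 1)"

definition zero_gen :: "gen \<Rightarrow> bool" where
  "zero_gen g = (case g of T i j r \<Rightarrow> r = 0 \<and> i < j | Tb i j r \<Rightarrow> r = 0 \<and> i > j)"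

definition ordered_monomial :: "nat \<Rightarrow> gen list \<Rightarrow> bool" where
  "ordered_monomial N w =
     (valid_word N w \<and> sorted (map gkey w) \<and> (\<forall>g\<in>set w. \<not> zero_gen g) \<and>
      (\<forall>i\<in>{1..N}. \<not> (T i i 0 \<in> set w \<and> Tb i i 0 \<in> set w)))"

end

theory Submission
  imports Defs "HOL-Library.Function_Algebras" "HOL-Computational_Algebra.Formal_Power_Series"
    "HOL-Computational_Algebra.Polynomial"
begin

text \<open>
  Spanning. In every relation in which a product of two generators is out of order, the out-of-order
  products occur multiplied by \<open>u - v\<close> or \<open>z\<^sup>-\<^sup>1 u - z v\<close> (up to terms already treated), and these
  factors can be divided out over \<open>\<complex>[z, z\<^sup>-\<^sup>1]\<close> because the series are one-sided. Each such rewriting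
  lowers the key of the first letter, hence terminates.

  Independence. By the Yang--Baxter equation \<open>T(u) \<mapsto> R(u, a)\<close> is a representation; dividing by the
  scalar series \<open>1 - a/u\<close> makes all generators congruent to \<open>0\<close> or \<open>1\<close> modulo \<open>z - 1\<close>. With
  \<open>z = exp \<epsilon>\<close> the generators act on the tensor product of such representations, to first order in
  \<open>\<epsilon>\<close>, as the derivations given by a basis of the loop algebra of \<open>gl\<^sub>N\<close>, while the diagonal ones of
  degree zero act by \<open>exp (\<plusminus> \<epsilon> \<mu>\<^sub>i)\<close> on vectors of weight \<open>\<mu>\<close>. For sufficiently generic \<open>\<mu>\<close> the powers
  of the latter are independent, so a nontrivial relation yields nonzero coefficients \<open>F\<^sub>v\<close> in front of
  monomials \<open>v\<close> in the remaining generators. Among the \<open>v\<close> with the least \<open>ord F\<^sub>v + length v\<close> take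
  a longest one, and look at the matrix coefficient in which each letter of \<open>v\<close> changes its own tensor
  factor: in the lowest order of \<open>\<epsilon>\<close> only \<open>v\<close> itself contributes.
\<close>


section \<open>The free algebra and its relation ideal\<close>

text \<open>The Cartan letters \<open>T i i 0\<close> and \<open>Tb i i 0\<close> obstruct a plain
  leading-term argument: they act as 1 + O(\<epsilon>), so at lowest order all their powers look
  alike. Hence they are split off exactly, as exponentials in the weight, before anything is
  truncated. The resulting coefficients \<open>F v\<close> may be divisible by powers of \<epsilon>,
  since a Laurent polynomial may vanish at z = 1; this is why their order has to be added to the
  number of letters. The evaluation parameters are shifts of an integer label instead of numbers:
  the label records the degree of what acted in a factor, so generators of different degree are told
  apart. On the spanning side, the only RLL relation between barred and unbarred series has Tbar in
  front on its left. Products with T in front have to be extracted from its right-hand side, where R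
  acts on the column indices.\<close>

lemma fadd_eq_plus: "fadd f g = f + g"
  by (simp add: fadd_def fun_eq_iff)

lemma fsub_eq_minus: "fsub f g = f - g"
  by (simp add: fsub_def fun_eq_iff)

lemma fzero_eq_0: "fzero = 0"
  by (simp add: fzero_def fun_eq_iff)

lemmas falg_ops = fadd_eq_plus fsub_eq_minus fzero_eq_0

lemma fsc_simps [simp]:
  "fsc 1 f = f" "fsc 0 f = 0" "fsc k 0 = 0" "fsc (- k) f = - fsc k f" "fsc k (- f) = - fsc k f"
  "fsc k (fsc l f) = fsc (k * l) f"
  by (simp_all add: fsc_def fun_eq_iff ac_simps)

lemma fsc_distrib: "fsc k (f + g) = fsc k f + fsc k g" "fsc k (f - g) = fsc k f - fsc k g"
  "fsc (k + l) f = fsc k f + fsc l f"  "fsc (k - l) f = fsc k f - fsc l f"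
  by (simp_all add: fsc_def fun_eq_iff algebra_simps)

lemma fmul_mono_left:
  "fmul (mono u) f w =
     (if length u \<le> length w \<and> take (length u) w = u then f (drop (length u) w) else 0)"
proof -
  have "fmul (mono u) f w = (\<Sum>k\<in>{0..length w}. if k = length u
      then (if take (length u) w = u then f (drop (length u) w) else 0) else 0)"
    unfolding fmul_def mono_def by (rule sum.cong) auto
  also have "\<dots> = (if length u \<le> length w \<and> take (length u) w = u then f (drop (length u) w) else 0)"
    by (subst sum.delta) auto
  finally show ?thesis .
qed

lemma fmul_mono_right:
  "fmul f (mono v) w =
     (if length v \<le> length w \<and> drop (length w - length v) w = v
      then f (take (length w - length v) w) else 0)"
proof -
  have "fmul f (mono v) w = (\<Sum>k\<in>{0..length w}. if k = length w - length v
      then (if length v \<le> length w \<and> drop (length w - length v) w = v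
            then f (take (length w - length v) w) else 0) else 0)"
    unfolding fmul_def mono_def by (rule sum.cong) auto
  also have "\<dots> = (if length v \<le> length w \<and> drop (length w - length v) w = v
      then f (take (length w - length v) w) else 0)"
    by (subst sum.delta) auto
  finally show ?thesis .
qed

lemma fmul_mono_mono [simp]: "fmul (mono u) (mono v) = mono (u @ v)"
proof
  fix w
  have "length u \<le> length w \<and> take (length u) w = u \<and> drop (length u) w = v \<longleftrightarrow> w = u @ v"
    by (metis append_eq_conv_conj append_take_drop_id length_append le_add1)
  then show "fmul (mono u) (mono v) w = mono (u @ v) w"
    unfolding fmul_mono_left by (auto simp: mono_def)
qed

lemma fmul_mono_Nil [simp]: "fmul (mono []) f = f" "fmul f (mono []) = f"
  by (simp_all add: fun_eq_iff fmul_mono_left fmul_mono_right)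

lemma fmul_zero [simp]: "fmul 0 f = 0" "fmul f 0 = 0"
  by (simp_all add: fmul_def fun_eq_iff)

lemma fmul_linear:
  "fmul f (g + h) = fmul f g + fmul f h" "fmul (g + h) f = fmul g f + fmul h f"
  "fmul f (fsc k g) = fsc k (fmul f g)" "fmul (fsc k g) f = fsc k (fmul g f)"
  by (simp_all add: fmul_def fsc_def fun_eq_iff algebra_simps sum.distrib sum_distrib_left)

definition sandwich :: "gen list \<Rightarrow> falg \<Rightarrow> gen list \<Rightarrow> falg" where
  "sandwich u f v = fmul (mono u) (fmul f (mono v))"

lemma sandwich_simps:
  "sandwich u (f + g) v = sandwich u f v + sandwich u g v"
  "sandwich u (fsc k f) v = fsc k (sandwich u f v)"
  "sandwich u (mono w) v = mono (u @ w @ v)"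
  by (simp_all add: sandwich_def fmul_linear)

lemma rel_ideal_sandwich:
  "x \<in> rel_ideal N \<Longrightarrow> valid_word N u \<Longrightarrow> valid_word N v \<Longrightarrow> sandwich u x v \<in> rel_ideal N"
  using rel_ideal.mult[of x N u v 1] by (simp add: sandwich_def)

lemma rel_ideal_fsc: "x \<in> rel_ideal N \<Longrightarrow> fsc k x \<in> rel_ideal N"
  using rel_ideal.mult[of x N "[]" "[]" k] by (simp add: valid_word_def)

lemma rel_ideal_add: "x \<in> rel_ideal N \<Longrightarrow> y \<in> rel_ideal N \<Longrightarrow> x + y \<in> rel_ideal N"
  using rel_ideal.add[of x N y] by (simp add: falg_ops)

section \<open>Spanning\<close>

text \<open>A closure rather than a statement about coefficient functions, so that spans compose by
  induction (\<open>spanned_trans\<close>); in particular \<open>spanned N {}\<close> is the ideal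
  itself.\<close>

inductive_set spanned :: "nat \<Rightarrow> gen list set \<Rightarrow> falg set" for N S where
  spanned_ideal: "x \<in> rel_ideal N \<Longrightarrow> x \<in> spanned N S"
| spanned_mono: "w \<in> S \<Longrightarrow> mono w \<in> spanned N S"
| spanned_add: "x \<in> spanned N S \<Longrightarrow> y \<in> spanned N S \<Longrightarrow> x + y \<in> spanned N S"
| spanned_fsc: "x \<in> spanned N S \<Longrightarrow> fsc k x \<in> spanned N S"

lemma spanned_0 [simp]: "0 \<in> spanned N S"
  using rel_ideal.zero by (auto simp: falg_ops intro: spanned_ideal)

lemma spanned_zero_fun [simp]: "(\<lambda>_. 0) \<in> spanned N S"
  using spanned_0[of N S] by (simp only: zero_fun_def)

lemma spanned_minus: "x \<in> spanned N S \<Longrightarrow> - x \<in> spanned N S"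
  using spanned_fsc[of x N S "-1"] by simp

lemma spanned_diff: "x \<in> spanned N S \<Longrightarrow> y \<in> spanned N S \<Longrightarrow> x - y \<in> spanned N S"
  using spanned_add[OF _ spanned_minus, of x N S y] by simp

lemma spanned_trans:
  "x \<in> spanned N S \<Longrightarrow> (\<And>w. w \<in> S \<Longrightarrow> mono w \<in> spanned N S') \<Longrightarrow> x \<in> spanned N S'"
  by (induction rule: spanned.induct) (auto intro: spanned.intros)

lemma spanned_subset: "x \<in> spanned N S \<Longrightarrow> S \<subseteq> S' \<Longrightarrow> x \<in> spanned N S'"
  by (erule spanned_trans) (auto intro: spanned_mono)

lemma spanned_sandwich:
  assumes "x \<in> spanned N S" "valid_word N u" "valid_word N v"
  shows "sandwich u x v \<in> spanned N ((\<lambda>w. u @ w @ v) ` S)"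
  using assms
  by (induction rule: spanned.induct)
    (auto simp: sandwich_simps intro: rel_ideal_sandwich spanned.intros)

lemma spanned_imp_reduced:
  assumes "x \<in> spanned N S"
  shows "\<exists>c. finite {w. c w \<noteq> 0} \<and> (\<forall>w. c w \<noteq> 0 \<longrightarrow> w \<in> S) \<and> fsub x c \<in> rel_ideal N"
  using assms
proof (induction rule: spanned.induct)
  case (spanned_ideal x)
  then show ?case unfolding falg_ops by (intro exI[of _ 0]) simp
next
  case (spanned_mono w)
  have "finite {v. mono w v \<noteq> 0}" "\<forall>v. mono w v \<noteq> 0 \<longrightarrow> v \<in> S"
    using spanned_mono by (auto simp: mono_def)
  moreover have "fsub (mono w) (mono w) \<in> rel_ideal N"
    using rel_ideal.zero by (simp add: falg_ops)
  ultimately show ?case by blast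
next
  case (spanned_add x y)
 then obtain c d where c: "finite {w. c w \<noteq> 0}" "\<forall>w. c w \<noteq> 0 \<longrightarrow> w \<in> S" "x - c \<in> rel_ideal N"
    and d: "finite {w. d w \<noteq> 0}" "\<forall>w. d w \<noteq> 0 \<longrightarrow> w \<in> S" "y - d \<in> rel_ideal N"
    unfolding falg_ops by blast
  have "finite {w. (c + d) w \<noteq> 0}"
    by (rule finite_subset[of _ "{w. c w \<noteq> 0} \<union> {w. d w \<noteq> 0}"]) (use c d in auto)
  moreover have "\<forall>w. (c + d) w \<noteq> 0 \<longrightarrow> w \<in> S"
    using c(2) d(2) by (metis add.right_neutral plus_fun_apply)
  moreover have "(x + y) - (c + d) \<in> rel_ideal N"
    using rel_ideal_add[OF c(3) d(3)] by (simp add: algebra_simps)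
  ultimately show ?case unfolding falg_ops by blast
next
  case (spanned_fsc x k)
  then obtain c where c: "finite {w. c w \<noteq> 0}" "\<forall>w. c w \<noteq> 0 \<longrightarrow> w \<in> S" "x - c \<in> rel_ideal N"
    unfolding falg_ops by blast
  have "finite {w. fsc k c w \<noteq> 0}"
    by (rule finite_subset[of _ "{w. c w \<noteq> 0}"]) (use c in \<open>auto simp: fsc_def\<close>)
  moreover have "fsc k x - fsc k c \<in> rel_ideal N"
    using rel_ideal_fsc[OF c(3), of k] by (simp add: fsc_distrib)
  moreover have "\<forall>w. fsc k c w \<noteq> 0 \<longrightarrow> w \<in> S"
    using c(2) by (auto simp: fsc_def)
  ultimately show ?case unfolding falg_ops by blast
qed

lemma finite_support_expand:
  assumes "finite {w. f w \<noteq> 0}"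
  shows "f = (\<Sum>w\<in>{w. f w \<noteq> 0}. fsc (f w) (mono w))"
proof
  fix v
  have "(\<Sum>w\<in>{w. f w \<noteq> 0}. fsc (f w) (mono w)) v = (\<Sum>w\<in>{w. f w \<noteq> 0}. fsc (f w) (mono w) v)"
    by (induction rule: infinite_finite_induct) auto
  also have "\<dots> = (\<Sum>w\<in>{w. f w \<noteq> 0}. if w = v then f v else 0)"
    by (rule sum.cong) (auto simp: fsc_def mono_def)
  also have "\<dots> = f v" using assms(1) by simp
  finally show "f v = (\<Sum>w\<in>{w. f w \<noteq> 0}. fsc (f w) (mono w)) v" by (rule sym)
qed

lemma finite_support_spanned:
  assumes "finite {w. f w \<noteq> 0}" "\<And>w. f w \<noteq> 0 \<Longrightarrow> w \<in> S"
  shows "f \<in> spanned N S"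
proof -
  have "(\<Sum>w\<in>A. fsc (f w) (mono w)) \<in> spanned N S" if "finite A" "\<forall>w\<in>A. f w \<noteq> 0" for A
    using that
    by (induction A rule: finite_induct) (auto intro: spanned_add spanned_fsc spanned_mono assms)
  then show ?thesis
    using assms(1) finite_support_expand[OF assms(1)] by (metis (mono_tags, lifting) mem_Collect_eq)
qed

text \<open>R preserves the unordered pair of indices (ice rule), so each double sum has at most two
  terms. \<open>K\<close> is abstract because the coefficients of R act by \<open>fsc\<close> on the
  free algebra and by multiplication in the rings used later.\<close>

lemma sum_R_collapse:
  fixes K :: "laurent \<Rightarrow> 'b \<Rightarrow> 'b::comm_monoid_add"
  assumes "\<And>x. K 0 x = 0" "a \<in> {1..N}" "b \<in> {1..N}"
  shows "(\<Sum>c\<in>{1..N}. \<Sum>d\<in>{1..N}. K (Ru a b c d) (f c d)) =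
      (if a = b then K zLinv (f a a)
       else K 1 (f a b) + (if a > b then K (zLinv - zL) (f b a) else 0))" (is ?u)
    and "(\<Sum>c\<in>{1..N}. \<Sum>d\<in>{1..N}. K (Rv a b c d) (f c d)) =
      (if a = b then K (- zL) (f a a)
       else K (- 1) (f a b) + (if a < b then K (zLinv - zL) (f b a) else 0))" (is ?v)
    and "(\<Sum>c\<in>{1..N}. \<Sum>d\<in>{1..N}. K (Ru c d a b) (f c d)) =
      (if a = b then K zLinv (f a a)
       else K 1 (f a b) + (if a < b then K (zLinv - zL) (f b a) else 0))" (is ?u')
    and "(\<Sum>c\<in>{1..N}. \<Sum>d\<in>{1..N}. K (Rv c d a b) (f c d)) =
      (if a = b then K (- zL) (f a a)
       else K (- 1) (f a b) + (if a > b then K (zLinv - zL) (f b a) else 0))" (is ?v')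
proof -
  have collapse: "(\<Sum>c\<in>{1..N}. \<Sum>d\<in>{1..N}. K (R c d) (f c d)) =
      (if a = b then K (R a a) (f a a) else K (R a b) (f a b) + K (R b a) (f b a))"
    if "\<And>c d. (c, d) \<noteq> (a, b) \<Longrightarrow> (c, d) \<noteq> (b, a) \<Longrightarrow> R c d = 0" for R
  proof -
    have "(\<Sum>c\<in>{1..N}. \<Sum>d\<in>{1..N}. K (R c d) (f c d))
        = (\<Sum>(c,d)\<in>{1..N}\<times>{1..N}. K (R c d) (f c d))"
      by (simp add: sum.cartesian_product)
    also have "\<dots> = (\<Sum>(c,d)\<in>{(a,b),(b,a)}. K (R c d) (f c d))"
    proof (rule sum.mono_neutral_right)
      show "\<forall>x\<in>{1..N} \<times> {1..N} - {(a, b), (b, a)}. (case x of (c, d) \<Rightarrow> K (R c d) (f c d)) = 0"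
      proof
        fix x assume x: "x \<in> {1..N} \<times> {1..N} - {(a, b), (b, a)}"
        obtain c d where cd: "x = (c, d)" by (cases x)
        with x have "R c d = 0" by (intro that) auto
        then show "(case x of (c, d) \<Rightarrow> K (R c d) (f c d)) = 0" by (simp add: cd assms(1))
      qed
    qed (use assms in auto)
    also have "\<dots> = (if a = b then K (R a a) (f a a) else K (R a b) (f a b) + K (R b a) (f b a))"
      by auto
    finally show ?thesis .
  qed
  show ?u by (subst collapse) (auto simp: Ru_def assms)
  show ?v by (subst collapse) (auto simp: Rv_def assms)
  show ?u' by (subst collapse) (auto simp: Ru_def assms)
  show ?v' by (subst collapse) (auto simp: Rv_def assms)
qed

section \<open>Quadratic relations between coefficients\<close>

definition pair :: "bool \<Rightarrow> nat \<Rightarrow> nat \<Rightarrow> int \<Rightarrow> bool \<Rightarrow> nat \<Rightarrow> nat \<Rightarrow> int \<Rightarrow> falg" where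
  "pair X i a r Y j b s = fmul (G X i a r) (G Y j b s)"

lemma pair_neg [simp]: "r < 0 \<or> s < 0 \<Longrightarrow> pair X i a r Y j b s = 0"
  by (auto simp: pair_def G_def fzero_eq_0)

definition hbar :: laurent where "hbar = zLinv - zL"

text \<open>The Boolean passed to \<open>P\<close> and \<open>Q\<close> selects the u-summand of
  R(u,v) when true. The exchange term takes its factor u or v from the order of the rows on the left
  and of the columns on the right.\<close>

lemma RLL_rel_collapse:
  assumes "a \<in> {1..N}" "b \<in> {1..N}" "j \<in> {1..N}" "l \<in> {1..N}"
  defines "P \<equiv> \<lambda>i j k l t r s X Y. pair X i j (iu X t r) Y k l (iv Y t s)"
    and "Q \<equiv> \<lambda>k l i j t r s X Y. pair Y k l (iv Y t s) X i j (iu X t r)"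
  shows "RLL_rel N X Y a b j l r s =
    (if a = b then fsc zLinv (P a j b l True r s X Y) - fsc zL (P a j b l False r s X Y)
     else P a j b l True r s X Y - P a j b l False r s X Y + fsc hbar (P b j a l (a > b) r s X Y)) -
    (if j = l then fsc zLinv (Q b l a j True r s X Y) - fsc zL (Q b l a j False r s X Y)
     else Q b l a j True r s X Y - Q b l a j False r s X Y + fsc hbar (Q b j a l (l > j) r s X Y))"
proof -
  have fs: "fsum A F = (\<Sum>x\<in>A. F x)" if "finite A" for A F
    using that by (induction A rule: finite_induct) (auto simp: fsum_def fun_eq_iff)
  show ?thesis
    unfolding RLL_rel_def P_def Q_def pair_def falg_ops
    apply (simp only: fs finite_atLeastAtMost sum.distrib)
    apply (subst sum_R_collapse[where K=fsc, OF _ assms(1,2)], simp)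
    apply (subst sum_R_collapse[where K=fsc, OF _ assms(1,2)], simp)
    apply (subst sum_R_collapse[where K=fsc, OF _ assms(3,4)], simp)
    apply (subst sum_R_collapse[where K=fsc, OF _ assms(3,4)], simp)
    apply (auto simp: hbar_def)
    done
qed


lemma RLL_rel_in_ideal:
  assumes "a \<in> {1..N}" "b \<in> {1..N}" "j \<in> {1..N}" "l \<in> {1..N}" "X \<or> \<not> Y"
  shows "RLL_rel N X Y a b j l r s \<in> rel_ideal N"
  using assms by (cases X; cases Y) (auto intro!: rel_ideal.base rels.intros)

lemma zLinv_zL [simp]: "zLinv * zL = 1" "zL * zLinv = 1"
  by (simp_all add: zL_def zLinv_def mult_single)

lemma spanned_fsc_cancel:
  assumes "fsc k x \<in> spanned N S" "k' * k = 1"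
  shows "x \<in> spanned N S"
  using spanned_fsc[OF assms(1), of k'] assms(2) by simp

text \<open>Dividing by \<open>k1 u - k2 v\<close>: the coefficient recursion expresses the coefficient of degree
  \<open>r\<close> in \<open>u\<close> through those of degree \<open>r - 1\<close>.\<close>
lemma spanned_descent:
  fixes F :: "int \<Rightarrow> int \<Rightarrow> falg"
  assumes XY: "X \<or> \<not> Y"
    and neg: "\<And>r s. r < 0 \<or> s < 0 \<Longrightarrow> F r s = 0"
    and units: "k1' * k1 = 1" "k2' * k2 = 1"
    and rel: "\<And>r s. fsc k1 (F (iu X True r) (iv Y True s)) - fsc k2 (F (iu X False r) (iv Y False s))
                \<in> spanned N S"
  shows "F r s \<in> spanned N S"
proof -
  \<comment> \<open>The offset makes degree -1, where \<open>F\<close> vanishes, the base case;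
    \<open>s\<close> stays arbitrary because the recursion may raise it.\<close>
  have "F (int n - 1) s \<in> spanned N S" for n s
  proof (induction n arbitrary: s)
    case 0
    then show ?case by (simp add: neg)
  next
    case (Suc n)
    show ?case
    proof (cases "s < 0")
      case True
      then show ?thesis by (simp add: neg)
    next
      case False
      then obtain t where t: "s = int t" by (metis nat_0_le not_less)
      consider "\<not> X" "\<not> Y" | "X" "Y" | "X" "\<not> Y" using XY by blast
      then show ?thesis
      proof cases
        case 1
        from rel[of n "Suc t"] 1 have "fsc k1 (F n s) - fsc k2 (F (int n - 1) (s + 1)) \<in> spanned N S"
          by (simp add: iu_def iv_def t add.commute)
        from spanned_add[OF this spanned_fsc[OF Suc[of "s + 1"], of k2]]
        have "fsc k1 (F n s) \<in> spanned N S" by simp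
        then show ?thesis using spanned_fsc_cancel[OF _ units(1)] by simp
      next
        case 2
        from rel[of n "Suc t"] 2 have "fsc k1 (F (int n - 1) (s + 1)) - fsc k2 (F n s) \<in> spanned N S"
          by (simp add: iu_def iv_def t add.commute)
        from spanned_diff[OF spanned_fsc[OF Suc[of "s + 1"], of k1] this]
        have "fsc k2 (F n s) \<in> spanned N S" by simp
        then show ?thesis using spanned_fsc_cancel[OF _ units(2)] by simp
      next
        case 3
        from rel[of n t] 3 have "fsc k1 (F (int n - 1) (s - 1)) - fsc k2 (F n s) \<in> spanned N S"
          by (simp add: iu_def iv_def t)
        from spanned_diff[OF spanned_fsc[OF Suc[of "s - 1"], of k1] this]
        have "fsc k2 (F n s) \<in> spanned N S" by simp
        then show ?thesis using spanned_fsc_cancel[OF _ units(2)] by simp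
      qed
    qed
  qed
  from this[of "nat (r + 1)" s] show ?thesis
    by (cases "r < 0") (simp_all add: neg)
qed

text \<open>The coupling is triangular: the first equation gives \<open>F\<close> at (r, s) from
  lower degrees alone, the second then gives \<open>H\<close> at (r, s) from lower degrees and the
  \<open>F\<close> just found.\<close>

lemma spanned_descent2:
  fixes F H :: "int \<Rightarrow> int \<Rightarrow> falg"
  assumes neg: "\<And>r s. r < 0 \<or> s < 0 \<Longrightarrow> F r s = 0" "\<And>r s. r < 0 \<or> s < 0 \<Longrightarrow> H r s = 0"
    and rel: "\<And>r s. F (int r - 1) (int s - 1) - F (int r) (int s) + fsc k (H (int r - 1) (int s - 1))
                \<in> spanned N S"
      "\<And>r s. H (int r - 1) (int s - 1) - H (int r) (int s) + fsc k (F (int r) (int s)) \<in> spanned N S"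
  shows "F r s \<in> spanned N S \<and> H r s \<in> spanned N S"
proof -
  have "F (int n - 1) s \<in> spanned N S \<and> H (int n - 1) s \<in> spanned N S" for n s
  proof (induction n arbitrary: s)
    case 0
    then show ?case by (simp add: neg)
  next
    case (Suc n)
    show ?case
    proof (cases "s < 0")
      case True
      then show ?thesis by (simp add: neg)
    next
      case False
      then obtain t where t: "s = int t" by (metis nat_0_le not_less)
      have IH: "F (int n - 1) (s - 1) \<in> spanned N S" "H (int n - 1) (s - 1) \<in> spanned N S"
        using Suc by auto
      from spanned_diff[OF spanned_add[OF IH(1) spanned_fsc[OF IH(2), of k]] rel(1)[of n t]]
      have F: "F (int n) s \<in> spanned N S" by (simp add: t)
      from spanned_diff[OF spanned_add[OF IH(2) spanned_fsc[OF F, of k]] rel(2)[of n t]]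
      have "H (int n) s \<in> spanned N S" by (simp add: t)
      with F show ?thesis by simp
    qed
  qed
  from this[of "nat (r + 1)" s] show ?thesis
    by (cases "r < 0") (simp_all add: neg)
qed

definition low_row :: "nat \<Rightarrow> nat \<Rightarrow> gen list set" where
  "low_row N i = {[x, y] | x y. valid_gen N x \<and> valid_gen N y \<and> fst (gkey x) < i}"

definition low_col :: "nat \<Rightarrow> nat \<Rightarrow> nat \<Rightarrow> gen list set" where
  "low_col N i a = {[x, y] | x y. valid_gen N x \<and> valid_gen N y \<and>
     fst (gkey x) = i \<and> fst (snd (gkey x)) < a}"

lemma pair_low_row:
  assumes "i < k" "i \<in> {1..N}" "a \<in> {1..N}" "j \<in> {1..N}" "b \<in> {1..N}"
  shows "pair X i a r Y j b s \<in> spanned N (low_row N k)"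
  unfolding pair_def G_def fzero_eq_0
  using assms by (auto intro!: spanned_mono simp: low_row_def valid_gen_def)

lemma pair_low_col:
  assumes "a < k" "i \<in> {1..N}" "a \<in> {1..N}" "j \<in> {1..N}" "b \<in> {1..N}"
  shows "pair X i a r Y j b s \<in> spanned N (low_col N i k)"
  unfolding pair_def G_def fzero_eq_0
  using assms by (auto intro!: spanned_mono simp: low_col_def valid_gen_def)

text \<open>In the relation with rows \<open>i\<close>, \<open>j\<close> every product other than
  the one in question begins with row \<open>j\<close>, and that one carries the factor u -
  v.\<close>

lemma pair_row_descent:
  assumes ij: "i \<in> {1..N}" "j \<in> {1..N}" and ab: "a \<in> {1..N}" "b \<in> {1..N}"
    and "i > j" and XY: "X \<or> \<not> Y"
  shows "pair X i a r Y j b s \<in> spanned N (low_row N i)"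
proof -
  note low = pair_low_row[OF \<open>i > j\<close>] ij ab
  have rel: "pair X i a (iu X True r) Y j b (iv Y True s) -
      pair X i a (iu X False r) Y j b (iv Y False s) \<in> spanned N (low_row N i)" for r s
  proof -
    let ?Q = "if a = b
      then fsc zLinv (pair Y j b (iv Y True s) X i a (iu X True r)) -
           fsc zL (pair Y j b (iv Y False s) X i a (iu X False r))
      else pair Y j b (iv Y True s) X i a (iu X True r) - pair Y j b (iv Y False s) X i a (iu X False r) +
           fsc hbar (pair Y j a (iv Y (b > a) s) X i b (iu X (b > a) r))"
    have "?Q \<in> spanned N (low_row N i)"
      by (auto intro!: spanned_add spanned_diff spanned_fsc low)
    moreover have "RLL_rel N X Y i j a b r s \<in> spanned N (low_row N i)"
      using RLL_rel_in_ideal[OF ij ab XY] by (rule spanned_ideal)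
    moreover have "fsc hbar (pair X j a (iu X True r) Y i b (iv Y True s)) \<in> spanned N (low_row N i)"
      by (intro spanned_fsc low)
    ultimately have "RLL_rel N X Y i j a b r s + ?Q
        - fsc hbar (pair X j a (iu X True r) Y i b (iv Y True s)) \<in> spanned N (low_row N i)"
      by (intro spanned_add spanned_diff)
    then show ?thesis
      using \<open>i > j\<close> by (simp add: RLL_rel_collapse[OF ij ab])
  qed
  show ?thesis
    by (rule spanned_descent[where F = "\<lambda>r s. pair X i a r Y j b s", of X Y 1 1 1 1])
      (use assms rel in auto)
qed

text \<open>These products stand on the right-hand side of the mixed relation, where R exchanges
  columns: equal columns give a single recursion with factor z^-1 u - z v, unequal ones a coupled
  pair. The terms on the left begin with row \<open>j\<close>, or with a barred letter in row
  \<open>i\<close>, and are then covered by \<open>pair_row_descent\<close>.\<close>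

lemma pair_row_descent_mixed:
  assumes "i > j" and ij: "i \<in> {1..N}" "j \<in> {1..N}" and ab: "a \<in> {1..N}" "b \<in> {1..N}"
  shows "pair False i a r True j b s \<in> spanned N (low_row N i)"
proof -
  note low = pair_low_row[OF \<open>i > j\<close>]
  let ?S = "spanned N (low_row N i)"
  have P: "(if j = i then fsc zLinv (pair True j c (iu True True s) False i d (iv False True r)) -
           fsc zL (pair True j c (iu True False s) False i d (iv False False r))
      else pair True j c (iu True True s) False i d (iv False True r) -
           pair True j c (iu True False s) False i d (iv False False r) +
           fsc hbar (pair True i c (iu True (j > i) s) False j d (iv False (j > i) r))) \<in> ?S"
    if "c \<in> {1..N}" "d \<in> {1..N}" for c d r s
    using \<open>i > j\<close> that ij
    by (auto intro!: spanned_add spanned_diff spanned_fsc low pair_row_descent)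
  have rel: "(if c = d
      then fsc zLinv (pair False i d (iv False True r) True j c (iu True True s)) -
           fsc zL (pair False i d (iv False False r) True j c (iu True False s))
      else pair False i d (iv False True r) True j c (iu True True s) -
           pair False i d (iv False False r) True j c (iu True False s) +
           fsc hbar (pair False i c (iv False (d > c) r) True j d (iu True (d > c) s))) \<in> ?S"
    if "c \<in> {1..N}" "d \<in> {1..N}" for c d r s
    using spanned_diff[OF P[OF that, of s r] spanned_ideal[OF RLL_rel_in_ideal[OF ij(2,1) that, of True False s r]]]
    by (simp only: RLL_rel_collapse[OF ij(2,1) that] diff_diff_eq2 add_diff_cancel_left' simp_thms)
  have ne: "pair False i c s True j d r \<in> ?S \<and> pair False i d s True j c r \<in> ?S"
    if "c < d" "c \<in> {1..N}" "d \<in> {1..N}" for c d r s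
  proof -
    have "pair False i d s True j c r \<in> ?S \<and> pair False i c s True j d r \<in> ?S"
      by (rule spanned_descent2[where F = "\<lambda>r s. pair False i d s True j c r"
            and H = "\<lambda>r s. pair False i c s True j d r" and k = hbar])
        (use rel[OF that(2,3)] rel[OF that(3,2)] that(1) in \<open>auto simp: iu_def iv_def\<close>)
    then show ?thesis by blast
  qed
  show ?thesis
  proof (cases "a = b")
    case True
    have "(\<lambda>s r. pair False i a r True j b s) s r \<in> ?S"
      by (rule spanned_descent[of True False _ zL zLinv zLinv zL])
        (use rel[OF ab(2,1)] True in auto)
    then show ?thesis .
  next
    case False
    then show ?thesis using ne[of a b r s] ne[of b a r s] ab by (cases "a < b") auto
  qed
qed

text \<open>In the relation with equal rows and columns \<open>a < b\<close> only the products with the column \<open>b\<close>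
  in front are out of order.\<close>
lemma pair_col_descent_flip:
  assumes "a < b" "X \<or> \<not> Y" and i: "i \<in> {1..N}" and ab: "a \<in> {1..N}" "b \<in> {1..N}"
  shows "pair Y i b s X i a r \<in> spanned N (low_col N i b)"
proof -
  let ?S = "spanned N (low_col N i b)"
  note low = pair_low_col[OF \<open>a < b\<close>] i ab
  have rel: "pair Y i b (iv Y True s) X i a (iu X True r) -
      pair Y i b (iv Y False s) X i a (iu X False r) \<in> ?S" for r s
  proof -
    have "fsc zLinv (pair X i a (iu X True r) Y i b (iv Y True s)) -
        fsc zL (pair X i a (iu X False r) Y i b (iv Y False s)) -
        fsc hbar (pair Y i a (iv Y True s) X i b (iu X True r)) - RLL_rel N X Y i i a b r s \<in> ?S"
      by (intro spanned_diff spanned_fsc low spanned_ideal RLL_rel_in_ideal assms)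
    then show ?thesis using \<open>a < b\<close> by (simp add: RLL_rel_collapse[OF i i ab])
  qed
  have "(\<lambda>r s. pair Y i b s X i a r) r s \<in> ?S"
    by (rule spanned_descent[of X Y _ 1 1 1 1]) (use assms rel in auto)
  then show ?thesis .
qed

text \<open>The factor is now z^-1 u - z v, on the left. Besides products with column
  \<open>b\<close> in front, the right-hand side has one exchange term with an unbarred letter in
  column \<open>a\<close> in front; \<open>pair_col_descent_flip\<close> settles it.\<close>

lemma pair_col_descent_mixed:
  assumes "a > b" and i: "i \<in> {1..N}" and ab: "a \<in> {1..N}" "b \<in> {1..N}"
  shows "pair True i a r False i b s \<in> spanned N (low_col N i a)"
proof -
  let ?S = "spanned N (low_col N i a)"
  note low = pair_low_col[OF \<open>a > b\<close>] i ab
  have rel: "fsc zLinv (pair True i a (iu True True r) False i b (iv False True s)) -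
      fsc zL (pair True i a (iu True False r) False i b (iv False False s)) \<in> ?S" for r s
  proof -
    have "RLL_rel N True False i i a b r s +
        (pair False i b (iv False True s) True i a (iu True True r) -
         pair False i b (iv False False s) True i a (iu True False r) +
         fsc hbar (pair False i a (iv False False s) True i b (iu True False r))) \<in> ?S"
      by (intro spanned_add spanned_diff spanned_fsc low pair_col_descent_flip[OF \<open>a > b\<close>]
          spanned_ideal[OF RLL_rel_in_ideal] i ab) simp_all
    then show ?thesis using \<open>a > b\<close> by (simp add: RLL_rel_collapse[OF i i ab])
  qed
  show ?thesis
    by (rule spanned_descent[of True False "\<lambda>r s. pair True i a r False i b s" zL zLinv zLinv zL])
      (use rel in auto)
qed

text \<open>For equal rows and equal columns both sides of the relation carry the same scalar z^-1 u
  - z v, which is divided out of the commutator.\<close>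

lemma pair_commute:
  assumes "X \<or> \<not> Y" and i: "i \<in> {1..N}" and a: "a \<in> {1..N}"
  shows "pair X i a r Y i a s - pair Y i a s X i a r \<in> spanned N {}"
proof -
  have rel: "fsc zLinv (pair X i a (iu X True r) Y i a (iv Y True s) - pair Y i a (iv Y True s) X i a (iu X True r)) -
      fsc zL (pair X i a (iu X False r) Y i a (iv Y False s) - pair Y i a (iv Y False s) X i a (iu X False r))
      \<in> spanned N {}" for r s
    using spanned_ideal[OF RLL_rel_in_ideal[OF i i a a assms(1), of r s], of "{}"]
    by (simp add: RLL_rel_collapse[OF i i a a] fsc_distrib algebra_simps)
  show ?thesis
    by (rule spanned_descent[of X Y "\<lambda>r s. pair X i a r Y i a s - pair Y i a s X i a r" zL zLinv zLinv zL])
      (use rel assms in auto)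
qed

section \<open>Straightening of words\<close>

definition gen_of :: "bool \<Rightarrow> nat \<Rightarrow> nat \<Rightarrow> nat \<Rightarrow> gen" where
  "gen_of X i a r = (if X then Tb i a r else T i a r)"

lemma gen_of_cases: obtains X i a r where "x = gen_of X i a r"
  by (cases x) (metis gen_of_def)+

lemma gkey_gen_of: "gkey (gen_of X i a r) = (i, a, r, of_bool X)"
  by (simp add: gen_of_def)

lemma valid_gen_of: "valid_gen N (gen_of X i a r) \<longleftrightarrow> i \<in> {1..N} \<and> a \<in> {1..N}"
  by (simp add: gen_of_def valid_gen_def)

lemma mono_pair: "mono [gen_of X i a r, gen_of Y j b s] = pair X i a (int r) Y j b (int s)"
  by (simp add: pair_def G_def gen_of_def)

text \<open>Only the key of the first letter is controlled and the second may grow, which suffices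
  for a lexicographic descent among words of fixed length.\<close>

lemma straighten_pair:
  assumes "valid_gen N x" "valid_gen N y" "gkey y < gkey x"
  shows "mono [x, y] \<in> spanned N {[x', y'] | x' y'. valid_gen N x' \<and> valid_gen N y' \<and> gkey x' < gkey x}"
    (is "_ \<in> spanned N ?S")
proof -
  obtain X i a r where x: "x = gen_of X i a r" by (rule gen_of_cases)
  obtain Y j b s where y: "y = gen_of Y j b s" by (rule gen_of_cases)
  have v: "i \<in> {1..N}" "a \<in> {1..N}" "j \<in> {1..N}" "b \<in> {1..N}"
    using assms(1,2) by (auto simp: x y valid_gen_of)
  have row: "low_row N i \<subseteq> ?S"
    by (auto simp: low_row_def x gkey_gen_of less_prod_def)
  have col: "low_col N i a \<subseteq> ?S"
    by (auto simp: low_col_def x gkey_gen_of less_prod_def)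
  consider "j < i" | "j = i" "b < a" | "j = i" "b = a"
    using assms(3) unfolding x y gkey_gen_of less_prod_simp by linarith
  then show ?thesis
  proof cases
    case 1
    have "pair X i a r Y j b s \<in> spanned N (low_row N i)"
      using pair_row_descent[OF v(1,3,2,4) 1] pair_row_descent_mixed[OF 1 v(1,3,2,4)]
      by (cases X; cases Y) auto
    from spanned_subset[OF this row] show ?thesis by (simp add: x y mono_pair)
  next
    case 2
    have "pair X i a r Y i b s \<in> spanned N (low_col N i a)"
      using pair_col_descent_flip[OF 2(2) _ v(1,4,2)] pair_col_descent_mixed[OF 2(2) v(1,2,4)]
      by (cases X; cases Y) auto
    from spanned_subset[OF this col] show ?thesis by (simp add: x y 2 mono_pair)
  next
    case 3
    have comm: "pair X i a r Y i a s - pair Y i a s X i a r \<in> spanned N {}"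
    proof (cases "X \<or> \<not> Y")
      case True
      then show ?thesis by (rule pair_commute[OF _ v(1,2)])
    next
      case False
      then have "pair Y i a s X i a r - pair X i a r Y i a s \<in> spanned N {}"
        by (intro pair_commute[OF _ v(1,2)]) auto
      from spanned_minus[OF this] show ?thesis by simp
    qed
    have "mono [y, x] \<in> spanned N ?S"
      using assms by (intro spanned_mono) auto
    from spanned_add[OF spanned_subset[OF comm] this]
    show ?thesis by (simp add: x y 3 mono_pair)
  qed
qed

text \<open>The length comes first in the order because cancelling \<open>T i i 0\<close> against
  \<open>Tb i i 0\<close> removes two letters, while rewriting an inversion keeps the
  length.\<close>

lemma straighten_word:
  assumes "valid_word N w"
  shows "mono w \<in> spanned N {w. ordered_monomial N w}"
  using assms
proof (induction w rule: wf_induct_rule[OF wf_inv_image[OF wf_lenlex[OF wf], of "map gkey"]])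
  case (1 w)
  let ?S = "spanned N {w. ordered_monomial N w}"
  have IH: "mono v \<in> ?S" if "valid_word N v" "length v < length w \<or>
     length v = length w \<and> (map gkey v, map gkey w) \<in> lex {(x, y). x < y}" for v
    using 1(1)[of v] that by (auto simp: lenlex_conv)
  show ?case
  proof (cases "\<exists>g\<in>set w. zero_gen g")
    case True
    then obtain u g v where w: "w = u @ g # v" and g: "zero_gen g"
      by (meson split_list)
    have val: "valid_word N u" "valid_word N v" "valid_gen N g"
      using 1(2) by (auto simp: w valid_word_def)
    have "mono [g] \<in> rel_ideal N"
      using g val(3) by (auto simp: zero_gen_def valid_gen_def split: gen.splits
          intro!: rel_ideal.base rels.zero_t rels.zero_tb)
    from rel_ideal_sandwich[OF this val(1,2)] show ?thesis
      by (auto simp: sandwich_simps w intro: spanned_ideal)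
  next
    case nz: False
    show ?thesis
    proof (cases "sorted (map gkey w)")
      case False
      then obtain k where k: "Suc k < length w" "gkey (w ! Suc k) < gkey (w ! k)"
        by (auto simp: sorted_iff_nth_Suc not_le)
      define u v where "u = take k w" and "v = drop (Suc (Suc k)) w"
      have w: "w = u @ [w ! k, w ! Suc k] @ v"
        unfolding u_def v_def using k(1)
        by (metis Cons_nth_drop_Suc Suc_lessD append_Cons append_Nil append_take_drop_id)
      define x y where "x = w ! k" and "y = w ! Suc k"
      note w = w[folded x_def y_def]
      have val: "valid_word N u" "valid_word N v" "valid_gen N x" "valid_gen N y"
        using 1(2) by (subst (asm) w; auto simp: valid_word_def)+
      have "mono [x, y] \<in> spanned N {[x', y'] | x' y'. valid_gen N x' \<and> valid_gen N y' \<and> gkey x' < gkey x}"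
        using straighten_pair[OF val(3,4)] k(2) by (simp add: x_def y_def)
      from spanned_sandwich[OF this val(1,2)]
      have "mono w \<in> spanned N ((\<lambda>w. u @ w @ v) ` {[x', y'] | x' y'. valid_gen N x' \<and> valid_gen N y' \<and> gkey x' < gkey x})"
        by (subst w) (simp add: sandwich_simps)
      then show ?thesis
      proof (rule spanned_trans)
        fix w' assume "w' \<in> (\<lambda>w. u @ w @ v) ` {[x', y'] | x' y'. valid_gen N x' \<and> valid_gen N y' \<and> gkey x' < gkey x}"
        then obtain x' y' where w': "w' = u @ [x', y'] @ v" "valid_gen N x'" "valid_gen N y'" "gkey x' < gkey x"
          by auto
        have "(map gkey w', map gkey w) \<in> lex {(x, y). x < y}"
          unfolding w'(1) by (subst w) (use w'(4) in \<open>simp add: lex_append_leftI\<close>)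
        moreover have "length w' = length w" by (subst w) (simp add: w'(1))
        ultimately show "mono w' \<in> ?S"
          using w' val by (intro IH) (auto simp: valid_word_def)
      qed
    next
      case srt: True
      show ?thesis
      proof (cases "\<exists>i\<in>{1..N}. T i i 0 \<in> set w \<and> Tb i i 0 \<in> set w")
        case True
        then obtain i where i: "i \<in> {1..N}" "T i i 0 \<in> set w" "Tb i i 0 \<in> set w" by blast
        \<comment> \<open>In a sorted word nothing fits between the last \<open>T i i 0\<close> and
          the first \<open>Tb i i 0\<close>, whose keys are (i, i, 0, 0) and (i, i, 0, 1); so the
          two are adjacent.\<close>
        obtain u v where w: "w = u @ T i i 0 # v" and nv: "T i i 0 \<notin> set v"
          using split_list_last[OF i(2)] by auto
        have sv: "sorted (map gkey (T i i 0 # v))" and su: "\<forall>g\<in>set u. gkey g \<le> (i, i, 0, 0)"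
          using srt by (auto simp: w sorted_append)
        have "Tb i i 0 \<in> set v" using i(3) su by (force simp: w)
        then obtain g v' where v: "v = g # v'" by (cases v) auto
        have "gkey g \<le> (i, i, 0, 1)" "(i, i, 0, 0) \<le> gkey g"
          using sv \<open>Tb i i 0 \<in> set v\<close> by (auto simp: v)
        moreover have "g \<noteq> T i i 0" using nv by (auto simp: v)
        ultimately have g: "g = Tb i i 0"
          by (cases g) (auto simp: less_eq_prod_def split: if_splits)
        have val: "valid_word N u" "valid_word N v'"
          using 1(2) by (auto simp: w v valid_word_def)
        have "fsub (fmul (mono [T i i 0]) (mono [Tb i i 0])) (mono []) \<in> rel_ideal N"
          using i(1) by (intro rel_ideal.base rels.inv1)
        from spanned_ideal[OF rel_ideal_sandwich[OF this val]]
        have "mono (u @ [T i i 0, Tb i i 0] @ v') - mono (u @ v') \<in> ?S"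
          using sandwich_simps(1)[of u "mono [T i i 0, Tb i i 0] - mono []" "mono []" v']
          by (simp add: falg_ops sandwich_simps(3) algebra_simps)
        moreover have "mono (u @ v') \<in> ?S"
          using val by (intro IH) (auto simp: w v valid_word_def)
        ultimately show ?thesis using spanned_add by (fastforce simp: w v g)
      next
        case False
        then have "ordered_monomial N w"
          using 1(2) nz srt by (auto simp: ordered_monomial_def)
        then show ?thesis by (intro spanned_mono) auto
      qed
    qed
  qed
qed

lemma ordered_monomials_span:
  assumes "finite {w. f w \<noteq> 0}" "\<forall>w. f w \<noteq> 0 \<longrightarrow> valid_word N w"
  shows "\<exists>c. finite {w. c w \<noteq> 0} \<and> (\<forall>w. c w \<noteq> 0 \<longrightarrow> ordered_monomial N w) \<and> fsub f c \<in> rel_ideal N"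
proof -
  have "f \<in> spanned N {w. valid_word N w}"
    using assms by (intro finite_support_spanned) blast+
  then have "f \<in> spanned N {w. ordered_monomial N w}"
    by (rule spanned_trans) (use straighten_word in blast)
  from spanned_imp_reduced[OF this] show ?thesis by blast
qed


section \<open>Matrices over a ring subject to the RLL relation\<close>

definition central :: "'b::ring_1 \<Rightarrow> bool" where
  "central c \<longleftrightarrow> (\<forall>x. x * c = c * x)"

lemma centralD: "central c \<Longrightarrow> x * c = c * x"
  by (simp add: central_def)

lemma central_left_commute: "central c \<Longrightarrow> x * (c * y) = c * (x * y)"
  by (metis central_def mult.assoc)

lemma central_add: "central a \<Longrightarrow> central b \<Longrightarrow> central (a + b)"
  by (simp add: central_def algebra_simps)

lemma central_minus: "central a \<Longrightarrow> central (- a)"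
  by (simp add: central_def)

lemma central_mult: "central a \<Longrightarrow> central b \<Longrightarrow> central (a * b)"
  by (metis central_def mult.assoc)

lemma central_1 [simp]: "central 1"
  by (simp add: central_def)

text \<open>The elements \<open>\<alpha>\<close>, \<open>\<beta>\<close> stand for u, v up to a
  common unit; this freedom allows negative powers of the spectral variables to be cleared.\<close>

definition RLL :: "nat \<Rightarrow> (laurent \<Rightarrow> 'b::ring_1) \<Rightarrow> 'b \<Rightarrow> 'b \<Rightarrow> (nat \<Rightarrow> nat \<Rightarrow> 'b) \<Rightarrow> (nat \<Rightarrow> nat \<Rightarrow> 'b) \<Rightarrow> bool"
  where "RLL N \<kappa> \<alpha> \<beta> X Y \<longleftrightarrow> (\<forall>a\<in>{1..N}. \<forall>b\<in>{1..N}. \<forall>j\<in>{1..N}. \<forall>l\<in>{1..N}.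
    (\<Sum>c\<in>{1..N}. \<Sum>d\<in>{1..N}. (\<alpha> * \<kappa> (Ru a b c d) + \<beta> * \<kappa> (Rv a b c d)) * (X c j * Y d l)) =
    (\<Sum>c\<in>{1..N}. \<Sum>d\<in>{1..N}. (\<alpha> * \<kappa> (Ru c d j l) + \<beta> * \<kappa> (Rv c d j l)) * (Y b d * X a c)))"

lemma RLL_scale:
  assumes "RLL N \<kappa> \<alpha> \<beta> X Y" "central g" "central h"
  shows "RLL N \<kappa> \<alpha> \<beta> (\<lambda>i j. g * X i j) (\<lambda>i j. h * Y i j)"
  unfolding RLL_def
proof (intro ballI)
  fix a b j l assume *: "a \<in> {1..N}" "b \<in> {1..N}" "j \<in> {1..N}" "l \<in> {1..N}"
  let ?R = "\<lambda>a b c d. \<alpha> * \<kappa> (Ru a b c d) + \<beta> * \<kappa> (Rv a b c d)"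
  have scale: "r * (g * x * (h * y)) = g * h * (r * (x * y))" for r x y
    by (metis central_left_commute[OF assms(2)] central_left_commute[OF assms(3)] mult.assoc)
  have scale': "r * (h * x * (g * y)) = g * h * (r * (x * y))" for r x y
    by (metis central_left_commute[OF assms(2)] central_left_commute[OF assms(3)] mult.assoc)
  have "(\<Sum>c\<in>{1..N}. \<Sum>d\<in>{1..N}. ?R a b c d * (g * X c j * (h * Y d l))) =
      g * h * (\<Sum>c\<in>{1..N}. \<Sum>d\<in>{1..N}. ?R a b c d * (X c j * Y d l))"
    by (simp add: sum_distrib_left scale)
  also have "\<dots> = g * h * (\<Sum>c\<in>{1..N}. \<Sum>d\<in>{1..N}. ?R c d j l * (Y b d * X a c))"
    using assms(1) * unfolding RLL_def by simp
  also have "\<dots> = (\<Sum>c\<in>{1..N}. \<Sum>d\<in>{1..N}. ?R c d j l * (h * Y b d * (g * X a c)))"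
    by (simp add: sum_distrib_left scale')
  finally show "(\<Sum>c\<in>{1..N}. \<Sum>d\<in>{1..N}. ?R a b c d * (g * X c j * (h * Y d l))) =
    (\<Sum>c\<in>{1..N}. \<Sum>d\<in>{1..N}. ?R c d j l * (h * Y b d * (g * X a c)))" .
qed

lemma RLL_cancel:
  assumes "RLL N \<kappa> (g * \<alpha>) (g * \<beta>) X Y" "h * g = 1"
  shows "RLL N \<kappa> \<alpha> \<beta> X Y"
  unfolding RLL_def
proof (intro ballI)
  fix a b j l assume *: "a \<in> {1..N}" "b \<in> {1..N}" "j \<in> {1..N}" "l \<in> {1..N}"
  let ?R = "\<lambda>\<alpha> \<beta> a b c d. \<alpha> * \<kappa> (Ru a b c d) + \<beta> * \<kappa> (Rv a b c d)"
  have h: "h * (g * x) = x" for x using assms(2) by (metis mult.assoc mult_1)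
  have "h * (\<Sum>c\<in>{1..N}. \<Sum>d\<in>{1..N}. ?R (g * \<alpha>) (g * \<beta>) a b c d * (X c j * Y d l)) =
    h * (\<Sum>c\<in>{1..N}. \<Sum>d\<in>{1..N}. ?R (g * \<alpha>) (g * \<beta>) c d j l * (Y b d * X a c))"
    using assms(1) * unfolding RLL_def by simp
  then show "(\<Sum>c\<in>{1..N}. \<Sum>d\<in>{1..N}. ?R \<alpha> \<beta> a b c d * (X c j * Y d l)) =
    (\<Sum>c\<in>{1..N}. \<Sum>d\<in>{1..N}. ?R \<alpha> \<beta> c d j l * (Y b d * X a c))"
    by (simp add: sum_distrib_left algebra_simps h)
qed

lemma sum4_swap:
  "(\<Sum>c\<in>A. \<Sum>d\<in>B. \<Sum>k\<in>C. \<Sum>m\<in>D. f c d k m) = (\<Sum>k\<in>C. \<Sum>m\<in>D. \<Sum>c\<in>A. \<Sum>d\<in>B. f c d k m)"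
proof -
  have prod: "(\<Sum>x\<in>U. \<Sum>y\<in>V. g x y) = (\<Sum>p\<in>U\<times>V. g (fst p) (snd p))" for U V and g :: "_ \<Rightarrow> _ \<Rightarrow> 'a"
    by (simp add: sum.cartesian_product case_prod_unfold)
  have "(\<Sum>c\<in>A. \<Sum>d\<in>B. \<Sum>k\<in>C. \<Sum>m\<in>D. f c d k m) = (\<Sum>c\<in>A. \<Sum>d\<in>B. \<Sum>y\<in>C\<times>D. f c d (fst y) (snd y))"
    by (subst prod) (rule refl)
  also have "\<dots> = (\<Sum>c\<in>A. \<Sum>y\<in>C\<times>D. \<Sum>d\<in>B. f c d (fst y) (snd y))"
    by (intro sum.cong refl sum.swap)
  also have "\<dots> = (\<Sum>y\<in>C\<times>D. \<Sum>c\<in>A. \<Sum>d\<in>B. f c d (fst y) (snd y))"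
    by (rule sum.swap)
  also have "\<dots> = (\<Sum>k\<in>C. \<Sum>m\<in>D. \<Sum>c\<in>A. \<Sum>d\<in>B. f c d k m)"
    by (rule prod[symmetric])
  finally show ?thesis .
qed

text \<open>Comultiplication: R passes first through \<open>L\<close>, \<open>L'\<close> and then
  through \<open>A\<close>, \<open>A'\<close>, since entries of different factors commute and can be
  regrouped.\<close>

lemma RLL_mult:
  assumes L: "RLL N \<kappa> \<alpha> \<beta> L L'" and A: "RLL N \<kappa> \<alpha> \<beta> A A'"
    and cent: "central \<alpha>" "central \<beta>" "\<And>x. central (\<kappa> x)"
    and comm: "\<And>i j k l. A i j * L' k l = L' k l * A i j" "\<And>i j k l. A' i j * L k l = L k l * A' i j"
  shows "RLL N \<kappa> \<alpha> \<beta> (\<lambda>i j. \<Sum>k\<in>{1..N}. L i k * A k j) (\<lambda>i j. \<Sum>k\<in>{1..N}. L' i k * A' k j)"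
  unfolding RLL_def
proof (intro ballI)
  fix a b j l assume *: "a \<in> {1..N}" "b \<in> {1..N}" "j \<in> {1..N}" "l \<in> {1..N}"
  define R where "R = (\<lambda>a b c d. \<alpha> * \<kappa> (Ru a b c d) + \<beta> * \<kappa> (Rv a b c d))"
  have R: "central (R a b c d)" for a b c d
    unfolding R_def using cent by (intro central_add central_mult)
  let ?I = "{1..N}"
  have Lrel: "(\<Sum>c\<in>?I. \<Sum>d\<in>?I. R a b c d * (L c k * L' d m)) = (\<Sum>c\<in>?I. \<Sum>d\<in>?I. R c d k m * (L' b d * L a c))"
    if "k \<in> ?I" "m \<in> ?I" for k m
    using L * that unfolding RLL_def R_def by blast
  have Arel: "(\<Sum>k\<in>?I. \<Sum>m\<in>?I. R c d k m * (A k j * A' m l)) = (\<Sum>k\<in>?I. \<Sum>m\<in>?I. R k m j l * (A' d m * A c k))"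
    if "c \<in> ?I" "d \<in> ?I" for c d
    using A * that unfolding RLL_def R_def by blast
  have "(\<Sum>c\<in>?I. \<Sum>d\<in>?I. R a b c d * ((\<Sum>k\<in>?I. L c k * A k j) * (\<Sum>k\<in>?I. L' d k * A' k l)))
      = (\<Sum>c\<in>?I. \<Sum>d\<in>?I. \<Sum>k\<in>?I. \<Sum>m\<in>?I. R a b c d * (L c k * L' d m) * (A k j * A' m l))"
  proof (intro sum.cong refl)
    fix c d
    have "(\<Sum>k\<in>?I. L c k * A k j) * (\<Sum>k\<in>?I. L' d k * A' k l)
        = (\<Sum>k\<in>?I. \<Sum>m\<in>?I. (L c k * A k j) * (L' d m * A' m l))"
      by (rule sum_product)
    also have "\<dots> = (\<Sum>k\<in>?I. \<Sum>m\<in>?I. (L c k * L' d m) * (A k j * A' m l))"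
      by (intro sum.cong refl) (metis comm(1) mult.assoc)
    finally show "R a b c d * ((\<Sum>k\<in>?I. L c k * A k j) * (\<Sum>k\<in>?I. L' d k * A' k l)) =
        (\<Sum>k\<in>?I. \<Sum>m\<in>?I. R a b c d * (L c k * L' d m) * (A k j * A' m l))"
      by (simp add: sum_distrib_left mult.assoc)
  qed
  also have "\<dots> = (\<Sum>k\<in>?I. \<Sum>m\<in>?I. (\<Sum>c\<in>?I. \<Sum>d\<in>?I. R a b c d * (L c k * L' d m)) * (A k j * A' m l))"
    by (subst sum4_swap) (simp add: sum_distrib_right)
  also have "\<dots> = (\<Sum>k\<in>?I. \<Sum>m\<in>?I. (\<Sum>c\<in>?I. \<Sum>d\<in>?I. R c d k m * (L' b d * L a c)) * (A k j * A' m l))"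
    by (intro sum.cong refl) (simp only: Lrel)
  also have "\<dots> = (\<Sum>k\<in>?I. \<Sum>m\<in>?I. \<Sum>c\<in>?I. \<Sum>d\<in>?I. (L' b d * L a c) * (R c d k m * (A k j * A' m l)))"
    by (simp add: sum_distrib_right mult.assoc central_left_commute[OF R])
  also have "\<dots> = (\<Sum>c\<in>?I. \<Sum>d\<in>?I. (L' b d * L a c) * (\<Sum>k\<in>?I. \<Sum>m\<in>?I. R c d k m * (A k j * A' m l)))"
    by (subst sum4_swap) (simp add: sum_distrib_left)
  also have "\<dots> = (\<Sum>c\<in>?I. \<Sum>d\<in>?I. (L' b d * L a c) * (\<Sum>k\<in>?I. \<Sum>m\<in>?I. R k m j l * (A' d m * A c k)))"
    by (intro sum.cong refl) (simp only: Arel)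
  also have "\<dots> = (\<Sum>c\<in>?I. \<Sum>d\<in>?I. \<Sum>k\<in>?I. \<Sum>m\<in>?I. R k m j l * ((L' b d * A' d m) * (L a c * A c k)))"
  proof (intro sum.cong refl)
    fix c d
    have "(L' b d * L a c) * (R k m j l * (A' d m * A c k)) = R k m j l * ((L' b d * A' d m) * (L a c * A c k))" for k m
    proof -
      have "(L' b d * L a c) * (R k m j l * (A' d m * A c k)) = R k m j l * (L' b d * L a c * (A' d m * A c k))"
        by (rule central_left_commute[OF R])
      also have "L' b d * L a c * (A' d m * A c k) = (L' b d * A' d m) * (L a c * A c k)"
        by (metis comm(2) mult.assoc)
      finally show ?thesis .
    qed
    then show "(L' b d * L a c) * (\<Sum>k\<in>?I. \<Sum>m\<in>?I. R k m j l * (A' d m * A c k)) =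
        (\<Sum>k\<in>?I. \<Sum>m\<in>?I. R k m j l * ((L' b d * A' d m) * (L a c * A c k)))"
      by (simp add: sum_distrib_left)
  qed
  also have "\<dots> = (\<Sum>k\<in>?I. \<Sum>m\<in>?I. R k m j l * ((\<Sum>d\<in>?I. L' b d * A' d m) * (\<Sum>c\<in>?I. L a c * A c k)))"
  proof (subst sum4_swap, intro sum.cong refl)
    fix k m
    have "(\<Sum>d\<in>?I. L' b d * A' d m) * (\<Sum>c\<in>?I. L a c * A c k)
       = (\<Sum>c\<in>?I. \<Sum>d\<in>?I. (L' b d * A' d m) * (L a c * A c k))"
      by (subst sum.swap) (rule sum_product)
    then show "(\<Sum>c\<in>?I. \<Sum>d\<in>?I. R k m j l * ((L' b d * A' d m) * (L a c * A c k))) =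
      R k m j l * ((\<Sum>d\<in>?I. L' b d * A' d m) * (\<Sum>c\<in>?I. L a c * A c k))"
      by (simp add: sum_distrib_left)
  qed
  finally show "(\<Sum>c\<in>?I. \<Sum>d\<in>?I. (\<alpha> * \<kappa> (Ru a b c d) + \<beta> * \<kappa> (Rv a b c d)) *
        ((\<Sum>k\<in>?I. L c k * A k j) * (\<Sum>k\<in>?I. L' d k * A' k l))) =
     (\<Sum>c\<in>?I. \<Sum>d\<in>?I. (\<alpha> * \<kappa> (Ru c d j l) + \<beta> * \<kappa> (Rv c d j l)) *
        ((\<Sum>k\<in>?I. L' b k * A' k d) * (\<Sum>k\<in>?I. L a k * A k c)))"
    unfolding R_def .
qed

lemma RLL_collapse:
  assumes \<kappa>: "\<kappa> 0 = 0" "\<kappa> 1 = 1" "\<And>x. \<kappa> (- x) = - \<kappa> x" "\<And>x y. \<kappa> (x - y) = \<kappa> x - \<kappa> y"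
  shows "RLL N \<kappa> \<alpha> \<beta> X Y \<longleftrightarrow> (\<forall>a\<in>{1..N}. \<forall>b\<in>{1..N}. \<forall>j\<in>{1..N}. \<forall>l\<in>{1..N}.
    (if a = b then (\<alpha> * \<kappa> zLinv - \<beta> * \<kappa> zL) * (X a j * Y b l)
     else (\<alpha> - \<beta>) * (X a j * Y b l) +
       (if a > b then \<alpha> else \<beta>) * (\<kappa> zLinv - \<kappa> zL) * (X b j * Y a l)) =
    (if j = l then (\<alpha> * \<kappa> zLinv - \<beta> * \<kappa> zL) * (Y b l * X a j)
     else (\<alpha> - \<beta>) * (Y b l * X a j) +
       (if j < l then \<alpha> else \<beta>) * (\<kappa> zLinv - \<kappa> zL) * (Y b j * X a l)))"
  unfolding RLL_def
proof (intro ball_cong refl)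
  fix a b j l assume *: "a \<in> {1..N}" "b \<in> {1..N}" "j \<in> {1..N}" "l \<in> {1..N}"
  have K: "\<alpha> * \<kappa> 0 * x = 0" "\<beta> * \<kappa> 0 * x = 0" for x by (simp_all add: \<kappa>)
  note c1 = sum_R_collapse[where K = "\<lambda>r x. \<alpha> * \<kappa> r * x", OF K(1)]
  note c2 = sum_R_collapse[where K = "\<lambda>r x. \<beta> * \<kappa> r * x", OF K(2)]
  show "((\<Sum>c\<in>{1..N}. \<Sum>d\<in>{1..N}. (\<alpha> * \<kappa> (Ru a b c d) + \<beta> * \<kappa> (Rv a b c d)) * (X c j * Y d l)) =
    (\<Sum>c\<in>{1..N}. \<Sum>d\<in>{1..N}. (\<alpha> * \<kappa> (Ru c d j l) + \<beta> * \<kappa> (Rv c d j l)) * (Y b d * X a c))) \<longleftrightarrow>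
    ((if a = b then (\<alpha> * \<kappa> zLinv - \<beta> * \<kappa> zL) * (X a j * Y b l)
     else (\<alpha> - \<beta>) * (X a j * Y b l) +
       (if a > b then \<alpha> else \<beta>) * (\<kappa> zLinv - \<kappa> zL) * (X b j * Y a l)) =
    (if j = l then (\<alpha> * \<kappa> zLinv - \<beta> * \<kappa> zL) * (Y b l * X a j)
     else (\<alpha> - \<beta>) * (Y b l * X a j) +
       (if j < l then \<alpha> else \<beta>) * (\<kappa> zLinv - \<kappa> zL) * (Y b j * X a l)))"
    unfolding distrib_right sum.distrib c1(1)[OF *(1,2)] c2(2)[OF *(1,2)] c1(3)[OF *(3,4)] c2(4)[OF *(3,4)]
    by (intro arg_cong2[where f = "(=)"]) (auto simp: \<kappa> algebra_simps)
qed

lemma RLL_delta: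
  assumes \<kappa>: "\<kappa> 0 = 0" "\<kappa> 1 = 1" "\<And>x. \<kappa> (- x) = - \<kappa> x" "\<And>x y. \<kappa> (x - y) = \<kappa> x - \<kappa> y"
  shows "RLL N \<kappa> \<alpha> \<beta> (\<lambda>i j. of_bool (i = j)) (\<lambda>i j. of_bool (i = j))"
  unfolding RLL_collapse[where \<kappa> = \<kappa>, OF \<kappa>] by auto

text \<open>The homogeneous parameters (p : q) stand for (u : a), so that the expansions at infinity
  and at zero are instances of one formula. The diagonal entry is \<open>zi * p - z * q\<close> on
  the i-th basis vector and \<open>p - q\<close> on the others.\<close>

definition Lpq :: "'b \<Rightarrow> 'b \<Rightarrow> (nat \<Rightarrow> nat \<Rightarrow> 'b) \<Rightarrow> 'b \<Rightarrow> 'b \<Rightarrow> nat \<Rightarrow> nat \<Rightarrow> 'b::ring_1" where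
  "Lpq z zi E p q i j =
    (if i = j then (p - q) + ((zi - 1) * p + (1 - z) * q) * E i i
     else if i < j then (zi - z) * q * E j i else (zi - z) * p * E j i)"

text \<open>The Yang--Baxter equation for \<open>R(u,v)\<close>; here \<open>Lpq z zi E p q\<close> is \<open>R(p,q)\<close> with matrix units
  \<open>E\<close> acting in the second tensor factor.\<close>
lemma RLL_Lpq:
  assumes \<kappa>: "\<kappa> 0 = 0" "\<kappa> 1 = 1" "\<And>x. \<kappa> (- x) = - \<kappa> x" "\<And>x y. \<kappa> (x - y) = \<kappa> x - \<kappa> y"
    and z: "\<kappa> zL = z" "\<kappa> zLinv = zi" "z * zi = 1"
    and cent: "central z" "central zi" "central p1" "central q1" "central p2" "central q2"
    and E: "\<And>j i l m. E j i * E l m = (if i = l then E j m else 0)"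
  shows "RLL N \<kappa> (p1 * q2) (p2 * q1) (Lpq z zi E p1 q1) (Lpq z zi E p2 q2)"
proof -
  have zz: "zi * z = 1" "zi * (z * x) = x" "z * (zi * x) = x" for x
    using z(3) centralD[OF cent(1), of zi] by (simp, metis mult.assoc mult_1, metis mult.assoc mult_1)
  \<comment> \<open>The ring is not commutative, so normal forms need explicit rules: central
    elements move to the left of the matrix units and are sorted as \<open>z\<close>,
    \<open>zi\<close>, \<open>p1\<close>, \<open>q1\<close>, \<open>p2\<close>,
    \<open>q2\<close>.\<close>
  note cE = centralD[OF cent(1), of "E i j" for i j] centralD[OF cent(2), of "E i j" for i j]
    centralD[OF cent(3), of "E i j" for i j] centralD[OF cent(4), of "E i j" for i j]
    centralD[OF cent(5), of "E i j" for i j] centralD[OF cent(6), of "E i j" for i j]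
    central_left_commute[OF cent(1), of "E i j" for i j] central_left_commute[OF cent(2), of "E i j" for i j]
    central_left_commute[OF cent(3), of "E i j" for i j] central_left_commute[OF cent(4), of "E i j" for i j]
    central_left_commute[OF cent(5), of "E i j" for i j] central_left_commute[OF cent(6), of "E i j" for i j]
  note c1 = centralD[OF cent(1), of zi] centralD[OF cent(1), of p1] centralD[OF cent(1), of p2]
    centralD[OF cent(1), of q1] centralD[OF cent(1), of q2]
    central_left_commute[OF cent(1), of zi] central_left_commute[OF cent(1), of p1]
    central_left_commute[OF cent(1), of p2] central_left_commute[OF cent(1), of q1]
    central_left_commute[OF cent(1), of q2]
  note c2 = centralD[OF cent(2), of p1] centralD[OF cent(2), of p2]
    centralD[OF cent(2), of q1] centralD[OF cent(2), of q2]
    central_left_commute[OF cent(2), of p1]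
    central_left_commute[OF cent(2), of p2] central_left_commute[OF cent(2), of q1]
    central_left_commute[OF cent(2), of q2]
  note c3 = centralD[OF cent(3), of p2]  centralD[OF cent(3), of q1] centralD[OF cent(3), of q2]
    central_left_commute[OF cent(3), of p2] central_left_commute[OF cent(3), of q1]
    central_left_commute[OF cent(3), of q2]
  note c4 = centralD[OF cent(4), of p2] centralD[OF cent(4), of q2]
    central_left_commute[OF cent(4), of p2] central_left_commute[OF cent(4), of q2]
  note c5 = centralD[OF cent(5), of q2] central_left_commute[OF cent(5), of q2]
  have E3: "E j i * (E l m * x) = (if i = l then E j m * x else 0)" for i j l m x
    by (simp add: mult.assoc[symmetric] E)
  note norm = Lpq_def z zz cE c1 c2 c3 c4 c5 E E3 distrib_left distrib_right left_diff_distrib right_diff_distrib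
    mult.assoc
  show ?thesis
    unfolding RLL_collapse[where \<kappa> = \<kappa>, OF \<kappa>]
  proof (intro ballI)
    fix a b j l
    show "(if a = b then (p1 * q2 * \<kappa> zLinv - p2 * q1 * \<kappa> zL) * (Lpq z zi E p1 q1 a j * Lpq z zi E p2 q2 b l)
     else (p1 * q2 - p2 * q1) * (Lpq z zi E p1 q1 a j * Lpq z zi E p2 q2 b l) +
       (if a > b then p1 * q2 else p2 * q1) * (\<kappa> zLinv - \<kappa> zL) * (Lpq z zi E p1 q1 b j * Lpq z zi E p2 q2 a l)) =
    (if j = l then (p1 * q2 * \<kappa> zLinv - p2 * q1 * \<kappa> zL) * (Lpq z zi E p2 q2 b l * Lpq z zi E p1 q1 a j)
     else (p1 * q2 - p2 * q1) * (Lpq z zi E p2 q2 b l * Lpq z zi E p1 q1 a j) +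
       (if j < l then p1 * q2 else p2 * q1) * (\<kappa> zLinv - \<kappa> zL) * (Lpq z zi E p2 q2 b j * Lpq z zi E p1 q1 a l))"
      \<comment> \<open>The shape of the entries depends only on the relative order of the indices;
        inconsistent orders are discarded, the others are identities between normal forms.\<close>
      by (cases rule: linorder_cases[of a b]; cases rule: linorder_cases[of j l];
        cases rule: linorder_cases[of a j]; cases rule: linorder_cases[of b l]; ((rule FalseE, linarith) | simp add: norm))
  qed
qed


section \<open>Operators on configurations\<close>

text \<open>A basis vector of the tensor product: for each factor an index of the vector
  representation and an exponent of the evaluation parameter. Operators built from \<open>Q\<close>
  factors touch only the first \<open>Q\<close> positions.\<close>

type_synonym conf = "nat \<Rightarrow> nat \<times> int"

definition conf_shift :: "nat \<Rightarrow> int \<Rightarrow> conf \<Rightarrow> conf" where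
  "conf_shift k n J = J(k := (fst (J k), snd (J k) + n))"

text \<open>Operators commuting with all shifts, so that the shifts become central and can play the role
  of the (invertible) evaluation parameters.\<close>
typedef lop = "{f :: (conf \<Rightarrow> complex fps) \<Rightarrow> conf \<Rightarrow> complex fps.
   (\<forall>\<phi> \<psi>. f (\<lambda>J. \<phi> J + \<psi> J) = (\<lambda>J. f \<phi> J + f \<psi> J)) \<and>
   (\<forall>c \<phi>. f (\<lambda>J. c * \<phi> J) = (\<lambda>J. c * f \<phi> J)) \<and>
   (\<forall>k n \<phi>. f (\<lambda>J. \<phi> (conf_shift k n J)) = (\<lambda>J. f \<phi> (conf_shift k n J)))}"
  morphisms app Abs_lop
  by (rule exI[of _ "\<lambda>\<phi>. \<phi>"]) simp

setup_lifting type_definition_lop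

lemma app_scale_fun: "app A (\<lambda>J. c * \<phi> J) = (\<lambda>J. c * app A \<phi> J)"
  and app_shift_fun: "app A (\<lambda>J. \<phi> (conf_shift k n J)) = (\<lambda>J. app A \<phi> (conf_shift k n J))"
  using app[of A] by blast+

lemma lop_eqI: "(\<And>\<phi> J. app A \<phi> J = app B \<phi> J) \<Longrightarrow> A = B"
  by (metis app_inject ext)

instantiation lop :: ring_1
begin

lift_definition zero_lop :: lop is "\<lambda>\<phi> J. 0" by simp
lift_definition one_lop :: lop is "\<lambda>\<phi>. \<phi>" by simp
lift_definition plus_lop :: "lop \<Rightarrow> lop \<Rightarrow> lop" is "\<lambda>A B \<phi> J. A \<phi> J + B \<phi> J"
  by (auto simp: algebra_simps)
lift_definition uminus_lop :: "lop \<Rightarrow> lop" is "\<lambda>A \<phi> J. - A \<phi> J"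
  by (auto simp: algebra_simps)
lift_definition minus_lop :: "lop \<Rightarrow> lop \<Rightarrow> lop" is "\<lambda>A B \<phi> J. A \<phi> J - B \<phi> J"
  by (auto simp: algebra_simps)
lift_definition times_lop :: "lop \<Rightarrow> lop \<Rightarrow> lop" is "\<lambda>A B \<phi>. A (B \<phi>)"
  by auto

instance
proof
  fix a b c :: lop
  show "a + b + c = a + (b + c)" "a + b = b + a" "0 + a = a" "- a + a = 0" "a - b = a + - b"
    "a * b * c = a * (b * c)" "1 * a = a" "a * 1 = a" "(a + b) * c = a * c + b * c"
    by (transfer; simp add: algebra_simps)+
  show "a * (b + c) = a * b + a * c"
    by transfer simp
  show "(0::lop) \<noteq> 1"
  proof
    assume "(0::lop) = 1"
    then have "app 0 (\<lambda>_. 1) J = app 1 (\<lambda>_. 1) J" for J by simp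
    then show False by (simp add: zero_lop.rep_eq one_lop.rep_eq)
  qed
qed

end

lemma app_simps [simp]:
  "app 0 \<phi> J = 0" "app 1 \<phi> = \<phi>" "app (A + B) \<phi> J = app A \<phi> J + app B \<phi> J"
  "app (A - B) \<phi> J = app A \<phi> J - app B \<phi> J" "app (- A) \<phi> J = - app A \<phi> J"
  "app (A * B) \<phi> = app A (app B \<phi>)"
  by (simp_all add: zero_lop.rep_eq one_lop.rep_eq plus_lop.rep_eq minus_lop.rep_eq
      uminus_lop.rep_eq times_lop.rep_eq)

lemma app_sum: "app (\<Sum>x\<in>A. F x) \<phi> J = (\<Sum>x\<in>A. app (F x) \<phi> J)"
  by (induction A rule: infinite_finite_induct) auto

lift_definition scal :: "complex fps \<Rightarrow> lop" is "\<lambda>c \<phi> J. c * \<phi> J"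
  by (auto simp: algebra_simps)

lift_definition shift_op :: "nat \<Rightarrow> int \<Rightarrow> lop" is "\<lambda>k n \<phi> J. \<phi> (conf_shift k n J)"
  by (auto simp: conf_shift_def fun_upd_twist fun_eq_iff algebra_simps intro!: arg_cong[where f = "\<lambda>J. _ J"])

text \<open>Operators act on functions of configurations: the value at index \<open>i\<close> is put
  at index \<open>j\<close>, which is the matrix unit E_ji of the k-th factor.\<close>

lift_definition unit_op :: "nat \<Rightarrow> nat \<Rightarrow> nat \<Rightarrow> lop" is
  "\<lambda>k j i \<phi> J. if fst (J k) = j then \<phi> (J(k := (i, snd (J k)))) else 0"
proof -
  fix k j i :: nat
  have *: "conf_shift m n (J(k := (i, snd (J k)))) = (conf_shift m n J)(k := (i, snd (conf_shift m n J k)))" for m n J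
    by (auto simp: conf_shift_def fun_eq_iff)
  show "(\<forall>\<phi> \<psi>. (\<lambda>J::conf. if fst (J k) = j then \<phi> (J(k := (i, snd (J k)))) + \<psi> (J(k := (i, snd (J k)))) else (0::complex fps)) =
          (\<lambda>J. (if fst (J k) = j then \<phi> (J(k := (i, snd (J k)))) else 0) + (if fst (J k) = j then \<psi> (J(k := (i, snd (J k)))) else 0))) \<and>
       (\<forall>(c::complex fps) \<phi>. (\<lambda>J::conf. if fst (J k) = j then c * \<phi> (J(k := (i, snd (J k)))) else 0) =
          (\<lambda>J. c * (if fst (J k) = j then \<phi> (J(k := (i, snd (J k)))) else 0))) \<and>
       (\<forall>m n (\<phi> :: conf \<Rightarrow> complex fps). (\<lambda>J. if fst (J k) = j then \<phi> (conf_shift m n (J(k := (i, snd (J k))))) else 0) =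
          (\<lambda>J. if fst (conf_shift m n J k) = j then \<phi> ((conf_shift m n J)(k := (i, snd (conf_shift m n J k)))) else 0))"
    unfolding * by (auto simp: fun_eq_iff conf_shift_def)
qed

lemma app_scal: "app (scal c) \<phi> J = c * \<phi> J"
  by (simp add: scal.rep_eq)

lemma app_shift_op: "app (shift_op k n) \<phi> J = \<phi> (J(k := (fst (J k), snd (J k) + n)))"
  by (simp add: shift_op.rep_eq conf_shift_def)

lemma app_unit_op: "app (unit_op k j i) \<phi> J = (if fst (J k) = j then \<phi> (J(k := (i, snd (J k)))) else 0)"
  by (simp add: unit_op.rep_eq)

lemma scal_simps: "scal 0 = 0" "scal 1 = 1" "scal (a + b) = scal a + scal b" "scal (a - b) = scal a - scal b"
  "scal (- a) = - scal a" "scal (a * b) = scal a * scal b"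
  by (rule lop_eqI; simp add: app_scal algebra_simps)+

lemma central_scal [simp]: "central (scal c)"
  unfolding central_def by (intro allI lop_eqI) (simp add: app_scal scal.rep_eq app_scale_fun)

lemma central_shift_op [simp]: "central (shift_op k n)"
  unfolding central_def by (intro allI lop_eqI) (simp add: shift_op.rep_eq app_shift_fun)

lemma shift_op_0 [simp]: "shift_op k 0 = 1"
  by (rule lop_eqI) (simp add: app_shift_op)

lemma shift_op_add: "shift_op k m * shift_op k n = shift_op k (m + n)"
  by (rule lop_eqI) (simp add: app_shift_op algebra_simps)

lemma unit_op_mult: "unit_op k j i * unit_op k l m = (if i = l then unit_op k j m else 0)"
  by (rule lop_eqI) (auto simp: app_unit_op)

lemma unit_op_commute: "k \<noteq> k' \<Longrightarrow> unit_op k j i * unit_op k' l m = unit_op k' l m * unit_op k j i"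
  by (rule lop_eqI) (auto simp: app_unit_op fun_upd_twist)

text \<open>The indeterminate \<open>z\<close> becomes \<open>exp \<epsilon>\<close>, where \<open>\<epsilon>\<close> is the variable of the power series ring.\<close>
definition exp_hom :: "laurent \<Rightarrow> complex fps" where
  "exp_hom f = (\<Sum>e\<in>Poly_Mapping.keys f. fps_const (Poly_Mapping.lookup f e) * fps_exp (of_int e))"

lemma exp_hom_superset:
  assumes "finite A" "Poly_Mapping.keys f \<subseteq> A"
  shows "exp_hom f = (\<Sum>e\<in>A. fps_const (Poly_Mapping.lookup f e) * fps_exp (of_int e))"
  unfolding exp_hom_def using assms
  by (intro sum.mono_neutral_left) (auto simp: in_keys_iff)

lemma exp_hom_0 [simp]: "exp_hom 0 = 0"
  by (simp add: exp_hom_def)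

lemma exp_hom_add: "exp_hom (f + g) = exp_hom f + exp_hom g"
proof -
  let ?A = "Poly_Mapping.keys f \<union> Poly_Mapping.keys g"
  have "exp_hom (f + g) = (\<Sum>e\<in>?A. fps_const (Poly_Mapping.lookup (f + g) e) * fps_exp (of_int e))"
    by (rule exp_hom_superset) (use Poly_Mapping.keys_add[of f g] in auto)
  also have "\<dots> = exp_hom f + exp_hom g"
    by (simp add: exp_hom_superset[of ?A f] exp_hom_superset[of ?A g] lookup_add sum.distrib distrib_right
        del: fps_const_add flip: fps_const_add)
  finally show ?thesis .
qed

lemma exp_hom_minus: "exp_hom (- f) = - exp_hom f"
  using exp_hom_add[of f "- f"] by (simp add: eq_neg_iff_add_eq_0 add.commute)

lemma exp_hom_diff: "exp_hom (f - g) = exp_hom f - exp_hom g"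
  using exp_hom_add[of f "- g"] by (simp add: exp_hom_minus)

lemma exp_hom_single: "exp_hom (Poly_Mapping.single e c) = fps_const c * fps_exp (of_int e)"
  by (subst exp_hom_superset[of "{e}"]) auto

lemma laurent_induct [case_names zero add_single]:
  fixes f :: laurent
  assumes "P 0" "\<And>f e c. P f \<Longrightarrow> P (f + Poly_Mapping.single e c)"
  shows "P f"
proof (induction f rule: update_induct)
  case const
  then show ?case by (rule assms)
next
  case (update f a b)
  then have "Poly_Mapping.update a b f = f + Poly_Mapping.single a b"
    by (intro poly_mapping_eqI)
      (auto simp: lookup_update lookup_add lookup_single in_keys_iff when_def)
  then show ?case using assms(2) update by simp
qed

lemma exp_hom_mult: "exp_hom (f * g) = exp_hom f * exp_hom g"
proof (induction f rule: laurent_induct)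
  case (add_single f e c)
  have "exp_hom (Poly_Mapping.single e c * g) = exp_hom (Poly_Mapping.single e c) * exp_hom g"
  proof (induction g rule: laurent_induct)
    case (add_single g e' c')
    then show ?case
      by (simp add: distrib_left exp_hom_add mult_single exp_hom_single fps_exp_add_mult algebra_simps
          flip: fps_const_mult)
  qed simp
  then show ?case using add_single by (simp add: distrib_right exp_hom_add)
qed simp

lemma exp_hom_1 [simp]: "exp_hom 1 = 1"
  using exp_hom_single[of 0 1] by simp

lemma exp_hom_z: "exp_hom zL = fps_exp 1" "exp_hom zLinv = fps_exp (- 1)"
  by (simp_all add: zL_def zLinv_def exp_hom_single)

unbundle fps_syntax

section \<open>Two-variable power series\<close>

text \<open>Two commuting variables over noncommuting coefficients: series in the second variable
  whose coefficients are series in the first, so \<open>$ s $ r\<close> reads the s-th power for v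
  and the r-th for u.\<close>

definition in_u :: "'b::ring_1 fps \<Rightarrow> 'b fps fps" where "in_u = fps_const"
definition in_v :: "'b::ring_1 fps \<Rightarrow> 'b fps fps" where "in_v P = Abs_fps (\<lambda>n. fps_const (P $ n))"

lemma in_u_simps: "in_u 0 = 0" "in_u 1 = 1" "in_u (a + b) = in_u a + in_u b" "in_u (a - b) = in_u a - in_u b"
  "in_u (- a) = - in_u a" "in_u (a * b) = in_u a * in_u b"
  by (simp_all add: in_u_def)

lemma in_v_mult: "in_v (a * b) = in_v a * in_v b"
proof (rule fps_ext)
  fix n
  have "in_v (a * b) $ n = fps_const (\<Sum>i=0..n. a $ i * b $ (n - i))"
    by (simp add: in_v_def fps_mult_nth)
  also have "\<dots> = (\<Sum>i=0..n. fps_const (a $ i * b $ (n - i)))"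
    by (rule fps_ext) (simp add: fps_sum_nth)
  finally show "in_v (a * b) $ n = (in_v a * in_v b) $ n"
    by (simp add: in_v_def fps_mult_nth)
qed

lemma in_v_simps: "in_v 0 = 0" "in_v 1 = 1" "in_v (a + b) = in_v a + in_v b" "in_v (a - b) = in_v a - in_v b"
  "in_v (- a) = - in_v a" "in_v (a * b) = in_v a * in_v b"
  by (simp_all add: in_v_mult) (rule fps_ext; simp add: in_v_def)+

lemma in_u_sum: "in_u (\<Sum>x\<in>A. f x) = (\<Sum>x\<in>A. in_u (f x))"
  by (induction A rule: infinite_finite_induct) (auto simp: in_u_simps)

lemma in_v_sum: "in_v (\<Sum>x\<in>A. f x) = (\<Sum>x\<in>A. in_v (f x))"
  by (induction A rule: infinite_finite_induct) (auto simp: in_v_simps)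

lemma in_u_in_v_nth: "(in_u P * in_v Q) $ s $ r = P $ r * Q $ s" "(in_v Q * in_u P) $ s $ r = Q $ s * P $ r"
  by (simp_all add: in_u_def in_v_def)

lemma in_v_const: "in_v (fps_const c) = fps_const (fps_const c)"
  by (rule fps_ext) (simp add: in_v_def)

lemma in_u_X: "in_u fps_X = fps_const fps_X" and in_v_X: "in_v fps_X = fps_X"
  by (simp add: in_u_def) (rule fps_ext, simp add: in_v_def)

lemma central_fps_const: "central c \<Longrightarrow> central (fps_const c)"
  unfolding central_def by (intro allI fps_ext) simp

lemma central_fps_X: "central fps_X"
  unfolding central_def by (simp add: fps_mult_fps_X_commute)

lemma central_Abs_fps:
  assumes "\<And>n. central (f n)"
  shows "central (Abs_fps f)"
  unfolding central_def
proof (intro allI fps_ext)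
  fix x :: "'a fps" and n
  have "(x * Abs_fps f) $ n = (\<Sum>i=0..n. f (n - i) * x $ i)"
    by (simp add: fps_mult_nth centralD[OF assms])
  also have "\<dots> = (\<Sum>i=0..n. f i * x $ (n - i))"
    by (rule sum.reindex_bij_witness[of _ "\<lambda>i. n - i" "\<lambda>i. n - i"]) auto
  finally show "(x * Abs_fps f) $ n = (Abs_fps f * x) $ n"
    by (simp add: fps_mult_nth)
qed

lemma central_in_u: "central c \<Longrightarrow> central (in_u c)"
  by (simp add: in_u_def central_fps_const)

lemma central_in_v:
  assumes "central c"
  shows "central (in_v c)"
proof -
  have "central (c $ n)" for n
    unfolding central_def
  proof
    fix x
    have "(fps_const x * c) $ n = (c * fps_const x) $ n"
      using assms by (metis centralD)
    then show "x * c $ n = c $ n * x" by simp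
  qed
  then show ?thesis unfolding in_v_def by (intro central_Abs_fps central_fps_const)
qed


section \<open>The representation\<close>

definition sgn_bar :: "bool \<Rightarrow> int" where "sgn_bar X = (if X then - 1 else 1)"

definition hbar_fps :: "complex fps" where "hbar_fps = fps_exp (- 1) - fps_exp 1"

text \<open>\<open>slot X k\<close> is the image of \<open>R(u, a)\<close>, normalised by a scalar series, under expansion at
  \<open>u = \<infinity>\<close> (\<open>X = False\<close>) or at \<open>u = 0\<close> (\<open>X = True\<close>); here \<open>a\<close> is the shift in the \<open>k\<close>-th slot.\<close>
definition slot_coeff :: "bool \<Rightarrow> nat \<Rightarrow> nat \<Rightarrow> nat \<Rightarrow> nat \<Rightarrow> lop" where
  "slot_coeff X k i j p =
     (if p = 0 \<and> i = j then 1 + scal (fps_exp (- of_int (sgn_bar X)) - 1) * unit_op k i i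
      else if p = 0 \<and> (if X then j < i else i < j) then 0
      else scal (of_int (sgn_bar X) * hbar_fps) * shift_op k (sgn_bar X * int p) * unit_op k j i)"

definition slot :: "bool \<Rightarrow> nat \<Rightarrow> nat \<Rightarrow> nat \<Rightarrow> lop fps" where
  "slot X k i j = Abs_fps (slot_coeff X k i j)"

definition geom :: "bool \<Rightarrow> nat \<Rightarrow> lop fps" where
  "geom X k = Abs_fps (\<lambda>n. shift_op k (sgn_bar X * int n))"

definition ev_par :: "bool \<Rightarrow> nat \<Rightarrow> lop fps" where
  "ev_par X k = fps_const (shift_op k (sgn_bar X)) * fps_X"

text \<open>R(u, a) is divided by u in the unbarred and by -a in the barred case, giving power
  series in 1/u and in u. Either way \<open>par_p X k - par_q X k\<close> is
  \<open>1 - ev_par X k\<close>, which \<open>geom X k\<close> inverts.\<close>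

definition par_p :: "bool \<Rightarrow> nat \<Rightarrow> lop fps" where "par_p X k = (if X then - ev_par X k else 1)"
definition par_q :: "bool \<Rightarrow> nat \<Rightarrow> lop fps" where "par_q X k = (if X then - 1 else ev_par X k)"

definition z_ser :: "lop fps" where "z_ser = fps_const (scal (fps_exp 1))"
definition zi_ser :: "lop fps" where "zi_ser = fps_const (scal (fps_exp (- 1)))"

lemma central_geom [simp]: "central (geom X k)"
  unfolding geom_def by (intro central_Abs_fps) simp

lemma central_ev_par [simp]: "central (ev_par X k)"
  unfolding ev_par_def by (intro central_mult central_fps_const central_fps_X) simp

lemma central_pars [simp]: "central (par_p X k)" "central (par_q X k)" "central z_ser" "central zi_ser"
  unfolding par_p_def par_q_def z_ser_def zi_ser_def
  by (auto intro!: central_minus central_fps_const)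

lemma geom_ev_par: "geom X k = 1 + geom X k * ev_par X k"
proof (rule fps_ext)
  fix n
  show "geom X k $ n = (1 + geom X k * ev_par X k) $ n"
  proof (cases n)
    case 0
    then show ?thesis by (simp add: geom_def ev_par_def)
  next
    case (Suc m)
    have "(geom X k * ev_par X k) $ n = geom X k $ m * shift_op k (sgn_bar X)"
      unfolding ev_par_def Suc mult.assoc[symmetric] by simp
    also have "\<dots> = geom X k $ n"
      by (simp add: geom_def Suc shift_op_add algebra_simps)
    finally show ?thesis by (simp add: Suc)
  qed
qed

lemma geom_ev_par_nth: "(geom X k * ev_par X k) $ n = (if n = 0 then 0 else shift_op k (sgn_bar X * int n))"
  using arg_cong[OF geom_ev_par[of X k], of "\<lambda>f. f $ n"] by (auto simp: geom_def)

lemma slot_eq_Lpq: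
  "slot X k i j = geom X k * Lpq z_ser zi_ser (\<lambda>j i. fps_const (unit_op k j i)) (par_p X k) (par_q X k) i j"
proof -
  let ?g = "geom X k" and ?x = "ev_par X k" and ?E = "\<lambda>j i. fps_const (unit_op k j i)"
  define h where "h = zi_ser - z_ser"
  have gx: "?g - ?g * ?x = 1" using geom_ev_par[of X k] by (simp add: algebra_simps)
  have hn: "h = fps_const (scal hbar_fps)"
    by (simp add: h_def zi_ser_def z_ser_def hbar_fps_def scal_simps)
  have sh: "shift_op k m * (scal hbar_fps * e) = scal hbar_fps * (shift_op k m * e)" for m e
    by (rule central_left_commute) simp
  have ch: "central h" unfolding hn by (intro central_fps_const) simp
  show ?thesis
  proof (cases "i = j")
    case True
    define s where "s = (if X then z_ser else zi_ser) - 1"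
    define \<sigma> where "\<sigma> = (if X then - 1 else 1 :: lop fps)"
    have cs: "central s" unfolding s_def
      using central_add[OF central_pars(3) central_minus[OF central_1]]
        central_add[OF central_pars(4) central_minus[OF central_1]] by auto
    note xz = centralD[OF central_ev_par, of z_ser] centralD[OF central_ev_par, of zi_ser]
      central_left_commute[OF central_ev_par, of z_ser] central_left_commute[OF central_ev_par, of zi_ser]
    \<comment> \<open>In both expansions (zi - 1) p + (1 - z) q equals s (1 - x) + \<sigma> h x.
      After division by 1 - x the constant s remains as it is, and only the second part becomes an
      infinite series.\<close>
    have Leq: "Lpq z_ser zi_ser ?E (par_p X k) (par_q X k) i j
        = (1 - ?x) * (1 + s * ?E i i) + \<sigma> * (?x * (h * ?E i i))"
      by (cases X) (simp_all add: Lpq_def True par_p_def par_q_def s_def h_def \<sigma>_def algebra_simps xz)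
    have "?g * Lpq z_ser zi_ser ?E (par_p X k) (par_q X k) i j
        = (?g - ?g * ?x) * (1 + s * ?E i i) + \<sigma> * ((?g * ?x) * (h * ?E i i))"
      unfolding Leq by (cases X) (simp_all add: algebra_simps \<sigma>_def)
    also have "\<dots> = 1 + s * ?E i i + \<sigma> * ((?g * ?x) * (h * ?E i i))" unfolding gx by simp
    also have "\<dots> = slot X k i j"
    proof (rule fps_ext)
      fix n
      have "((?g * ?x) * (h * ?E i i)) $ n = (if n = 0 then 0 else
          shift_op k (sgn_bar X * int n) * (scal hbar_fps * unit_op k i i))"
        unfolding hn by (simp add: geom_ev_par_nth)
      then show "(1 + s * ?E i i + \<sigma> * ((?g * ?x) * (h * ?E i i))) $ n = slot X k i j $ n"
        using sh[of "sgn_bar X * int n"]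
        by (cases X; cases "n = 0") (simp_all add: slot_def slot_coeff_def True \<sigma>_def s_def z_ser_def zi_ser_def
            sgn_bar_def scal_simps mult.assoc)
    qed
    finally show ?thesis by simp
  next
    case False
    define \<sigma> where "\<sigma> = (if X then - 1 else 1 :: lop fps)"
    have "Lpq z_ser zi_ser ?E (par_p X k) (par_q X k) i j
        = \<sigma> * ((if (if X then j < i else i < j) then ?x else 1) * (h * ?E j i))"
      using central_left_commute[OF ch, of ?x] False
      by (cases X) (auto simp: Lpq_def par_p_def par_q_def h_def[symmetric] \<sigma>_def mult.assoc)
    then have "?g * Lpq z_ser zi_ser ?E (par_p X k) (par_q X k) i j
        = \<sigma> * ((if (if X then j < i else i < j) then ?g * ?x else ?g) * (h * ?E j i))"
      by (cases X) (auto simp: \<sigma>_def mult.assoc)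
    also have "\<dots> = slot X k i j"
    proof (rule fps_ext)
      fix n
      have "((?g * ?x) * (h * ?E j i)) $ n = (if n = 0 then 0 else
          shift_op k (sgn_bar X * int n) * (scal hbar_fps * unit_op k j i))"
        unfolding hn by (simp add: geom_ev_par_nth)
      moreover have "(?g * (h * ?E j i)) $ n = shift_op k (sgn_bar X * int n) * (scal hbar_fps * unit_op k j i)"
        unfolding hn by (simp add: geom_def)
      ultimately show "(\<sigma> * ((if (if X then j < i else i < j) then ?g * ?x else ?g) * (h * ?E j i))) $ n = slot X k i j $ n"
        using sh[of "sgn_bar X * int n"] False
        by (cases X; cases "n = 0") (auto simp: slot_def slot_coeff_def \<sigma>_def sgn_bar_def scal_simps mult.assoc)
    qed
    finally show ?thesis by simp
  qed
qed

definition scal2 :: "laurent \<Rightarrow> lop fps fps" where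
  "scal2 x = fps_const (fps_const (scal (exp_hom x)))"

lemma scal2_simps: "scal2 0 = 0" "scal2 1 = 1" "scal2 (- x) = - scal2 x" "scal2 (x - y) = scal2 x - scal2 y"
  by (simp_all add: scal2_def scal_simps exp_hom_minus exp_hom_diff)

lemma central_scal2 [simp]: "central (scal2 x)"
  unfolding scal2_def by (intro central_fps_const) simp

text \<open>The ratio u : v in terms of the expansion variables, cleared of negative powers: y : x
  for two unbarred series, x : y for two barred ones, x y : 1 in the mixed case, where x is 1/u or u
  and y is 1/v or v.\<close>

definition coef_u :: "bool \<Rightarrow> bool \<Rightarrow> lop fps fps" where
  "coef_u X Y = (if X then (if Y then in_u fps_X else in_u fps_X * in_v fps_X) else in_v fps_X)"
definition coef_v :: "bool \<Rightarrow> bool \<Rightarrow> lop fps fps" where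
  "coef_v X Y = (if X then (if Y then in_v fps_X else 1) else in_u fps_X)"

lemma central_coefs [simp]: "central (coef_u X Y)" "central (coef_v X Y)"
  unfolding coef_u_def coef_v_def by (auto intro!: central_mult central_in_u central_in_v central_fps_X)

lemma in_u_Lpq: "in_u (Lpq z zi E p q i j) = Lpq (in_u z) (in_u zi) (\<lambda>j i. in_u (E j i)) (in_u p) (in_u q) i j"
  by (simp add: Lpq_def in_u_simps)

lemma in_v_Lpq: "in_v (Lpq z zi E p q i j) = Lpq (in_v z) (in_v zi) (\<lambda>j i. in_v (E j i)) (in_v p) (in_v q) i j"
  by (simp add: Lpq_def in_v_simps)

text \<open>The Yang-Baxter equation gives the relation for the ratio u/a : v/a; the common factor,
  a power of a or a sign, is a unit because a is an invertible shift.\<close>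

lemma RLL_slot:
  assumes "X \<or> \<not> Y"
  shows "RLL N scal2 (coef_u X Y) (coef_v X Y) (\<lambda>i j. in_u (slot X k i j)) (\<lambda>i j. in_v (slot Y k i j))"
proof -
  let ?E = "\<lambda>j i. fps_const (fps_const (unit_op k j i))"
  define z zi where "z = scal2 zL" and "zi = scal2 zLinv"
  have zz: "in_u z_ser = z" "in_u zi_ser = zi" "in_v z_ser = z" "in_v zi_ser = zi"
    by (simp_all add: z_def zi_def z_ser_def zi_ser_def scal2_def exp_hom_z in_v_const) (simp_all add: in_u_def)
  let ?p1 = "in_u (par_p X k)" and ?q1 = "in_u (par_q X k)" and ?p2 = "in_v (par_p Y k)" and ?q2 = "in_v (par_q Y k)"
  have cent: "central ?p1" "central ?q1" "central ?p2" "central ?q2"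
    by (intro central_in_u central_in_v; simp)+
  have zzi: "z * zi = 1"
    by (simp add: z_def zi_def scal2_def exp_hom_z scal_simps(2) flip: scal_simps(6) fps_exp_add_mult)
  have "RLL N scal2 (?p1 * ?q2) (?p2 * ?q1) (Lpq z zi ?E ?p1 ?q1) (Lpq z zi ?E ?p2 ?q2)"
    by (rule RLL_Lpq) (use cent zzi in \<open>auto simp: scal2_simps z_def zi_def unit_op_mult\<close>)
  then have *: "RLL N scal2 (?p1 * ?q2) (?p2 * ?q1)
      (\<lambda>i j. in_u (geom X k) * Lpq z zi ?E ?p1 ?q1 i j) (\<lambda>i j. in_v (geom Y k) * Lpq z zi ?E ?p2 ?q2 i j)"
    by (rule RLL_scale) (intro central_in_u central_in_v; simp)+
  have L: "in_u (slot X k i j) = in_u (geom X k) * Lpq z zi ?E ?p1 ?q1 i j"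
    "in_v (slot Y k i j) = in_v (geom Y k) * Lpq z zi ?E ?p2 ?q2 i j" for i j
    by (simp_all add: slot_eq_Lpq in_u_simps in_v_simps in_u_Lpq in_v_Lpq zz in_v_const) (simp add: in_u_def)
  define A where "A n = in_u (fps_const (shift_op k n))" for n
  have A: "A (- n) * A n = 1" "A n * A (- n) = 1" for n
    by (simp_all add: A_def shift_op_add in_u_simps(2) flip: in_u_simps(6))
  have cA: "central (A n)" for n unfolding A_def by (intro central_in_u central_fps_const) simp
  have ev: "in_u (ev_par X k) = A (sgn_bar X) * in_u fps_X" "in_v (ev_par Y k) = A (sgn_bar Y) * in_v fps_X"
    by (simp_all add: ev_par_def in_u_simps in_v_simps A_def in_v_const) (simp_all add: in_u_def)
  consider "X" "Y" | "\<not> X" "\<not> Y" | "X" "\<not> Y" using assms by blast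
  then show ?thesis
  proof cases
    case 1
    have "?p1 * ?q2 = A (- 1) * coef_u X Y" "?p2 * ?q1 = A (- 1) * coef_v X Y"
      using 1 ev by (simp_all add: par_p_def par_q_def in_u_simps in_v_simps coef_u_def coef_v_def sgn_bar_def)
    with * L A(2)[of 1] show ?thesis by (simp add: RLL_cancel)
  next
    case 2
    have "?p1 * ?q2 = A 1 * coef_u X Y" "?p2 * ?q1 = A 1 * coef_v X Y"
      using 2 ev by (simp_all add: par_p_def par_q_def in_u_simps in_v_simps coef_u_def coef_v_def sgn_bar_def)
    with * L A(1)[of 1] show ?thesis by (simp add: RLL_cancel)
  next
    case 3
    have "A (-1) * in_u fps_X * (A 1 * in_v fps_X) = (A (-1) * A 1) * (in_u fps_X * in_v fps_X)"
      by (simp only: mult.assoc central_left_commute[OF cA, of "in_u fps_X"])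
    then have "?p1 * ?q2 = (- 1) * coef_u X Y" "?p2 * ?q1 = (- 1) * coef_v X Y"
      using 3 ev A(1)[of 1] by (simp_all add: par_p_def par_q_def in_u_simps in_v_simps coef_u_def coef_v_def sgn_bar_def)
    with * L have "RLL N scal2 ((- 1) * coef_u X Y) ((- 1) * coef_v X Y) (\<lambda>i j. in_u (slot X k i j)) (\<lambda>i j. in_v (slot Y k i j))"
      by simp
    then show ?thesis by (rule RLL_cancel[where h = "- 1"]) simp
  qed
qed

text \<open>The monodromy matrix of a chain of \<open>Q\<close> evaluation representations.\<close>

fun rep :: "nat \<Rightarrow> bool \<Rightarrow> nat \<Rightarrow> nat \<Rightarrow> nat \<Rightarrow> lop fps" where
  "rep N X 0 i j = of_bool (i = j)"
| "rep N X (Suc Q) i j = (\<Sum>k\<in>{1..N}. slot X Q i k * rep N X Q k j)"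

text \<open>By \<open>slot_eq_Lpq\<close> the entries are built from matrix units of the k-th factor
  and central elements.\<close>

lemma slot_commute:
  assumes "\<And>j i. y * fps_const (unit_op k j i) = fps_const (unit_op k j i) * y"
  shows "y * slot X k i j = slot X k i j * y"
proof -
  have comm: "y * (c * e) = c * e * y" if "central c" "y * e = e * y" for c e
    using that by (metis central_left_commute mult.assoc)
  have cent: "central ((zi_ser - 1) * par_p X k + (1 - z_ser) * par_q X k)" "central (zi_ser - z_ser)"
    unfolding diff_conv_add_uminus
    by (intro central_add central_mult central_minus central_pars central_1)+
  have "y * Lpq z_ser zi_ser (\<lambda>j i. fps_const (unit_op k j i)) (par_p X k) (par_q X k) i j =
      Lpq z_ser zi_ser (\<lambda>j i. fps_const (unit_op k j i)) (par_p X k) (par_q X k) i j * y"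
    using comm[OF cent(1) assms, of i i]
      comm[OF central_mult[OF cent(2) central_pars(1)[of X k]] assms, of j i]
      comm[OF central_mult[OF cent(2) central_pars(2)[of X k]] assms, of j i]
      centralD[OF central_pars(1)[of X k], of y] centralD[OF central_pars(2)[of X k], of y]
    by (cases "i = j"; simp add: Lpq_def distrib_left distrib_right left_diff_distrib right_diff_distrib del: fps_const_sub)
  then show ?thesis unfolding slot_eq_Lpq using comm[OF central_geom] by blast
qed

lemma rep_unit_commute:
  assumes "Q \<le> k"
  shows "fps_const (unit_op k l m) * rep N X Q i j = rep N X Q i j * fps_const (unit_op k l m)"
  using assms
proof (induction Q arbitrary: i j)
  case (Suc Q)
  have "fps_const (unit_op k l m) * slot X Q i r = slot X Q i r * fps_const (unit_op k l m)" for r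
    by (rule slot_commute) (use Suc.prems unit_op_commute[of k Q] in simp)
  then have "fps_const (unit_op k l m) * (slot X Q i r * rep N X Q r j)
      = slot X Q i r * rep N X Q r j * fps_const (unit_op k l m)" for r
    using Suc by (metis Suc_leD mult.assoc)
  then show ?case by (simp add: sum_distrib_left sum_distrib_right)
qed auto

lemma rep_slot_coeff_commute:
  "rep N X Q i j $ n * slot_coeff Y Q r s m = slot_coeff Y Q r s m * rep N X Q i j $ n"
proof -
  have *: "y * slot_coeff Y Q r s m = slot_coeff Y Q r s m * y"
    if "\<And>j i. y * unit_op Q j i = unit_op Q j i * y" for y
  proof -
    have "fps_const y * slot Y Q r s = slot Y Q r s * fps_const y"
      by (rule slot_commute) (simp add: that)
    from arg_cong[OF this, of "\<lambda>f. f $ m"] show ?thesis by (simp add: slot_def)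
  qed
  show ?thesis
  proof (rule *)
    fix l i'
    from arg_cong[OF rep_unit_commute[of Q Q l i' N X i j], of "\<lambda>f. f $ n"]
    show "rep N X Q i j $ n * unit_op Q l i' = unit_op Q l i' * rep N X Q i j $ n" by simp
  qed
qed

lemma RLL_rep:
  assumes "X \<or> \<not> Y"
  shows "RLL N scal2 (coef_u X Y) (coef_v X Y) (\<lambda>i j. in_u (rep N X Q i j)) (\<lambda>i j. in_v (rep N Y Q i j))"
proof (induction Q)
  case 0
  have "in_u (of_bool b :: lop fps) = of_bool b" "in_v (of_bool b :: lop fps) = of_bool b" for b
    by (simp_all add: of_bool_def in_u_simps in_v_simps)
  then show ?case using RLL_delta[of scal2 N "coef_u X Y" "coef_v X Y"] by (simp add: scal2_simps)
next
  case (Suc Q)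
  have uv: "in_u P * in_v P' = in_v P' * in_u P"
    if "\<And>r s. P $ r * P' $ s = P' $ s * P $ r" for P P' :: "lop fps"
    by (intro fps_ext) (simp add: in_u_in_v_nth that)
  have "RLL N scal2 (coef_u X Y) (coef_v X Y)
      (\<lambda>i j. \<Sum>k\<in>{1..N}. in_u (slot X Q i k) * in_u (rep N X Q k j))
      (\<lambda>i j. \<Sum>k\<in>{1..N}. in_v (slot Y Q i k) * in_v (rep N Y Q k j))"
  proof (rule RLL_mult[OF RLL_slot[OF assms] Suc])
    show "in_u (rep N X Q i j) * in_v (slot Y Q k l) = in_v (slot Y Q k l) * in_u (rep N X Q i j)" for i j k l
      by (rule uv) (simp add: slot_def rep_slot_coeff_commute)
    show "in_v (rep N Y Q i j) * in_u (slot X Q k l) = in_u (slot X Q k l) * in_v (rep N Y Q i j)" for i j k l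
      by (rule uv[symmetric]) (simp add: slot_def rep_slot_coeff_commute)
  qed simp_all
  then show ?case by (simp add: in_u_sum in_v_sum in_u_simps in_v_simps)
qed


section \<open>Weights and the degree-zero diagonal generators\<close>

definition occ :: "nat \<Rightarrow> conf \<Rightarrow> nat \<Rightarrow> nat" where
  "occ Q J i = card {k. k < Q \<and> fst (J k) = i}"

lemma occ_Suc: "occ (Suc Q) J i = occ Q J i + of_bool (fst (J Q) = i)"
proof -
  have "{k. k < Suc Q \<and> fst (J k) = i} = {k. k < Q \<and> fst (J k) = i} \<union> (if fst (J Q) = i then {Q} else {})"
    by (auto simp: less_Suc_eq)
  then show ?thesis by (auto simp: occ_def)
qed

lemma slot_coeff_zero: "(if X then j < i else i < j) \<Longrightarrow> slot_coeff X k i j 0 = 0"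
  by (auto simp: slot_coeff_def split: if_splits)

lemma app_slot_coeff_diag:
  "app (slot_coeff X k i i 0) \<phi> J = fps_exp (- of_int (sgn_bar X) * of_nat (of_bool (fst (J k) = i))) * \<phi> J"
  by (auto simp: slot_coeff_def app_scal app_unit_op fun_upd_idem algebra_simps prod_eq_iff)

lemma rep_zero:
  "(if X then j < i else i < j) \<Longrightarrow> rep N X Q i j $ 0 = 0"
proof (induction Q arbitrary: i)
  case (Suc Q)
  have "slot_coeff X Q i k 0 * rep N X Q k j $ 0 = 0" for k
  proof (cases "if X then k < i else i < k")
    case True
    then show ?thesis using slot_coeff_zero by simp
  next
    case False
    then have "if X then j < k else k < j" using Suc.prems by (auto split: if_splits)
    then show ?thesis using Suc.IH by simp
  qed
  then show ?case by (simp add: fps_sum_nth slot_def)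
qed (auto split: if_splits)

text \<open>At degree zero every slot matrix is triangular, so only the intermediate indices
  constantly equal to \<open>i\<close> contribute and the eigenvalues multiply.\<close>

lemma app_rep_diag:
  assumes "i \<in> {1..N}"
  shows "app (rep N X Q i i $ 0) \<phi> J = fps_exp (- of_int (sgn_bar X) * of_nat (occ Q J i)) * \<phi> J"
proof (induction Q)
  case 0
  then show ?case by (simp add: occ_def)
next
  case (Suc Q)
  have z: "slot_coeff X Q i k 0 * rep N X Q k i $ 0 = 0" if "k \<noteq> i" for k
  proof (cases "if X then k < i else i < k")
    case True
    then show ?thesis using slot_coeff_zero by simp
  next
    case False
    then have "if X then i < k else k < i" using that by (auto split: if_splits)
    then show ?thesis using rep_zero by simp
  qed
  have "rep N X (Suc Q) i i $ 0 = (\<Sum>k\<in>{1..N}. slot_coeff X Q i k 0 * rep N X Q k i $ 0)"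
    by (simp add: fps_sum_nth slot_def)
  also have "\<dots> = (\<Sum>k\<in>{i}. slot_coeff X Q i k 0 * rep N X Q k i $ 0)"
    by (rule sum.mono_neutral_right) (use assms z in auto)
  finally have "rep N X (Suc Q) i i $ 0 = slot_coeff X Q i i 0 * rep N X Q i i $ 0" by simp
  moreover have "fps_exp (- of_int (sgn_bar X) * of_nat (m + n) :: complex)
      = fps_exp (- of_int (sgn_bar X) * of_nat n) * fps_exp (- of_int (sgn_bar X) * of_nat m)" for m n
    unfolding fps_exp_add_mult[symmetric] by (simp add: algebra_simps)
  ultimately show ?case
    by (simp only: app_slot_coeff_diag Suc occ_Suc app_simps mult.assoc)
qed

section \<open>Evaluation of the free algebra and vanishing on the ideal\<close>

definition gen_op :: "nat \<Rightarrow> nat \<Rightarrow> gen \<Rightarrow> lop" where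
  "gen_op N Q g = (case g of T i j r \<Rightarrow> rep N False Q i j $ r | Tb i j r \<Rightarrow> rep N True Q i j $ r)"

definition word_op :: "nat \<Rightarrow> nat \<Rightarrow> gen list \<Rightarrow> lop" where
  "word_op N Q w = prod_list (map (gen_op N Q) w)"

lemma word_op_simps [simp]: "word_op N Q [] = 1" "word_op N Q (g # w) = gen_op N Q g * word_op N Q w"
  "word_op N Q (u @ w) = word_op N Q u * word_op N Q w"
  by (simp_all add: word_op_def)

text \<open>Over an infinite support the sum would be 0, hence the \<open>fin_supp\<close>
  conditions below. Compatibility with products takes the form \<open>ev_sandwich\<close>, matching
  the closure rule of \<open>rel_ideal\<close>.\<close>

definition ev :: "nat \<Rightarrow> nat \<Rightarrow> falg \<Rightarrow> lop" where
  "ev N Q f = (\<Sum>w | f w \<noteq> 0. scal (exp_hom (f w)) * word_op N Q w)"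

definition fin_supp :: "falg \<Rightarrow> bool" where
  "fin_supp f \<longleftrightarrow> finite {w. f w \<noteq> 0}"

lemma fin_supp_0 [simp]: "fin_supp 0"
  by (simp add: fin_supp_def)

lemma fin_supp_mono [simp]: "fin_supp (mono w)"
  by (simp add: fin_supp_def mono_def)

lemma fin_supp_add: "fin_supp f \<Longrightarrow> fin_supp g \<Longrightarrow> fin_supp (f + g)"
  unfolding fin_supp_def by (rule finite_subset[of _ "{w. f w \<noteq> 0} \<union> {w. g w \<noteq> 0}"]) auto

lemma fin_supp_fsc: "fin_supp f \<Longrightarrow> fin_supp (fsc k f)"
  unfolding fin_supp_def by (rule finite_subset[of _ "{w. f w \<noteq> 0}"]) (auto simp: fsc_def)

lemma fin_supp_minus: "fin_supp f \<Longrightarrow> fin_supp (- f)"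
  using fin_supp_fsc[of f "-1"] by simp

lemma fin_supp_diff: "fin_supp f \<Longrightarrow> fin_supp g \<Longrightarrow> fin_supp (f - g)"
  using fin_supp_add[OF _ fin_supp_minus, of f g] by simp

lemma fin_supp_sum: "(\<And>x. x \<in> A \<Longrightarrow> fin_supp (F x)) \<Longrightarrow> fin_supp (\<Sum>x\<in>A. F x)"
  by (induction A rule: infinite_finite_induct) (auto intro: fin_supp_add)

lemma fin_supp_induct [consumes 1, case_names zero add]:
  assumes "fin_supp f" "P 0" "\<And>f k w. fin_supp f \<Longrightarrow> P f \<Longrightarrow> P (fsc k (mono w) + f)"
  shows "P f"
proof -
  have "fin_supp (\<Sum>w\<in>A. fsc (f w) (mono w)) \<and> P (\<Sum>w\<in>A. fsc (f w) (mono w))" if "finite A" for A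
    using that
  proof (induction A rule: finite_induct)
    case empty
    show ?case unfolding sum.empty using assms(2) fin_supp_0 by blast
  next
    case (insert x A)
    show ?case
      unfolding sum.insert[OF insert(1,2)]
      using insert(3) assms(3) fin_supp_add fin_supp_fsc fin_supp_mono by blast
  qed
  moreover have "finite {w. f w \<noteq> 0}" using assms(1) by (simp add: fin_supp_def)
  ultimately show ?thesis
    using back_subst[of P, OF _ finite_support_expand[symmetric]] by blast
qed

lemma ev_superset:
  assumes "finite A" "{w. f w \<noteq> 0} \<subseteq> A"
  shows "ev N Q f = (\<Sum>w\<in>A. scal (exp_hom (f w)) * word_op N Q w)"
  unfolding ev_def using assms by (intro sum.mono_neutral_left) (auto simp: scal_simps)

lemma ev_0 [simp]: "ev N Q 0 = 0"
  by (simp add: ev_def)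

lemma ev_add:
  assumes "fin_supp f" "fin_supp g"
  shows "ev N Q (f + g) = ev N Q f + ev N Q g"
proof -
  let ?A = "{w. f w \<noteq> 0} \<union> {w. g w \<noteq> 0}"
  have A: "finite ?A" using assms by (simp add: fin_supp_def)
  have "ev N Q (f + g) = (\<Sum>w\<in>?A. scal (exp_hom ((f + g) w)) * word_op N Q w)"
    using A by (rule ev_superset) auto
  then show ?thesis
    by (simp add: ev_superset[OF A, of f] ev_superset[OF A, of g] exp_hom_add scal_simps distrib_right sum.distrib)
qed

lemma ev_fsc:
  assumes "fin_supp f"
  shows "ev N Q (fsc k f) = scal (exp_hom k) * ev N Q f"
proof -
  have A: "finite {w. f w \<noteq> 0}" using assms by (simp add: fin_supp_def)
  have "ev N Q (fsc k f) = (\<Sum>w | f w \<noteq> 0. scal (exp_hom (fsc k f w)) * word_op N Q w)"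
    using A by (rule ev_superset) (auto simp: fsc_def)
  then show ?thesis
    by (simp add: ev_def fsc_def exp_hom_mult scal_simps sum_distrib_left mult.assoc)
qed

lemma ev_diff:
  assumes "fin_supp f" "fin_supp g"
  shows "ev N Q (f - g) = ev N Q f - ev N Q g"
  using ev_add[OF assms(1) fin_supp_minus[OF assms(2)], of N Q] ev_fsc[OF assms(2), of N Q "-1"]
  by (simp add: exp_hom_minus scal_simps)

lemma ev_sum:
  "(\<And>x. x \<in> A \<Longrightarrow> fin_supp (F x)) \<Longrightarrow> ev N Q (\<Sum>x\<in>A. F x) = (\<Sum>x\<in>A. ev N Q (F x))"
  by (induction A rule: infinite_finite_induct) (auto simp: ev_add fin_supp_sum)

lemma ev_mono [simp]: "ev N Q (mono w) = word_op N Q w"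
  by (subst ev_superset[of "{w}"]) (auto simp: mono_def scal_simps)

lemma ev_sandwich:
  assumes "fin_supp f"
  shows "fin_supp (sandwich u f v) \<and> ev N Q (sandwich u f v) = word_op N Q u * ev N Q f * word_op N Q v"
  using assms
proof (induction rule: fin_supp_induct)
  case zero
  show ?case unfolding sandwich_def fmul_zero ev_0 by (intro conjI fin_supp_0) simp
next
  case (add f k w)
  have "word_op N Q u * (scal (exp_hom k) * word_op N Q w) * word_op N Q v
      = scal (exp_hom k) * word_op N Q (u @ w @ v)"
    using central_left_commute[OF central_scal, of "word_op N Q u"] by (simp add: mult.assoc)
  then show ?case
    using add by (simp add: sandwich_simps fin_supp_add fin_supp_fsc ev_add ev_fsc distrib_left distrib_right
        del: plus_fun_apply)
qed

lemma fin_supp_pair [simp]: "fin_supp (pair X i a r Y j b s)"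
  by (auto simp: pair_def G_def fzero_eq_0)

definition coeff_op :: "nat \<Rightarrow> nat \<Rightarrow> bool \<Rightarrow> nat \<Rightarrow> nat \<Rightarrow> int \<Rightarrow> lop" where
  "coeff_op N Q X i j r = (if r < 0 then 0 else rep N X Q i j $ nat r)"

lemma ev_pair: "ev N Q (pair X i a r Y j b s) = coeff_op N Q X i a r * coeff_op N Q Y j b s"
  by (auto simp: pair_def G_def fzero_eq_0 coeff_op_def gen_op_def)

lemma in_u_X_mult_nth: "(in_u fps_X * F) $ s $ r = (if r = 0 then 0 else F $ s $ (r - 1))"
  by (simp add: in_u_X)

lemma in_v_X_mult_nth: "(in_v fps_X * F) $ s $ r = (if s = 0 then 0 else F $ (s - 1) $ r)"
  by (simp add: in_v_X)

lemma coef_u_nth: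
  assumes "X \<or> \<not> Y"
  shows "(coef_u X Y * F) $ s $ r = (if iu X True r < 0 \<or> iv Y True s < 0 then 0
     else F $ nat (iv Y True s) $ nat (iu X True r))"
proof -
  have "in_u fps_X * in_v fps_X * F = in_u fps_X * (in_v fps_X * F)" by (rule mult.assoc)
  moreover have "nat (int n - 1) = n - 1" for n by simp
  moreover have "in_v (fps_X :: lop fps) $ 0 = 0" by (simp add: in_v_X)
  ultimately show ?thesis
    using assms by (cases X; cases Y) (auto simp: coef_u_def iu_def iv_def in_u_X_mult_nth in_v_X_mult_nth)
qed

lemma coef_v_nth:
  assumes "X \<or> \<not> Y"
  shows "(coef_v X Y * F) $ s $ r = (if iu X False r < 0 \<or> iv Y False s < 0 then 0
     else F $ nat (iv Y False s) $ nat (iu X False r))"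
proof -
  have "nat (int n - 1) = n - 1" for n by simp
  moreover have "in_v (fps_X :: lop fps) $ 0 = 0" by (simp add: in_v_X)
  ultimately show ?thesis
    using assms by (cases X; cases Y) (auto simp: coef_v_def iu_def iv_def in_u_X_mult_nth in_v_X_mult_nth)
qed

lemma scal2_nth: "(\<alpha> * scal2 c * F) $ s $ r = scal (exp_hom c) * (\<alpha> * F) $ s $ r"
proof -
  have "\<alpha> * scal2 c * F = scal2 c * (\<alpha> * F)"
    using centralD[OF central_scal2, of \<alpha> c] by (simp add: mult.assoc)
  then show ?thesis by (simp add: scal2_def)
qed

text \<open>The coefficient of \<open>RLL_rep\<close> at \<open>$ s $ r\<close> is the relation in
  question: multiplication by \<open>coef_u\<close> and \<open>coef_v\<close> shifts the indices
  exactly as \<open>iu\<close> and \<open>iv\<close> do.\<close>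

lemma ev_RLL_rel:
  assumes "a \<in> {1..N}" "b \<in> {1..N}" "j \<in> {1..N}" "l \<in> {1..N}" "X \<or> \<not> Y"
  shows "fin_supp (RLL_rel N X Y a b j l r s)" "ev N Q (RLL_rel N X Y a b j l r s) = 0"
proof -
  have fs: "fsum A F = (\<Sum>x\<in>A. F x)" if "finite A" for A F
    using that by (induction A rule: finite_induct) (auto simp: fsum_def fun_eq_iff)
  let ?L = "\<Sum>c\<in>{1..N}. \<Sum>d\<in>{1..N}. fsc (Ru a b c d) (pair X c j (iu X True r) Y d l (iv Y True s)) +
      fsc (Rv a b c d) (pair X c j (iu X False r) Y d l (iv Y False s))"
  let ?R = "\<Sum>c\<in>{1..N}. \<Sum>d\<in>{1..N}. fsc (Ru c d j l) (pair Y b d (iv Y True s) X a c (iu X True r)) +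
      fsc (Rv c d j l) (pair Y b d (iv Y False s) X a c (iu X False r))"
  have eq: "RLL_rel N X Y a b j l r s = ?L - ?R"
    unfolding RLL_rel_def falg_ops by (simp only: fs finite_atLeastAtMost pair_def)
  have fin: "fin_supp ?L" "fin_supp ?R"
    by (intro fin_supp_sum fin_supp_add fin_supp_fsc fin_supp_pair)+
  then show "fin_supp (RLL_rel N X Y a b j l r s)" unfolding eq by (rule fin_supp_diff)
  note rel = RLL_rep[OF assms(5), of N Q, unfolded RLL_def, rule_format, OF assms(1-4)]
  have uv: "(coef_u X Y * (in_u (rep N X Q c j) * in_v (rep N Y Q d l))) $ s $ r
        = coeff_op N Q X c j (iu X True r) * coeff_op N Q Y d l (iv Y True s)"
    "(coef_v X Y * (in_u (rep N X Q c j) * in_v (rep N Y Q d l))) $ s $ r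
        = coeff_op N Q X c j (iu X False r) * coeff_op N Q Y d l (iv Y False s)"
    "(coef_u X Y * (in_v (rep N Y Q d l) * in_u (rep N X Q c j))) $ s $ r
        = coeff_op N Q Y d l (iv Y True s) * coeff_op N Q X c j (iu X True r)"
    "(coef_v X Y * (in_v (rep N Y Q d l) * in_u (rep N X Q c j))) $ s $ r
        = coeff_op N Q Y d l (iv Y False s) * coeff_op N Q X c j (iu X False r)" for c d j l
    by (auto simp: coef_u_nth[OF assms(5)] coef_v_nth[OF assms(5)] in_u_in_v_nth coeff_op_def)
  have L: "ev N Q ?L = (\<Sum>c\<in>{1..N}. \<Sum>d\<in>{1..N}. (coef_u X Y * scal2 (Ru a b c d) + coef_v X Y * scal2 (Rv a b c d)) *
       (in_u (rep N X Q c j) * in_v (rep N Y Q d l))) $ s $ r"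
    by (simp add: ev_sum ev_add ev_fsc fin_supp_sum fin_supp_add fin_supp_fsc ev_pair fps_sum_nth
        distrib_right scal2_nth uv)
  have R: "ev N Q ?R = (\<Sum>c\<in>{1..N}. \<Sum>d\<in>{1..N}. (coef_u X Y * scal2 (Ru c d j l) + coef_v X Y * scal2 (Rv c d j l)) *
       (in_v (rep N Y Q b d) * in_u (rep N X Q a c))) $ s $ r"
    by (simp add: ev_sum ev_add ev_fsc fin_supp_sum fin_supp_add fin_supp_fsc ev_pair fps_sum_nth
        distrib_right scal2_nth uv)
  show "ev N Q (RLL_rel N X Y a b j l r s) = 0"
    unfolding eq ev_diff[OF fin] L R rel by simp
qed

lemma rep_diag_inverse:
  assumes "i \<in> {1..N}"
  shows "rep N X Q i i $ 0 * rep N (\<not> X) Q i i $ 0 = 1"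
  by (rule lop_eqI)
    (simp add: app_rep_diag[OF assms] sgn_bar_def mult.assoc[symmetric] flip: fps_exp_add_mult)

lemma ev_rels:
  assumes "x \<in> rels N"
  shows "fin_supp x \<and> ev N Q x = 0"
  using assms
proof (cases rule: rels.cases)
  case (zero_t i j)
  then show ?thesis using rep_zero[of False j i N Q] by (simp add: gen_op_def)
next
  case (zero_tb i j)
  then show ?thesis using rep_zero[of True i j N Q] by (simp add: gen_op_def)
next
  case (inv1 i)
  then show ?thesis using rep_diag_inverse[of i N False Q]
    by (simp add: falg_ops fin_supp_diff ev_diff gen_op_def)
next
  case (inv2 i)
  then show ?thesis using rep_diag_inverse[of i N True Q]
    by (simp add: falg_ops fin_supp_diff ev_diff gen_op_def)
qed (simp_all add: ev_RLL_rel)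

lemma ev_rel_ideal:
  assumes "x \<in> rel_ideal N"
  shows "fin_supp x \<and> ev N Q x = 0"
  using assms
proof (induction rule: rel_ideal.induct)
  case (base x)
  then show ?case by (rule ev_rels)
next
  case zero
  show ?case unfolding fzero_eq_0 using fin_supp_0 ev_0 by blast
next
  case (add x y)
  then show ?case by (simp add: falg_ops fin_supp_add ev_add del: plus_fun_apply)
next
  case (mult x w w' k)
  then show ?case using ev_sandwich[of x w w' N Q]
    by (simp add: sandwich_def[symmetric] fin_supp_fsc ev_fsc)
qed


section \<open>Leading terms as \<open>z\<close> tends to 1\<close>

text \<open>\<open>\<psi>\<close> may vanish; then only a bound on the order is asserted, which
  keeps the notion stable under sums.\<close>

definition lead :: "nat \<Rightarrow> (conf \<Rightarrow> complex fps) \<Rightarrow> (conf \<Rightarrow> complex) \<Rightarrow> bool" where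
  "lead n \<phi> \<psi> \<longleftrightarrow> (\<forall>J. (\<forall>i<n. \<phi> J $ i = 0) \<and> \<phi> J $ n = \<psi> J)"

lemma lead_zero: "lead n (\<lambda>_. 0) (\<lambda>_. 0)"
  by (simp add: lead_def)

lemma lead_add: "lead n \<phi> \<psi> \<Longrightarrow> lead n \<phi>' \<psi>' \<Longrightarrow> lead n (\<lambda>J. \<phi> J + \<phi>' J) (\<lambda>J. \<psi> J + \<psi>' J)"
  by (simp add: lead_def)

lemma lead_sum:
  "(\<And>x. x \<in> A \<Longrightarrow> lead n (\<phi> x) (\<psi> x)) \<Longrightarrow> lead n (\<lambda>J. \<Sum>x\<in>A. \<phi> x J) (\<lambda>J. \<Sum>x\<in>A. \<psi> x J)"
  by (induction A rule: infinite_finite_induct) (auto intro: lead_add lead_zero)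

lemma lead_Suc: "lead (Suc n) \<phi> \<psi> \<Longrightarrow> lead n \<phi> (\<lambda>_. 0)"
  by (simp add: lead_def)

lemma lead_mult:
  assumes "lead n \<phi> \<psi>"
  shows "lead n (\<lambda>J. c J * \<phi> J) (\<lambda>J. c J $ 0 * \<psi> J)"
proof -
  have "(c J * \<phi> J) $ i = (if i = n then c J $ 0 * \<phi> J $ n else 0)" if "i \<le> n" for i J
  proof -
    have "(c J * \<phi> J) $ i = (\<Sum>k=0..i. if k = 0 then c J $ 0 * \<phi> J $ i else 0)"
      unfolding fps_mult_nth by (rule sum.cong) (use assms that in \<open>auto simp: lead_def\<close>)
    also have "\<dots> = c J $ 0 * \<phi> J $ i" by simp
    finally show ?thesis using assms that by (auto simp: lead_def)
  qed
  then show ?thesis using assms by (auto simp: lead_def)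
qed

lemma lead_mult_order1:
  assumes "lead n \<phi> \<psi>" "c $ 0 = 0"
  shows "lead (Suc n) (\<lambda>J. c * \<phi> J) (\<lambda>J. c $ 1 * \<psi> J)"
proof -
  have c: "c = fps_X * fps_shift 1 c"
    by (rule fps_ext) (use assms(2) in \<open>auto simp: fps_X_mult_nth\<close>)
  have "lead n (\<lambda>J. fps_shift 1 c * \<phi> J) (\<lambda>J. fps_shift 1 c $ 0 * \<psi> J)"
    by (rule lead_mult[OF assms(1)])
  then have "lead (Suc n) (\<lambda>J. fps_X * (fps_shift 1 c * \<phi> J)) (\<lambda>J. c $ 1 * \<psi> J)"
    by (auto simp: lead_def fps_X_mult_nth)
  then show ?thesis by (subst c) (simp add: mult.assoc)
qed

text \<open>First-order action on one factor of a loop algebra element, a matrix unit times a power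
  of the parameter; it is 0 for the vanishing generators and for the Cartan ones. The values are
  polymorphic to cover power series, complex leading terms and path counts.\<close>

definition move :: "bool \<Rightarrow> nat \<Rightarrow> nat \<Rightarrow> nat \<Rightarrow> nat \<Rightarrow> (conf \<Rightarrow> 'a::zero) \<Rightarrow> conf \<Rightarrow> 'a" where
  "move X k i j p \<psi> J =
     (if (p \<noteq> 0 \<or> (if X then i < j else j < i)) \<and> fst (J k) = j
      then \<psi> (J(k := (i, snd (J k) + sgn_bar X * int p))) else 0)"

lemma hbar_fps_nth: "hbar_fps $ 0 = 0" "hbar_fps $ Suc 0 = - 2"
  by (simp_all add: hbar_fps_def)

lemma app_slot_coeff:
  assumes "\<not> (p = 0 \<and> i = j)"
  shows "app (slot_coeff X k i j p) \<phi> = (\<lambda>J. of_int (sgn_bar X) * hbar_fps * move X k i j p \<phi> J)"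
proof
  fix J
  show "app (slot_coeff X k i j p) \<phi> J = of_int (sgn_bar X) * hbar_fps * move X k i j p \<phi> J"
    using assms by (auto simp: slot_coeff_def move_def app_scal app_shift_op app_unit_op)
qed

lemma lead_move: "lead n \<phi> \<psi> \<Longrightarrow> lead n (move X k i j p \<phi>) (move X k i j p \<psi>)"
  by (auto simp: lead_def move_def)

lemma lead_slot:
  assumes "\<not> (p = 0 \<and> i = j)" "lead n \<phi> \<psi>"
  shows "lead (Suc n) (app (slot_coeff X k i j p) \<phi>) (\<lambda>J. - 2 * of_int (sgn_bar X) * move X k i j p \<psi> J)"
proof -
  let ?c = "of_int (sgn_bar X) * hbar_fps"
  have "?c $ 0 = 0" "?c $ 1 = - 2 * of_int (sgn_bar X)"
    by (auto simp: hbar_fps_nth sgn_bar_def)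
  with lead_mult_order1[OF lead_move[OF assms(2), of X k i j p], of ?c] show ?thesis
    unfolding app_slot_coeff[OF assms(1)] by simp
qed

lemma lead_slot_diag: "lead n \<phi> \<psi> \<Longrightarrow> lead n (app (slot_coeff X k i i 0) \<phi>) \<psi>"
  using lead_mult[of n \<phi> \<psi> "\<lambda>J. fps_exp (- of_int (sgn_bar X) * of_nat (of_bool (fst (J k) = i)))"]
  by (simp add: lead_def app_slot_coeff_diag)

lemma lead_rep_diag: "i \<in> {1..N} \<Longrightarrow> lead n \<phi> \<psi> \<Longrightarrow> lead n (app (rep N X Q i i $ 0) \<phi>) \<psi>"
  using lead_mult[of n \<phi> \<psi> "\<lambda>J. fps_exp (- of_int (sgn_bar X) * of_nat (occ Q J i))"]
  by (simp add: lead_def app_rep_diag)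

text \<open>Leibniz rule: among the intermediate indices and degrees (k, p), only (i, 0) and (j, r)
  leave one of the two factors at its degree-zero diagonal entry; all other terms contain two
  factors of order \<epsilon>.\<close>

lemma lead_rep:
  assumes "i \<in> {1..N}" "j \<in> {1..N}" "\<not> (r = 0 \<and> i = j)" "lead n \<phi> \<psi>"
  shows "lead (Suc n) (app (rep N X Q i j $ r) \<phi>) (\<lambda>J. - 2 * of_int (sgn_bar X) * (\<Sum>k<Q. move X k i j r \<psi> J))"
  using assms
proof (induction Q arbitrary: i j r n \<phi> \<psi>)
  case 0
  then have "app (rep N X 0 i j $ r) \<phi> = (\<lambda>_. 0)" by (auto simp: fun_eq_iff)
  then show ?case by (simp add: lead_zero)
next
  case (Suc Q)
  define tm where "tm = (\<lambda>(k, p). app (slot_coeff X Q i k p * rep N X Q k j $ (r - p)) \<phi>)"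
  define lt where "lt = (\<lambda>x J. if x = (i, 0) then - 2 * of_int (sgn_bar X) * (\<Sum>k<Q. move X k i j r \<psi> J)
     else if x = (j, r) then - 2 * of_int (sgn_bar X) * move X Q i j r \<psi> J else 0)"
  have ne: "(i, 0) \<noteq> (j, r)" using Suc.prems(3) by auto
  let ?S = "{1..N} \<times> {0..r}"
  have "lead (Suc n) (tm x) (lt x)" if "x \<in> ?S" for x
  proof -
    obtain k p where x: "x = (k, p)" by (cases x)
    have kp: "k \<in> {1..N}" "p \<le> r" using that by (auto simp: x)
    consider "x = (i, 0)" | "x = (j, r)" "x \<noteq> (i, 0)" | "x \<noteq> (i, 0)" "x \<noteq> (j, r)" by blast
    then show ?thesis
    proof cases
      case 1
      then show ?thesis
        using lead_slot_diag[OF Suc.IH[OF Suc.prems]] by (simp add: tm_def lt_def)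
    next
      case 2
      then have "lt x = (\<lambda>J. - 2 * of_int (sgn_bar X) * move X Q i j r \<psi> J)"
        by (simp only: lt_def) auto
      moreover have "tm x = app (slot_coeff X Q i j r) (app (rep N X Q j j $ 0) \<phi>)"
        using 2 by (simp add: tm_def)
      ultimately show ?thesis
        using lead_slot[OF Suc.prems(3) lead_rep_diag[OF Suc.prems(2,4)]] by (simp only:)
    next
      case 3
      have a: "\<not> (p = 0 \<and> i = k)" "\<not> (r - p = 0 \<and> k = j)" using 3 kp by (auto simp: x)
      have "lt x = (\<lambda>_. 0)" using 3 by (simp only: lt_def) auto
      moreover have "tm x = app (slot_coeff X Q i k p) (app (rep N X Q k j $ (r - p)) \<phi>)"
        by (simp add: tm_def x)
      ultimately show ?thesis
        using lead_Suc[OF lead_slot[OF a(1) Suc.IH[OF kp(1) Suc.prems(2) a(2) Suc.prems(4)]]] by (simp only:)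
    qed
  qed
  then have "lead (Suc n) (\<lambda>J. \<Sum>x\<in>?S. tm x J) (\<lambda>J. \<Sum>x\<in>?S. lt x J)"
    by (rule lead_sum)
  moreover have "(\<lambda>J. \<Sum>x\<in>?S. tm x J) = app (rep N X (Suc Q) i j $ r) \<phi>"
    by (rule ext) (simp add: fps_sum_nth fps_mult_nth slot_def app_sum tm_def
        sum.cartesian_product case_prod_unfold)
  moreover have "(\<Sum>x\<in>?S. lt x J) = - 2 * of_int (sgn_bar X) * (\<Sum>k<Suc Q. move X k i j r \<psi> J)" for J
  proof -
    have "(\<Sum>x\<in>?S. lt x J) = (\<Sum>x\<in>{(i, 0), (j, r)}. lt x J)"
      by (rule sum.mono_neutral_right) (use Suc.prems in \<open>auto simp: lt_def\<close>)
    also have "\<dots> = lt (i, 0) J + lt (j, r) J" using ne by simp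
    also have "lt (i, 0) J = - 2 * of_int (sgn_bar X) * (\<Sum>k<Q. move X k i j r \<psi> J)"
      by (simp only: lt_def) simp
    also have "lt (j, r) J = - 2 * of_int (sgn_bar X) * move X Q i j r \<psi> J"
      using ne by (simp only: lt_def) auto
    finally show ?thesis by (simp add: algebra_simps)
  qed
  ultimately show ?case by simp
qed

section \<open>Words acting on a configuration\<close>

fun gbar :: "gen \<Rightarrow> bool" where "gbar (T i j r) = False" | "gbar (Tb i j r) = True"
fun grow :: "gen \<Rightarrow> nat" where "grow (T i j r) = i" | "grow (Tb i j r) = i"
fun gcol :: "gen \<Rightarrow> nat" where "gcol (T i j r) = j" | "gcol (Tb i j r) = j"
fun glev :: "gen \<Rightarrow> nat" where "glev (T i j r) = r" | "glev (Tb i j r) = r"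

definition cartan :: "gen \<Rightarrow> bool" where "cartan g \<longleftrightarrow> grow g = gcol g \<and> glev g = 0"

abbreviation noncartan :: "gen list \<Rightarrow> gen list" where "noncartan w \<equiv> filter (\<lambda>g. \<not> cartan g) w"

lemma gen_op_eq: "gen_op N Q g = rep N (gbar g) Q (grow g) (gcol g) $ glev g"
  by (cases g) (simp_all add: gen_op_def)

lemma valid_gen_iff: "valid_gen N g \<longleftrightarrow> grow g \<in> {1..N} \<and> gcol g \<in> {1..N}"
  by (cases g) (simp_all add: valid_gen_def)

text \<open>A matrix coefficient of a product of derivations, counted in natural numbers: signs and
  factors are split off into \<open>lead_const\<close>, so different paths cannot cancel.\<close>

fun paths :: "nat \<Rightarrow> conf \<Rightarrow> gen list \<Rightarrow> conf \<Rightarrow> nat" where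
  "paths Q J0 [] J = of_bool (J = J0)"
| "paths Q J0 (g # w) J = (\<Sum>k<Q. move (gbar g) k (grow g) (gcol g) (glev g) (paths Q J0 w) J)"

definition delta :: "conf \<Rightarrow> conf \<Rightarrow> complex fps" where
  "delta J0 J = of_bool (J = J0)"

text \<open>The number -2 is the coefficient of \<epsilon> in exp(-\<epsilon>) -
  exp(\<epsilon>).\<close>

definition lead_const :: "gen list \<Rightarrow> complex" where
  "lead_const w = (\<Prod>g\<leftarrow>w. - 2 * of_int (sgn_bar (gbar g)))"

lemma lead_const_nonzero: "lead_const w \<noteq> 0"
  by (induction w) (auto simp: lead_const_def sgn_bar_def)

lemma lead_word:
  assumes "valid_word N w" "\<forall>g\<in>set w. \<not> cartan g"
  shows "lead (length w) (app (word_op N Q w) (delta J0)) (\<lambda>J. lead_const w * of_nat (paths Q J0 w J))"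
  using assms
proof (induction w)
  case Nil
  then show ?case by (simp add: lead_def delta_def lead_const_def)
next
  case (Cons g w)
  have mv: "move X k i j p (\<lambda>J. lead_const w * of_nat (f J)) J = lead_const w * of_nat (move X k i j p f J)"
    for X k i j p J and f :: "conf \<Rightarrow> nat"
    by (simp add: move_def)
  have "lead (Suc (length w)) (app (rep N (gbar g) Q (grow g) (gcol g) $ glev g) (app (word_op N Q w) (delta J0)))
    (\<lambda>J. - 2 * of_int (sgn_bar (gbar g)) *
      (\<Sum>k<Q. move (gbar g) k (grow g) (gcol g) (glev g) (\<lambda>J. lead_const w * of_nat (paths Q J0 w J)) J))"
    using Cons by (intro lead_rep Cons.IH) (auto simp: valid_word_def valid_gen_iff cartan_def)
  moreover have "lead_const (g # w) = - 2 * of_int (sgn_bar (gbar g)) * lead_const w"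
    by (simp add: lead_const_def)
  ultimately show ?case
    by (simp add: gen_op_eq mv sum_distrib_left[symmetric] mult.assoc)
qed

section \<open>Extracting the Cartan letters\<close>

definition has_weight :: "nat \<Rightarrow> (nat \<Rightarrow> int) \<Rightarrow> (conf \<Rightarrow> complex fps) \<Rightarrow> bool" where
  "has_weight Q \<nu> \<phi> \<longleftrightarrow> (\<forall>J. \<phi> J \<noteq> 0 \<longrightarrow> (\<forall>i. int (occ Q J i) = \<nu> i))"

lemma has_weight_sum:
  "(\<And>x. x \<in> A \<Longrightarrow> has_weight Q \<nu> (\<phi> x)) \<Longrightarrow> has_weight Q \<nu> (\<lambda>J. \<Sum>x\<in>A. \<phi> x J)"
  unfolding has_weight_def by (metis sum.not_neutral_contains_not_neutral)

lemma occ_upd: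
  assumes "k < Q"
  shows "int (occ Q J m) = int (occ Q (J(k := (i, n))) m) + of_bool (m = fst (J k)) - of_bool (m = i)"
proof -
  have "occ Q J m = card ({l. l < Q \<and> l \<noteq> k \<and> fst (J l) = m} \<union> (if fst (J k) = m then {k} else {}))"
    unfolding occ_def by (rule arg_cong[of _ _ card]) (use assms in auto)
  also have "\<dots> = card {l. l < Q \<and> l \<noteq> k \<and> fst (J l) = m} + of_bool (m = fst (J k))"
    by (subst card_Un_disjoint) auto
  finally have 1: "occ Q J m = card {l. l < Q \<and> l \<noteq> k \<and> fst (J l) = m} + of_bool (m = fst (J k))" .
  have "occ Q (J(k := (i, n))) m = card ({l. l < Q \<and> l \<noteq> k \<and> fst (J l) = m} \<union> (if i = m then {k} else {}))"
    unfolding occ_def by (rule arg_cong[of _ _ card]) (use assms in auto)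
  also have "\<dots> = card {l. l < Q \<and> l \<noteq> k \<and> fst (J l) = m} + of_bool (m = i)"
    by (subst card_Un_disjoint) auto
  finally show ?thesis using 1 by simp
qed

lemma has_weight_slot:
  assumes "has_weight Q \<nu> \<phi>" "k < Q"
  shows "has_weight Q (\<lambda>m. \<nu> m + of_bool (m = j) - of_bool (m = i)) (app (slot_coeff X k i j p) \<phi>)"
proof (cases "p = 0 \<and> i = j")
  case True
  then show ?thesis using assms by (auto simp: has_weight_def app_slot_coeff_diag)
next
  case False
  show ?thesis
    unfolding has_weight_def app_slot_coeff[OF False]
  proof (intro allI impI)
    fix J m assume "of_int (sgn_bar X) * hbar_fps * move X k i j p \<phi> J \<noteq> 0"
    then have "fst (J k) = j" "\<phi> (J(k := (i, snd (J k) + sgn_bar X * int p))) \<noteq> 0"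
      by (auto simp: move_def split: if_splits)
    then show "int (occ Q J m) = \<nu> m + of_bool (m = j) - of_bool (m = i)"
      using assms(1) occ_upd[OF assms(2), of J m i "snd (J k) + sgn_bar X * int p"]
      unfolding has_weight_def by auto
  qed
qed

lemma has_weight_rep:
  assumes "has_weight Q' \<nu> \<phi>" "Q \<le> Q'"
  shows "has_weight Q' (\<lambda>m. \<nu> m + of_bool (m = j) - of_bool (m = i)) (app (rep N X Q i j $ r) \<phi>)"
  using assms
proof (induction Q arbitrary: i j r)
  case 0
  then show ?case by (cases "i = j"; cases "r = 0") (auto simp: has_weight_def)
next
  case (Suc Q)
  have "has_weight Q' (\<lambda>m. \<nu> m + of_bool (m = j) - of_bool (m = i))
      (app (slot_coeff X Q i k p) (app (rep N X Q k j $ (r - p)) \<phi>))" for k p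
  proof -
    have "has_weight Q' (\<lambda>m. \<nu> m + of_bool (m = j) - of_bool (m = k)) (app (rep N X Q k j $ (r - p)) \<phi>)"
      using Suc by simp
    from has_weight_slot[OF this, of Q k i X p] Suc.prems show ?thesis by simp
  qed
  then have "has_weight Q' (\<lambda>m. \<nu> m + of_bool (m = j) - of_bool (m = i))
      (\<lambda>J. \<Sum>k\<in>{1..N}. \<Sum>p\<in>{0..r}. app (slot_coeff X Q i k p) (app (rep N X Q k j $ (r - p)) \<phi>) J)"
    by (intro has_weight_sum)
  moreover have "app (rep N X (Suc Q) i j $ r) \<phi> =
      (\<lambda>J. \<Sum>k\<in>{1..N}. \<Sum>p\<in>{0..r}. app (slot_coeff X Q i k p) (app (rep N X Q k j $ (r - p)) \<phi>) J)"
    by (rule ext) (simp add: fps_sum_nth fps_mult_nth slot_def app_sum)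
  ultimately show ?case by simp
qed

definition wt_shift :: "gen list \<Rightarrow> nat \<Rightarrow> int" where
  "wt_shift w m = (\<Sum>g\<leftarrow>w. of_bool (m = gcol g) - of_bool (m = grow g))"

text \<open>A Cartan letter sees the weight after the letters to its right have acted; Cartan
  letters preserve the weight, so the correction involves \<open>noncartan w\<close> only.\<close>

fun cartan_exp :: "gen list \<Rightarrow> (nat \<Rightarrow> int) \<Rightarrow> int" where
  "cartan_exp [] \<nu> = 0"
| "cartan_exp (g # w) \<nu> = cartan_exp w \<nu> -
     (if cartan g then sgn_bar (gbar g) * (\<nu> (grow g) + wt_shift (noncartan w) (grow g)) else 0)"

lemma has_weight_word:
  assumes "has_weight Q \<nu> \<phi>"
  shows "has_weight Q (\<lambda>m. \<nu> m + wt_shift w m) (app (word_op N Q w) \<phi>)"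
proof (induction w)
  case Nil
  then show ?case using assms by (simp add: wt_shift_def)
next
  case (Cons g w)
  show ?case using has_weight_rep[OF Cons, of Q "gcol g" "grow g" N "gbar g" "glev g"]
    by (simp add: gen_op_eq wt_shift_def algebra_simps)
qed

lemma word_op_cartan:
  assumes "has_weight Q \<nu> \<phi>" "valid_word N w"
  shows "app (word_op N Q w) \<phi> = (\<lambda>J. fps_exp (of_int (cartan_exp w \<nu>)) * app (word_op N Q (noncartan w)) \<phi> J)"
  using assms(2)
proof (induction w)
  case (Cons g w)
  let ?\<theta> = "app (word_op N Q (noncartan w)) \<phi>"
  have IH: "app (word_op N Q w) \<phi> = (\<lambda>J. fps_exp (of_int (cartan_exp w \<nu>)) * ?\<theta> J)"
    using Cons by (simp add: valid_word_def)
  have *: "app (word_op N Q (g # w)) \<phi> = (\<lambda>J. fps_exp (of_int (cartan_exp w \<nu>)) * app (gen_op N Q g) ?\<theta> J)"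
    by (simp add: IH app_scale_fun)
  show ?case
  proof (cases "cartan g")
    case False
    then show ?thesis using * by simp
  next
    case True
    have g: "grow g \<in> {1..N}" using Cons.prems by (auto simp: valid_word_def valid_gen_iff)
    have "app (gen_op N Q g) ?\<theta> J = fps_exp (- of_int (sgn_bar (gbar g)) *
        of_int (\<nu> (grow g) + wt_shift (noncartan w) (grow g))) * ?\<theta> J" for J
    proof (cases "?\<theta> J = 0")
      case True
      then show ?thesis using \<open>cartan g\<close> g by (simp add: gen_op_eq cartan_def app_rep_diag)
    next
      case False
      then have "int (occ Q J (grow g)) = \<nu> (grow g) + wt_shift (noncartan w) (grow g)"
        using has_weight_word[OF assms(1), of "noncartan w" N] by (auto simp: has_weight_def)
      then have "(of_nat (occ Q J (grow g)) :: complex) = of_int (\<nu> (grow g) + wt_shift (noncartan w) (grow g))"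
        by (metis of_int_of_nat_eq)
      then show ?thesis using \<open>cartan g\<close> g app_rep_diag[OF g, of "gbar g" Q ?\<theta> J]
        by (simp add: gen_op_eq cartan_def)
    qed
    then have "app (word_op N Q (g # w)) \<phi> J = fps_exp (of_int (cartan_exp w \<nu>)) *
        fps_exp (- of_int (sgn_bar (gbar g)) * of_int (\<nu> (grow g) + wt_shift (noncartan w) (grow g))) * ?\<theta> J" for J
      unfolding * by simp
    moreover have "fps_exp (of_int (cartan_exp w \<nu>)) *
        fps_exp (- of_int (sgn_bar (gbar g)) * of_int (\<nu> (grow g) + wt_shift (noncartan w) (grow g))) =
        fps_exp (of_int (cartan_exp (g # w) \<nu>) :: complex)"
      unfolding fps_exp_add_mult[symmetric] using True by simp
    ultimately show ?thesis using True by (simp add: fun_eq_iff)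
  qed
qed simp

definition cartan_mult :: "gen list \<Rightarrow> nat \<Rightarrow> int" where
  "cartan_mult w i = (\<Sum>g\<leftarrow>w. if cartan g \<and> grow g = i then sgn_bar (gbar g) else 0)"

text \<open>The linear part in \<open>\<nu>\<close> is what will separate words with the same
  non-Cartan letters; the constant records only where the Cartan letters stand.\<close>

lemma cartan_exp_affine:
  assumes "valid_word N w"
  shows "cartan_exp w \<nu> = cartan_exp w (\<lambda>_. 0) - (\<Sum>i\<in>{1..N}. cartan_mult w i * \<nu> i)"
  using assms
proof (induction w)
  case Nil
  then show ?case by (simp add: cartan_mult_def)
next
  case (Cons g w)
  have g: "grow g \<in> {1..N}" and w: "valid_word N w"
    using Cons.prems by (auto simp: valid_word_def valid_gen_iff)
  have "(\<Sum>i\<in>{1..N}. cartan_mult (g # w) i * \<nu> i) = (\<Sum>i\<in>{1..N}. cartan_mult w i * \<nu> i) +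
      (\<Sum>i\<in>{1..N}. if i = grow g then (if cartan g then sgn_bar (gbar g) * \<nu> (grow g) else 0) else 0)"
    unfolding sum.distrib[symmetric] by (rule sum.cong) (auto simp: cartan_mult_def algebra_simps)
  also have "\<dots> = (\<Sum>i\<in>{1..N}. cartan_mult w i * \<nu> i) + (if cartan g then sgn_bar (gbar g) * \<nu> (grow g) else 0)"
    using g by (simp add: sum.delta)
  finally show ?case using Cons.IH[OF w] by (auto simp: algebra_simps)
qed


section \<open>Linear independence\<close>

text \<open>All power moments of \<open>c\<close> at the points \<open>g s\<close> vanish, hence so
  does the pairing with every polynomial; one that is zero at all points but \<open>g s0\<close>
  isolates \<open>c s0\<close>.\<close>

lemma fps_exp_independent:
  fixes c g :: "'s \<Rightarrow> complex"
  assumes S: "finite S" and inj: "inj_on g S"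
    and eq: "(\<Sum>s\<in>S. fps_const (c s) * fps_exp (g s)) = 0" and s0: "s0 \<in> S"
  shows "c s0 = 0"
proof -
  have pow: "(\<Sum>s\<in>S. c s * g s ^ n) = 0" for n
  proof -
    have "(\<Sum>s\<in>S. c s * (g s ^ n / fact n)) = 0"
      using arg_cong[OF eq, of "\<lambda>f. f $ n"] by (simp add: fps_sum_nth)
    then have "(\<Sum>s\<in>S. c s * g s ^ n) / fact n = 0"
      by (simp add: sum_divide_distrib)
    then show ?thesis by simp
  qed
  define q where "q = (\<Prod>t\<in>S - {s0}. [:- g t, 1:])"
  have "(\<Sum>s\<in>S. c s * poly q (g s)) = (\<Sum>i\<le>degree q. coeff q i * (\<Sum>s\<in>S. c s * g s ^ i))"
    unfolding poly_altdef sum_distrib_left by (subst sum.swap) (simp add: algebra_simps)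
  also have "\<dots> = 0" by (simp add: pow)
  finally have "(\<Sum>s\<in>S. c s * poly q (g s)) = 0" .
  moreover have "(\<Sum>s\<in>S. c s * poly q (g s)) = (\<Sum>s\<in>{s0}. c s * poly q (g s))"
    using S s0 by (intro sum.mono_neutral_right) (auto simp: q_def poly_prod prod_zero_iff)
  moreover have "poly q (g s0) \<noteq> 0"
    using S s0 inj by (auto simp: q_def poly_prod prod_zero_iff inj_on_def)
  ultimately show ?thesis by simp
qed

section \<open>Recovering ordered monomials from their invariants\<close>

lemma inj_gkey: "inj gkey"
proof (rule injI)
  fix x y assume "gkey x = gkey y"
  then show "x = y" by (cases x; cases y) auto
qed

lemma sorted_mset_unique:
  assumes "sorted (map gkey v)" "sorted (map gkey w)" "mset v = mset w"
  shows "v = w"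
proof -
  have "mset (map gkey v) = mset (map gkey w)" using assms(3) by simp
  then have "map gkey v = map gkey w"
    using assms(1,2) by (metis properties_for_sort)
  then show ?thesis using inj_gkey by (simp add: inj_map_eq_map)
qed

lemma cartan_cases: "cartan g \<longleftrightarrow> (\<exists>i. g = T i i 0 \<or> g = Tb i i 0)"
  by (cases g) (auto simp: cartan_def)

lemma cartan_mult_count:
  "cartan_mult w i = int (count (mset w) (T i i 0)) - int (count (mset w) (Tb i i 0))"
proof (induction w)
  case (Cons g w)
  have "(if cartan g \<and> grow g = i then sgn_bar (gbar g) else 0) = of_bool (g = T i i 0) - of_bool (g = Tb i i 0)"
    by (cases g) (auto simp: cartan_def sgn_bar_def)
  then show ?case using Cons by (auto simp: cartan_mult_def)
qed (simp add: cartan_mult_def)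

text \<open>For each \<open>i\<close> at most one of \<open>T i i 0\<close> and
  \<open>Tb i i 0\<close> occurs, so the difference of their multiplicities determines both;
  sortedness does the rest.\<close>

lemma ordered_monomial_unique:
  assumes v: "ordered_monomial N v" and w: "ordered_monomial N w"
    and nc: "noncartan v = noncartan w"
    and cm: "\<And>i. i \<in> {1..N} \<Longrightarrow> cartan_mult v i = cartan_mult w i"
  shows "v = w"
proof (rule sorted_mset_unique)
  show "sorted (map gkey v)" "sorted (map gkey w)" using v w by (auto simp: ordered_monomial_def)
  show "mset v = mset w"
  proof (rule multiset_eqI)
    fix g
    show "count (mset v) g = count (mset w) g"
    proof (cases "cartan g")
      case False
      then have "count (mset u) g = count (mset (noncartan u)) g" for u by simp
      then show ?thesis using nc by metis
    next
      case True
      then obtain i where i: "g = T i i 0 \<or> g = Tb i i 0" by (auto simp: cartan_cases)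
      show ?thesis
      proof (cases "i \<in> {1..N}")
        case False
        then have "g \<notin> set v" "g \<notin> set w"
          using v w i by (auto simp: ordered_monomial_def valid_word_def valid_gen_def)
        then show ?thesis by (metis count_mset_0_iff)
      next
        case True
        have ex: "count (mset u) (T i i 0) = 0 \<or> count (mset u) (Tb i i 0) = 0" if "ordered_monomial N u" for u
          using that True by (auto simp: ordered_monomial_def count_mset_0_iff)
        have "count (mset v) (T i i 0) = count (mset w) (T i i 0)"
          using ex[OF v] ex[OF w] cm[OF True] unfolding cartan_mult_count by (elim disjE; linarith)
        moreover have "count (mset v) (Tb i i 0) = count (mset w) (Tb i i 0)"
          using ex[OF v] ex[OF w] cm[OF True] unfolding cartan_mult_count by (elim disjE; linarith)
        ultimately show ?thesis using i by blast
      qed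
    qed
  qed
qed

text \<open>The label of a letter in the loop algebra basis. At degree zero \<open>T\<close>
  supplies the entries below the diagonal and \<open>Tb\<close> those above; at positive degree the
  sign of the exponent distinguishes them.\<close>

definition transition :: "gen \<Rightarrow> nat \<times> nat \<times> int" where
  "transition g = (grow g, gcol g, sgn_bar (gbar g) * int (glev g))"

lemma inj_transition: "inj_on transition {g. \<not> zero_gen g \<and> \<not> cartan g}"
proof (rule inj_onI)
  fix x y assume "x \<in> {g. \<not> zero_gen g \<and> \<not> cartan g}" "y \<in> {g. \<not> zero_gen g \<and> \<not> cartan g}"
    "transition x = transition y"
  then show "x = y"
    by (cases x; cases y) (auto simp: transition_def sgn_bar_def zero_gen_def cartan_def)
qed

text \<open>Each letter acts in one factor. If as many factors have changed as there are letters, no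
  factor was used twice, and the changes list the transitions of the letters.\<close>

lemma paths_nonzero:
  assumes "paths Q J0 w J \<noteq> 0"
  defines "D \<equiv> {k. J k \<noteq> J0 k}"
  shows "finite D \<and> card D \<le> length w \<and> (card D = length w \<longrightarrow>
     image_mset (\<lambda>k. (fst (J0 k), fst (J k), snd (J0 k) - snd (J k))) (mset_set D) = mset (map transition w))"
  using assms(1) unfolding D_def
proof (induction w arbitrary: J)
  case Nil
  then show ?case by simp
next
  case (Cons g w)
  let ?tr = "\<lambda>J k. (fst (J0 k), fst (J k), snd (J0 k) - snd (J k))"
  obtain k where k: "k < Q" "move (gbar g) k (grow g) (gcol g) (glev g) (paths Q J0 w) J \<noteq> 0"
    using Cons.prems by (auto simp: sum_eq_0_iff)
  define J' where "J' = J(k := (grow g, snd (J k) + sgn_bar (gbar g) * int (glev g)))"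
  have J': "fst (J k) = gcol g" "paths Q J0 w J' \<noteq> 0"
    using k(2) by (auto simp: move_def J'_def split: if_splits)
  let ?D = "{k. J k \<noteq> J0 k}" and ?D' = "{k. J' k \<noteq> J0 k}"
  have IH: "finite ?D'" "card ?D' \<le> length w"
    "card ?D' = length w \<Longrightarrow> image_mset (?tr J') (mset_set ?D') = mset (map transition w)"
    using Cons.IH[OF J'(2)] by auto
  have sub: "?D \<subseteq> insert k ?D'" "?D - {k} = ?D' - {k}" by (auto simp: J'_def split: if_splits)
  have fin: "finite ?D" using sub(1) IH(1) finite_subset by blast
  have "card ?D \<le> card (insert k ?D')" using sub(1) IH(1) by (intro card_mono) auto
  also have "\<dots> \<le> Suc (card ?D')" by (simp add: card_insert_le_m1 IH(1) card_insert_if)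
  finally have le: "card ?D \<le> Suc (card ?D')" .
  have "image_mset (?tr J) (mset_set ?D) = mset (map transition (g # w))" if eq: "card ?D = length (g # w)"
  proof -
    have c: "card ?D' = length w" using le IH(2) eq by simp
    have notin: "k \<notin> ?D'"
    proof
      assume "k \<in> ?D'"
      then have "card ?D \<le> card ?D'" using sub(1) IH(1) by (intro card_mono) auto
      then show False using c eq by simp
    qed
    have "k \<in> ?D"
    proof (rule ccontr)
      assume "k \<notin> ?D"
      then have "card ?D \<le> card ?D'" using sub(1) IH(1) by (intro card_mono) auto
      then show False using c eq by simp
    qed
    then have D: "?D = insert k ?D'" using sub(2) notin by blast
    have "image_mset (?tr J) (mset_set ?D) = add_mset (?tr J k) (image_mset (?tr J) (mset_set ?D'))"
      unfolding D using IH(1) notin by simp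
    also have "image_mset (?tr J) (mset_set ?D') = image_mset (?tr J') (mset_set ?D')"
    proof (rule image_mset_cong)
      fix x assume "x \<in># mset_set ?D'"
      then have "x \<noteq> k" using notin IH(1) by (metis elem_mset_set)
      then show "?tr J x = ?tr J' x" by (simp add: J'_def)
    qed
    also have "?tr J k = transition g"
    proof -
      have "J0 k = (grow g, snd (J k) + sgn_bar (gbar g) * int (glev g))"
        using notin by (simp add: J'_def)
      then show ?thesis using J'(1) by (simp add: transition_def)
    qed
    finally show ?thesis using IH(3)[OF c] by simp
  qed
  then show ?case using fin le IH(2) by auto
qed

section \<open>The matrix coefficient that detects one word\<close>

definition source_conf :: "nat list \<Rightarrow> conf" where
  "source_conf xs k = (if k < length xs then xs ! k else 0, 0)"

text \<open>The stages of the path on which the k-th letter acts in the k-th factor: words act from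
  the right, so after \<open>drop n v\<close> the factors below \<open>n\<close> are still at the
  source. Sources carry rows and targets columns because operators act on functions.\<close>

definition target_conf :: "gen list \<Rightarrow> nat \<Rightarrow> nat list \<Rightarrow> conf" where
  "target_conf v n xs k = (if n \<le> k \<and> k < length v
     then (gcol (v ! k), - sgn_bar (gbar (v ! k)) * int (glev (v ! k))) else source_conf (map grow v @ xs) k)"

lemma paths_target_pos:
  assumes "\<forall>g\<in>set v. \<not> zero_gen g \<and> \<not> cartan g" "n \<le> length v"
  shows "paths (length v + length xs) (source_conf (map grow v @ xs)) (drop n v) (target_conf v n xs) > 0"
  using assms(2)
proof (induction n rule: inc_induct)
  case base
  then show ?case by (auto simp: target_conf_def fun_eq_iff)
next
  case (step n)
  let ?J0 = "source_conf (map grow v @ xs)" and ?Q = "length v + length xs"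
  define g where "g = v ! n"
  have g: "\<not> zero_gen g" "\<not> cartan g" using assms(1) step(2) by (auto simp: g_def)
  have upd: "(target_conf v n xs)(n := (grow g, 0)) = target_conf v (Suc n) xs"
    using step(2) by (auto simp: target_conf_def source_conf_def fun_eq_iff g_def nth_append)
  have tn: "target_conf v n xs n = (gcol g, - sgn_bar (gbar g) * int (glev g))"
    using step(2) by (simp add: target_conf_def g_def)
  have "glev g \<noteq> 0 \<or> (if gbar g then grow g < gcol g else gcol g < grow g)"
    using g by (cases g) (auto simp: zero_gen_def cartan_def)
  then have "move (gbar g) n (grow g) (gcol g) (glev g) (paths ?Q ?J0 (drop (Suc n) v)) (target_conf v n xs)
      = paths ?Q ?J0 (drop (Suc n) v) (target_conf v (Suc n) xs)"
    by (simp add: move_def tn upd)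
  then have "0 < move (gbar g) n (grow g) (gcol g) (glev g) (paths ?Q ?J0 (drop (Suc n) v)) (target_conf v n xs)"
    using step(3) by simp
  also have "\<dots> \<le> (\<Sum>k<?Q. move (gbar g) k (grow g) (gcol g) (glev g) (paths ?Q ?J0 (drop (Suc n) v)) (target_conf v n xs))"
    using step(2) by (intro member_le_sum) auto
  also have "\<dots> = paths ?Q ?J0 (drop n v) (target_conf v n xs)"
    using Cons_nth_drop_Suc[OF step(2)] by (metis g_def paths.simps(2))
  finally show ?case .
qed

text \<open>All \<open>length v\<close> letter positions have changed, so a word no longer than
  \<open>v\<close> must spend each of its letters on a factor of its own; its transitions are then
  those of \<open>v\<close>.\<close>

lemma paths_target_unique:
  assumes v: "\<forall>g\<in>set v. \<not> zero_gen g \<and> \<not> cartan g" "sorted (map gkey v)"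
    and w: "\<forall>g\<in>set w. \<not> zero_gen g \<and> \<not> cartan g" "sorted (map gkey w)"
    and len: "length w \<le> length v"
    and ne: "paths Q (source_conf (map grow v @ xs)) w (target_conf v 0 xs) \<noteq> 0"
  shows "w = v"
proof (rule sorted_mset_unique[OF w(2) v(2)])
  let ?JS = "source_conf (map grow v @ xs)" and ?JT = "target_conf v 0 xs"
  have in_v: "(fst (?JS k), fst (?JT k), snd (?JS k) - snd (?JT k)) = transition (v ! k)" if "k < length v" for k
    using that by (simp add: source_conf_def target_conf_def transition_def nth_append)
  have "?JT k \<noteq> ?JS k" if "k < length v" for k
  proof
    assume "?JT k = ?JS k"
    then have "transition (v ! k) = (grow (v ! k), grow (v ! k), 0)"
      using in_v[OF that] by (metis diff_self fst_conv transition_def)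
    then have "cartan (v ! k)" by (auto simp: transition_def cartan_def sgn_bar_def split: if_splits)
    then show False using v(1) that by auto
  qed
  then have D: "{k. ?JT k \<noteq> ?JS k} = {..<length v}" by (auto simp: target_conf_def)
  have "image_mset (\<lambda>k. (fst (?JS k), fst (?JT k), snd (?JS k) - snd (?JT k))) (mset_set {..<length v}) = mset (map transition w)"
    using paths_nonzero[OF ne] len unfolding D by auto
  moreover have "image_mset (\<lambda>k. (fst (?JS k), fst (?JT k), snd (?JS k) - snd (?JT k))) (mset_set {..<length v})
      = image_mset (\<lambda>k. transition (v ! k)) (mset_set {..<length v})"
    by (rule image_mset_cong) (use in_v in auto)
  moreover have "image_mset (\<lambda>k. transition (v ! k)) (mset_set {..<length v}) = mset (map transition v)"
  proof -
    have "map transition v = map (\<lambda>k. transition (v ! k)) [0..<length v]"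
      by (rule nth_equalityI) simp_all
    then have "mset (map transition v) = mset (map (\<lambda>k. transition (v ! k)) [0..<length v])"
      by (rule arg_cong)
    then show ?thesis by (simp add: atLeast0LessThan)
  qed
  ultimately have eq: "image_mset transition (mset w) = image_mset transition (mset v)" by simp
  let ?h = "inv_into {g. \<not> zero_gen g \<and> \<not> cartan g} transition"
  have inv: "image_mset ?h (image_mset transition (mset u)) = mset u"
    if "\<forall>g\<in>set u. \<not> zero_gen g \<and> \<not> cartan g" for u
  proof -
    have "image_mset (?h \<circ> transition) (mset u) = image_mset id (mset u)"
      by (rule image_mset_cong) (use that inj_transition in \<open>auto simp: inv_into_f_f\<close>)
    then show ?thesis by (simp add: image_mset.compositionality)
  qed
  show "mset w = mset v" using inv[OF w(1)] inv[OF v(1)] eq by metis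
qed

lemma ex_list_count:
  fixes N :: nat
  shows "\<exists>xs. \<forall>i. count_list xs i = (if i \<in> {1..N} then d i else 0)"
proof (induction N)
  case 0
  show ?case by (rule exI[of _ "[]"]) simp
next
  case (Suc N)
  then obtain xs where xs: "\<forall>i. count_list xs i = (if i \<in> {1..N} then d i else 0)" by blast
  have "count_list (replicate n x) i = (if i = x then n else 0)" for n and x i :: nat
    by (induction n) auto
  then show ?case using xs by (intro exI[of _ "xs @ replicate (d (Suc N)) (Suc N)"]) auto
qed

lemma occ_source_conf: "occ (length xs) (source_conf xs) i = count_list xs i"
proof -
  have "occ (length xs) (source_conf xs) i = length (filter (\<lambda>x. x = i) xs)"
    unfolding occ_def source_conf_def length_filter_conv_card by (rule arg_cong[of _ _ card]) auto
  also have "\<dots> = count_list xs i" by (induction xs) auto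
  finally show ?thesis .
qed

text \<open>With weights B^i the difference of two exponents is a polynomial in B, nonzero by
  \<open>ordered_monomial_unique\<close>. Finitely many such polynomials have finitely many roots to
  avoid.\<close>

lemma ex_separating_base:
  assumes S: "finite S" "\<forall>w\<in>S. ordered_monomial N w" and K: "\<And>w. finite (K w :: int set)"
  shows "\<exists>B\<ge>b. \<forall>w\<in>S. \<forall>w'\<in>S. \<forall>e\<in>K w. \<forall>e'\<in>K w'. w \<noteq> w' \<longrightarrow> noncartan w = noncartan w' \<longrightarrow>
     e + cartan_exp w (\<lambda>i. int B ^ i) \<noteq> e' + cartan_exp w' (\<lambda>i. int B ^ i)"
proof -
  define q :: "gen list \<times> gen list \<times> int \<times> int \<Rightarrow> int poly" where
    "q = (\<lambda>(w, w', e, e'). (\<Sum>i\<in>{1..N}. monom (cartan_mult w' i - cartan_mult w i) i) +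
       [:e + cartan_exp w (\<lambda>_. 0) - e' - cartan_exp w' (\<lambda>_. 0):])"
  define X where "X = {(w, w', e, e'). w \<in> S \<and> w' \<in> S \<and> e \<in> K w \<and> e' \<in> K w' \<and> w \<noteq> w' \<and> noncartan w = noncartan w'}"
  have "X \<subseteq> S \<times> S \<times> (\<Union>w\<in>S. K w) \<times> (\<Union>w\<in>S. K w)" by (auto simp: X_def)
  then have finX: "finite X" using S K by (rule_tac finite_subset) auto
  have q0: "q t \<noteq> 0" if tX: "t \<in> X" for t
  proof -
    obtain w w' e e' where t: "t = (w, w', e, e')" by (cases t)
    then have *: "w \<in> S" "w' \<in> S" "w \<noteq> w'" "noncartan w = noncartan w'" using tX by (auto simp: X_def)
    then obtain i where i: "i \<in> {1..N}" "cartan_mult w i \<noteq> cartan_mult w' i"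
      using ordered_monomial_unique[of N w w'] S(2) by blast
    \<comment> \<open>Since \<open>i\<close> is at least 1, the constant summand of
      \<open>q t\<close> does not reach this coefficient.\<close>
    have "coeff (q t) i = (\<Sum>k\<in>{1..N}. if k = i then cartan_mult w' k - cartan_mult w k else 0)"
      using i(1) by (auto simp: q_def t coeff_sum coeff_pCons split: nat.splits)
    also have "\<dots> = cartan_mult w' i - cartan_mult w i" using i(1) by simp
    finally have "coeff (q t) i \<noteq> 0" using i(2) by simp
    then show ?thesis by auto
  qed
  have "finite (\<Union>t\<in>X. int -` {x. poly (q t) x = 0})"
    using finX q0 by (intro finite_UN_I finite_vimageI poly_roots_finite) auto
  from finite_nat_set_iff_bounded[THEN iffD1, OF this]
  obtain m where m: "\<forall>n\<in>(\<Union>t\<in>X. int -` {x. poly (q t) x = 0}). n < m" ..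
  define B where "B = max b m"
  have "e + cartan_exp w (\<lambda>i. int B ^ i) \<noteq> e' + cartan_exp w' (\<lambda>i. int B ^ i)"
    if "w \<in> S" "w' \<in> S" "e \<in> K w" "e' \<in> K w'" "w \<noteq> w'" "noncartan w = noncartan w'" for w w' e e'
  proof
    assume eq: "e + cartan_exp w (\<lambda>i. int B ^ i) = e' + cartan_exp w' (\<lambda>i. int B ^ i)"
    have val: "valid_word N w" "valid_word N w'" using that S(2) by (auto simp: ordered_monomial_def)
    have "poly (q (w, w', e, e')) (int B) = (\<Sum>i\<in>{1..N}. (cartan_mult w' i - cartan_mult w i) * int B ^ i) +
        (e + cartan_exp w (\<lambda>_. 0) - e' - cartan_exp w' (\<lambda>_. 0))"
      by (simp add: q_def poly_sum poly_monom)
    also have "\<dots> = 0"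
      using eq cartan_exp_affine[OF val(1), of "\<lambda>i. int B ^ i"] cartan_exp_affine[OF val(2), of "\<lambda>i. int B ^ i"]
      by (simp add: left_diff_distrib sum_subtractf)
    finally have "B \<in> (\<Union>t\<in>X. int -` {x. poly (q t) x = 0})" using that by (auto simp: X_def)
    with m have "B < m" by (rule bspec)
    then show False by (simp add: B_def)
  qed
  then show ?thesis by (intro exI[of _ B]) (auto simp: B_def)
qed

lemma fps_mult_nth_boundary:
  fixes f g :: "'a::comm_ring_1 fps"
  assumes "\<And>i. i < a \<Longrightarrow> f $ i = 0" "\<And>i. i < b \<Longrightarrow> g $ i = 0" "n \<le> a + b"
  shows "(f * g) $ n = (if n = a + b then f $ a * g $ b else 0)"
proof -
  have "(f * g) $ n = (\<Sum>i=0..n. if i = a \<and> n = a + b then f $ a * g $ b else 0)"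
    unfolding fps_mult_nth
  proof (rule sum.cong)
    fix i assume "i \<in> {0..n}"
    then consider "i < a" | "n - i < b" | "i = a" "n = a + b" using assms(3) by fastforce
    then show "f $ i * g $ (n - i) = (if i = a \<and> n = a + b then f $ a * g $ b else 0)"
      using assms(1)[of i] assms(2)[of "n - i"] by cases auto
  qed simp
  then show ?thesis by (cases "n = a + b") auto
qed

text \<open>Expanding the coefficients gives exponentials indexed by pairs (w, e), whose exponents
  differ across words by \<open>sep\<close> and within a word through e.\<close>

lemma exp_combination_nonzero:
  assumes S: "finite S" "w0 \<in> S" "c w0 \<noteq> 0"
    and sep: "\<And>w w' e e'. w \<in> S \<Longrightarrow> w' \<in> S \<Longrightarrow> e \<in> Poly_Mapping.keys (c w) \<Longrightarrow>
       e' \<in> Poly_Mapping.keys (c w') \<Longrightarrow> w \<noteq> w' \<Longrightarrow> e + E w \<noteq> e' + E w'"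
  shows "(\<Sum>w\<in>S. exp_hom (c w) * fps_exp (of_int (E w))) \<noteq> 0"
proof
  let ?X = "Sigma S (\<lambda>w. Poly_Mapping.keys (c w))"
  assume "(\<Sum>w\<in>S. exp_hom (c w) * fps_exp (of_int (E w))) = 0"
  moreover have "exp_hom (c w) * fps_exp (of_int (E w)) =
      (\<Sum>e\<in>Poly_Mapping.keys (c w). fps_const (Poly_Mapping.lookup (c w) e) * fps_exp (of_int (e + E w)))" for w
    by (simp add: exp_hom_def sum_distrib_right fps_exp_add_mult mult.assoc)
  ultimately have "(\<Sum>(w, e)\<in>?X. fps_const (Poly_Mapping.lookup (c w) e) * fps_exp (of_int (e + E w))) = 0"
    using S(1) by (simp add: sum.Sigma)
  then have eq: "(\<Sum>x\<in>?X. fps_const (Poly_Mapping.lookup (c (fst x)) (snd x)) * fps_exp (of_int (snd x + E (fst x)))) = 0"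
    by (simp add: case_prod_unfold)
  have inj: "inj_on (\<lambda>x. of_int (snd x + E (fst x)) :: complex) ?X"
  proof (rule inj_onI)
    fix x y assume xy: "x \<in> ?X" "y \<in> ?X" "(of_int (snd x + E (fst x)) :: complex) = of_int (snd y + E (fst y))"
    then have "snd x + E (fst x) = snd y + E (fst y)" by (simp only: of_int_eq_iff)
    moreover from this have "fst x = fst y" using sep[of "fst x" "fst y" "snd x" "snd y"] xy by force
    ultimately show "x = y" by (simp add: prod_eq_iff)
  qed
  obtain e where e: "e \<in> Poly_Mapping.keys (c w0)" using S(3) by (metis all_not_in_conv keys_eq_empty)
  have "Poly_Mapping.lookup (c w0) e = 0"
    using fps_exp_independent[OF _ inj eq, of "(w0, e)"] S e by (simp add: finite_SigmaI)
  then show False using e by (simp add: in_keys_iff)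
qed

lemma ordered_monomials_independent:
  assumes fin: "finite {w. c w \<noteq> 0}" and ord: "\<forall>w. c w \<noteq> 0 \<longrightarrow> ordered_monomial N w"
    and ideal: "c \<in> rel_ideal N"
  shows "c = fzero"
proof (rule ccontr)
  assume "c \<noteq> fzero"
  define S where "S = {w. c w \<noteq> 0}"
  have S: "finite S" "\<forall>w\<in>S. ordered_monomial N w" "S \<noteq> {}"
    using fin ord \<open>c \<noteq> fzero\<close> by (auto simp: S_def fzero_def)
  \<comment> \<open>The lower bound makes B exceed the length of every word, so that B^i copies of
    the index i leave room for its letters.\<close>
  obtain B where B: "B \<ge> Suc (Max (length ` S))" and
    sep: "\<And>w w' e e'. w \<in> S \<Longrightarrow> w' \<in> S \<Longrightarrow> e \<in> Poly_Mapping.keys (c w) \<Longrightarrow> e' \<in> Poly_Mapping.keys (c w') \<Longrightarrow>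
     w \<noteq> w' \<Longrightarrow> noncartan w = noncartan w' \<Longrightarrow>
     e + cartan_exp w (\<lambda>i. int B ^ i) \<noteq> e' + cartan_exp w' (\<lambda>i. int B ^ i)"
    using ex_separating_base[OF S(1,2), of "\<lambda>w. Poly_Mapping.keys (c w)" "Suc (Max (length ` S))"] by auto
  define \<nu> where "\<nu> i = (if i \<in> {1..N} then int B ^ i else 0)" for i
  have val: "valid_word N w" if "w \<in> S" for w using that S(2) by (auto simp: ordered_monomial_def)
  have cexp: "cartan_exp w \<nu> = cartan_exp w (\<lambda>i. int B ^ i)" if "w \<in> S" for w
  proof -
    have "(\<Sum>i\<in>{1..N}. cartan_mult w i * \<nu> i) = (\<Sum>i\<in>{1..N}. cartan_mult w i * int B ^ i)"
      by (rule sum.cong) (simp_all add: \<nu>_def)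
    then show ?thesis
      using cartan_exp_affine[OF val[OF that], of \<nu>] cartan_exp_affine[OF val[OF that], of "\<lambda>i. int B ^ i"]
      by simp
  qed
  define V where "V = noncartan ` S"
  define F where "F v = (\<Sum>w\<in>{w \<in> S. noncartan w = v}. exp_hom (c w) * fps_exp (of_int (cartan_exp w \<nu>)))" for v
  have V: "finite V" "V \<noteq> {}" using S by (auto simp: V_def)
  have V_props: "valid_word N v" "\<forall>g\<in>set v. \<not> zero_gen g \<and> \<not> cartan g" "sorted (map gkey v)" "length v < B"
    if vV: "v \<in> V" for v
  proof -
    obtain w where w: "w \<in> S" "v = noncartan w" using vV by (auto simp: V_def)
    then have "ordered_monomial N w" using S(2) by blast
    then show "valid_word N v" "\<forall>g\<in>set v. \<not> zero_gen g \<and> \<not> cartan g" "sorted (map gkey v)"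
      by (auto simp: w ordered_monomial_def valid_word_def sorted_filter)
    have "length v \<le> length w" by (simp add: w)
    also have "\<dots> \<le> Max (length ` S)" using w S(1) by (intro Max_ge) auto
    finally show "length v < B" using B by simp
  qed
  have F_nz: "F v \<noteq> 0" if vV: "v \<in> V" for v
  proof -
    obtain w where w: "w \<in> S" "v = noncartan w" using vV by (auto simp: V_def)
    show ?thesis
      unfolding F_def
    proof (rule exp_combination_nonzero)
      show "finite {w \<in> S. noncartan w = v}" using S(1) by simp
      show "w \<in> {w \<in> S. noncartan w = v}" "c w \<noteq> 0" using w by (auto simp: S_def)
    qed (use sep cexp in auto)
  qed
  define M where "M = Min ((\<lambda>v. subdegree (F v) + length v) ` V)"
  define V0 where "V0 = {v \<in> V. subdegree (F v) + length v = M}"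
  have M_le: "M \<le> subdegree (F v) + length v" if "v \<in> V" for v
    using that V(1) by (auto simp: M_def)
  have "M \<in> (\<lambda>v. subdegree (F v) + length v) ` V"
    unfolding M_def using V by (intro Min_in) auto
  then have V0: "finite V0" "V0 \<noteq> {}" using V(1) by (auto simp: V0_def)
  then have "Max (length ` V0) \<in> length ` V0" by (intro Max_in) auto
  then obtain v0 where v0: "v0 \<in> V0" "length v0 = Max (length ` V0)" by auto
  have v0_max: "length v \<le> length v0" if "v \<in> V0" for v
    using that V0 v0(2) by simp
  have v0V: "v0 \<in> V" using v0 by (simp add: V0_def)
  \<comment> \<open>Further factors are added until the index i occurs B^i times. The subtraction
    does not truncate: the count is at most \<open>length v0\<close>, which is less than B.\<close>
  from ex_list_count[of N "\<lambda>i. B ^ i - count_list (map grow v0) i"]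
  obtain xs where xs: "\<forall>i. count_list xs i = (if i \<in> {1..N} then B ^ i - count_list (map grow v0) i else 0)" ..
  define Q where "Q = length v0 + length xs"
  define J0 where "J0 = source_conf (map grow v0 @ xs)"
  define J where "J = target_conf v0 0 xs"
  have "has_weight Q \<nu> (delta J0)"
    unfolding has_weight_def
  proof (intro allI impI)
    fix J i assume "delta J0 J \<noteq> 0"
    then have J: "J = J0" by (simp add: delta_def split: if_splits)
    have "occ Q J i = count_list (map grow v0) i + count_list xs i"
      using occ_source_conf[of "map grow v0 @ xs" i] by (simp add: J J0_def Q_def)
    also have "int \<dots> = \<nu> i"
    proof (cases "i \<in> {1..N}")
      case True
      have "count_list (map grow v0) i \<le> length (map grow v0)" by (rule count_le_length)
      also have "\<dots> \<le> B" using V_props(4)[OF v0V] by simp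
      also have "B \<le> B ^ i" using True B by (intro self_le_power) auto
      finally have "count_list (map grow v0) i \<le> B ^ i" .
      then show ?thesis using True by (simp add: xs \<nu>_def)
    next
      case False
      then have "i \<notin> set (map grow v0)"
        using V_props(1)[OF v0V] by (auto simp: valid_word_def valid_gen_iff)
      then show ?thesis using False by (auto simp: xs \<nu>_def count_list_0_iff)
    qed
    finally show "int (occ Q J i) = \<nu> i" .
  qed
  note wc = word_op_cartan[OF this]
  define G where "G v = app (word_op N Q v) (delta J0) J" for v
  have "(0::complex fps) = app (ev N Q c) (delta J0) J" using ev_rel_ideal[OF ideal, of Q] by simp
  also have "\<dots> = (\<Sum>w\<in>S. exp_hom (c w) * app (word_op N Q w) (delta J0) J)"
    by (simp add: ev_def S_def app_sum app_scal)
  also have "\<dots> = (\<Sum>w\<in>S. exp_hom (c w) * fps_exp (of_int (cartan_exp w \<nu>)) * G (noncartan w))"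
    by (rule sum.cong) (simp_all add: wc[OF val] G_def mult.assoc)
  also have "\<dots> = (\<Sum>v\<in>V. \<Sum>w\<in>{w \<in> S. noncartan w = v}. exp_hom (c w) * fps_exp (of_int (cartan_exp w \<nu>)) * G (noncartan w))"
    unfolding V_def by (rule sum.image_gen[OF S(1)])
  also have "\<dots> = (\<Sum>v\<in>V. F v * G v)"
    unfolding F_def sum_distrib_right by (intro sum.cong) auto
  finally have "(\<Sum>v\<in>V. (F v * G v) $ M) = 0"
    by (metis fps_sum_nth fps_zero_nth)
  \<comment> \<open>Outside \<open>V0\<close> the product has order above \<open>M\<close>; inside
    \<open>V0\<close> no word is longer than \<open>v0\<close>, so only \<open>v0\<close> reaches
    \<open>J\<close>.\<close>
  moreover have "(F v * G v) $ M = (if v = v0 then F v0 $ subdegree (F v0) * (lead_const v0 * of_nat (paths Q J0 v0 J)) else 0)"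
    if vV: "v \<in> V" for v
  proof -
    have l: "lead (length v) (app (word_op N Q v) (delta J0)) (\<lambda>J. lead_const v * of_nat (paths Q J0 v J))"
      using V_props[OF vV] by (intro lead_word) auto
    then have "(F v * G v) $ M = (if M = subdegree (F v) + length v then F v $ subdegree (F v) * G v $ length v else 0)"
      using M_le[OF vV] by (intro fps_mult_nth_boundary) (auto simp: lead_def G_def)
    moreover have "G v $ length v = lead_const v * of_nat (paths Q J0 v J)" using l by (simp add: lead_def G_def)
    moreover have "paths Q J0 v J = 0" if "M = subdegree (F v) + length v" "v \<noteq> v0"
      using paths_target_unique[of v0 v Q xs] V_props[OF v0V] V_props[OF vV] v0_max[of v] that vV
      by (auto simp: J0_def J_def V0_def)
    moreover have "M = subdegree (F v0) + length v0" using v0 by (simp add: V0_def)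
    ultimately show ?thesis by auto
  qed
  ultimately have "F v0 $ subdegree (F v0) * (lead_const v0 * of_nat (paths Q J0 v0 J)) = 0"
    using V(1) v0V by simp
  moreover have "paths Q J0 v0 J > 0"
    using paths_target_pos[of v0 0 xs] V_props(2)[OF v0V] by (simp add: Q_def J0_def J_def)
  ultimately show False
    using F_nz[OF v0V] lead_const_nonzero[of v0] by simp
qed

theorem theorem2p11:
  fixes N :: nat
  assumes "N \<ge> 1"
  shows "(\<forall>f :: falg. finite {w. f w \<noteq> 0} \<and> (\<forall>w. f w \<noteq> 0 \<longrightarrow> valid_word N w) \<longrightarrow>
            (\<exists>c :: falg. finite {w. c w \<noteq> 0} \<and> (\<forall>w. c w \<noteq> 0 \<longrightarrow> ordered_monomial N w) \<and>
                 fsub f c \<in> rel_ideal N))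
       \<and> (\<forall>c :: falg. finite {w. c w \<noteq> 0} \<and> (\<forall>w. c w \<noteq> 0 \<longrightarrow> ordered_monomial N w) \<and>
                 c \<in> rel_ideal N \<longrightarrow> c = fzero)"
  using ordered_monomials_span ordered_monomials_independent by blast

end
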